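(* Let $n=2k+1$ with $k\ge 1$, and let $D$ be the correspondence on the curve $C$ attached (see context) to coverings $\widetilde X\stackrel{\kappa}{\to}X\stackrel{\rho_n}{\to}Y$. Then $D$ satisfies the equation $$\prod_{i=0}^{k}\bigl(X+(-1)^{i+k+1}(2i+1)\bigr)=0,$$ and this polynomial has no multiple root.
   Context: All curves are over $\mathbb{C}$. Let $X,Y$ be smooth projective connected curves, $\rho_n:X\to Y$ a covering of degree $n$, and $\kappa:\widetilde X\to X$ an étale double cover which is not obtained by base change from a double cover of $Y$. For $x\in\widetilde X$ let $x'$ denote the other point of the fibre of $\kappa$ through $x$. Assume $\rho_n$ is ramified and simply ramified (each fibre contains at most one ramification point, and its ramification index is $2$). Let $\widetilde C\subset\widetilde X^{(n)}$ be the fibre product of $\kappa^{(n)}:\widetilde X^{(n)}\to X^{(n)}$ with the map $Y\to X^{(n)}$, $y\mapsto\rho_n^*(y)$; its points over $y$ are the divisors $x_1+\dots+x_n$ with $\kappa(x_1)+\dots+\kappa(x_n)=\rho_n^*(y)$. Let $\sigma$ be the involution $x_1+\dots+x_n\mapsto x_1'+\dots+x_n'$ of $\widetilde C$. Standing hypothesis: $\widetilde C$ is smooth with exactly two connected components $\widetilde C_1,\widetilde C_2$. For $n$ odd, $\sigma$ exchanges the two components; put $C=\widetilde C/\sigma\cong\widetilde C_1\cong\widetilde C_2$. Let $D_i\subset\widetilde C_i\times\widetilde C_i$ be the reduced curve $\{(x_1+\dots+x_n,\ x_1+x_2'+\dots+x_n')\}$ (for all ways of singling out one of the $n$ points), and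 let $D\subset C\times C$ be the image of $D_i$ (which does not depend on $i$). For a point $z\in C$, $D(z)=p_{2*}(p_1^*z\cdot D)$, where $p_1,p_2$ are the projections; identifying $C$ with $\widetilde C_1$, for $z=x_1+\dots+x_n$ the divisor $D(z)$ is the sum over $i=1,\dots,n$ of the points $x_i+\sum_{j\ne i}x_j'$. "$D$ satisfies the equation $P(X)=0$" ($P\in\mathbb{Z}[X]$) means that $P(D)=0$, powers being compositions of correspondences, i.e. $P(D)(z)=0$ as a divisor for all $z\in C$; then the endomorphism of the Jacobian $JC$ induced by $D$ (denoted by the same letter) also satisfies $P(D)=0$. *)

theory Defs
  imports "HOL-Complex_Analysis.Complex_Analysis" "HOL-Library.Poly_Mapping"
    "HOL-Library.Multiset" "HOL-Computational_Algebra.Computational_Algebra"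
begin

text \<open>
  Smooth projective curves over the complex numbers are represented by compact Riemann surfaces,
  finite morphisms by holomorphic maps with finite fibres. A surface is a topology together with
  an atlas; a chart is a pair of its domain and its coordinate function.
\<close>

section \<open>Compact Riemann surfaces\<close>

record 'a surface =
  stop :: "'a topology"
  charts :: "('a set \<times> ('a \<Rightarrow> complex)) set"

abbreviation pts :: "'a surface \<Rightarrow> 'a set" where
  "pts R \<equiv> topspace (stop R)"

definition riemann_surface :: "'a surface \<Rightarrow> bool" where
  "riemann_surface R \<longleftrightarrow>
     Hausdorff_space (stop R) \<and>
     (\<Union>(U, \<phi>)\<in>charts R. U) = pts R \<and>
     (\<forall>(U, \<phi>)\<in>charts R. openin (stop R) U \<and> open (\<phi> ` U) \<and>
        homeomorphic_map (subtopology (stop R) U) (top_of_set (\<phi> ` U)) \<phi>) \<and>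
     (\<forall>(U, \<phi>)\<in>charts R. \<forall>(V, \<psi>)\<in>charts R.
        (\<lambda>u. \<psi> (inv_into U \<phi> u)) holomorphic_on \<phi> ` (U \<inter> V))"

text \<open>Second countability follows from compactness.\<close>

definition compact_riemann_surface :: "'a surface \<Rightarrow> bool" where
  "compact_riemann_surface R \<longleftrightarrow> riemann_surface R \<and> compact_space (stop R)"

definition connected_surface :: "'a surface \<Rightarrow> bool" where
  "connected_surface R \<longleftrightarrow> pts R \<noteq> {} \<and> connected_space (stop R)"

definition holomorphic_map :: "'a surface \<Rightarrow> 'b surface \<Rightarrow> ('a \<Rightarrow> 'b) \<Rightarrow> bool" where
  "holomorphic_map R S f \<longleftrightarrow>
     continuous_map (stop R) (stop S) f \<and>
     (\<forall>(U, \<phi>)\<in>charts R. \<forall>(V, \<psi>)\<in>charts S.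
        (\<lambda>u. \<psi> (f (inv_into U \<phi> u))) holomorphic_on \<phi> ` {x \<in> U. f x \<in> V})"

text \<open>
  An injective holomorphic function on an open set, which need not be contained in a chart of the
  given atlas nor be connected.
\<close>

definition local_coordinate :: "'a surface \<Rightarrow> 'a set \<Rightarrow> ('a \<Rightarrow> complex) \<Rightarrow> bool" where
  "local_coordinate R U \<phi> \<longleftrightarrow>
     openin (stop R) U \<and> inj_on \<phi> U \<and>
     (\<forall>(V, \<psi>)\<in>charts R. (\<lambda>u. \<phi> (inv_into V \<psi> u)) holomorphic_on \<psi> ` (U \<inter> V))"

section \<open>Coverings\<close>

text \<open>The value does not depend on the two charts.\<close>

definition ramification_index :: "'a surface \<Rightarrow> 'b surface \<Rightarrow> ('a \<Rightarrow> 'b) \<Rightarrow> 'a \<Rightarrow> nat" where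
  "ramification_index R S f x =
     (THE e. \<exists>(U, \<phi>)\<in>charts R. \<exists>(V, \<psi>)\<in>charts S. x \<in> U \<and> f x \<in> V \<and>
        e = nat (zorder (\<lambda>u. \<psi> (f (inv_into U \<phi> u)) - \<psi> (f x)) (\<phi> x)))"

definition fibre :: "'a surface \<Rightarrow> ('a \<Rightarrow> 'b) \<Rightarrow> 'b \<Rightarrow> 'a set" where
  "fibre R f y = {x \<in> pts R. f x = y}"

definition covering :: "'a surface \<Rightarrow> 'b surface \<Rightarrow> ('a \<Rightarrow> 'b) \<Rightarrow> nat \<Rightarrow> bool" where
  "covering R S f n \<longleftrightarrow>
     holomorphic_map R S f \<and>
     (\<forall>y\<in>pts S. finite (fibre R f y) \<and> (\<Sum>x\<in>fibre R f y. ramification_index R S f x) = n)"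

definition ramification_point :: "'a surface \<Rightarrow> 'b surface \<Rightarrow> ('a \<Rightarrow> 'b) \<Rightarrow> 'a \<Rightarrow> bool" where
  "ramification_point R S f x \<longleftrightarrow> x \<in> pts R \<and> ramification_index R S f x \<noteq> 1"

definition ramified :: "'a surface \<Rightarrow> 'b surface \<Rightarrow> ('a \<Rightarrow> 'b) \<Rightarrow> bool" where
  "ramified R S f \<longleftrightarrow> (\<exists>x. ramification_point R S f x)"

definition simply_ramified :: "'a surface \<Rightarrow> 'b surface \<Rightarrow> ('a \<Rightarrow> 'b) \<Rightarrow> bool" where
  "simply_ramified R S f \<longleftrightarrow>
     (\<forall>x. ramification_point R S f x \<longrightarrow> ramification_index R S f x = 2) \<and>
     (\<forall>x x'. ramification_point R S f x \<and> ramification_point R S f x' \<and> f x = f x' \<longrightarrow> x = x')"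

definition etale_double_cover :: "'a surface \<Rightarrow> 'b surface \<Rightarrow> ('a \<Rightarrow> 'b) \<Rightarrow> bool" where
  "etale_double_cover R S f \<longleftrightarrow> covering R S f 2 \<and> \<not> ramified R S f"

text \<open>
  The cover \<open>\<kappa>\<close> is the base change along \<open>\<rho>\<close> of a double cover of \<open>Y\<close>. Any double cover of
  \<open>Y\<close> has at most two points in each fibre, so that it can be carried by the type
  \<^typ>\<open>'y \<times> bool\<close>; it may be disconnected. For \<open>\<pi>\<close> unramified the fibre product is a Riemann
  surface, and a bijective holomorphic map onto it is an isomorphism. If \<open>\<kappa>\<close> is etale and each
  fibre of \<open>\<rho>\<close> contains an unramified point, then the bijection forces \<open>\<pi>\<close> to be unramified.
\<close>

definition base_change_of_double_cover ::
  "'t surface \<Rightarrow> 'x surface \<Rightarrow> 'y surface \<Rightarrow> ('t \<Rightarrow> 'x) \<Rightarrow> ('x \<Rightarrow> 'y) \<Rightarrow> bool" where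
  "base_change_of_double_cover T X Y \<kappa> \<rho> \<longleftrightarrow>
     (\<exists>(Z :: ('y \<times> bool) surface) \<pi> F.
        compact_riemann_surface Z \<and> covering Z Y \<pi> 2 \<and> holomorphic_map T Z F \<and>
        bij_betw (\<lambda>t. (\<kappa> t, F t)) (pts T) {(x, z). x \<in> pts X \<and> z \<in> pts Z \<and> \<rho> x = \<pi> z})"

definition other_point :: "'t surface \<Rightarrow> ('t \<Rightarrow> 'x) \<Rightarrow> 't \<Rightarrow> 't" where
  "other_point T \<kappa> x = (THE x'. x' \<in> pts T \<and> \<kappa> x' = \<kappa> x \<and> x' \<noteq> x)"

definition pullback_divisor ::
  "'a surface \<Rightarrow> 'b surface \<Rightarrow> ('a \<Rightarrow> 'b) \<Rightarrow> 'b \<Rightarrow> 'a multiset" where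
  "pullback_divisor R S f y = (\<Sum>x\<in>fibre R f y. replicate_mset (ramification_index R S f x) x)"

section \<open>Symmetric products\<close>

definition quotient_topology :: "'a topology \<Rightarrow> ('a \<Rightarrow> 'b) \<Rightarrow> 'b topology" where
  "quotient_topology T q =
     topology (\<lambda>W. W \<subseteq> q ` topspace T \<and> openin T {x \<in> topspace T. q x \<in> W})"

lemma openin_quotient_topology:
  "openin (quotient_topology T q) W \<longleftrightarrow>
     W \<subseteq> q ` topspace T \<and> openin T {x \<in> topspace T. q x \<in> W}"
proof -
  have "istopology (\<lambda>W. W \<subseteq> q ` topspace T \<and> openin T {x \<in> topspace T. q x \<in> W})"
    unfolding istopology_def
  proof (intro conjI allI impI)
    fix S W
    assume "S \<subseteq> q ` topspace T \<and> openin T {x \<in> topspace T. q x \<in> S}"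
      and "W \<subseteq> q ` topspace T \<and> openin T {x \<in> topspace T. q x \<in> W}"
    moreover have "{x \<in> topspace T. q x \<in> S \<inter> W} =
        {x \<in> topspace T. q x \<in> S} \<inter> {x \<in> topspace T. q x \<in> W}"
      by auto
    ultimately show "S \<inter> W \<subseteq> q ` topspace T" "openin T {x \<in> topspace T. q x \<in> S \<inter> W}"
      by auto
  next
    fix \<K>
    assume *: "\<forall>K\<in>\<K>. K \<subseteq> q ` topspace T \<and> openin T {x \<in> topspace T. q x \<in> K}"
    then show "\<Union>\<K> \<subseteq> q ` topspace T" by auto
    have "{x \<in> topspace T. q x \<in> \<Union>\<K>} = (\<Union>K\<in>\<K>. {x \<in> topspace T. q x \<in> K})"
      by auto
    with * show "openin T {x \<in> topspace T. q x \<in> \<Union>\<K>}" by auto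
  qed
  then show ?thesis
    by (simp add: quotient_topology_def topology_inverse')
qed

lemma topspace_quotient_topology: "topspace (quotient_topology T q) = q ` topspace T"
proof
  show "topspace (quotient_topology T q) \<subseteq> q ` topspace T"
    using openin_quotient_topology[of T q] openin_topspace by blast
  have "{x \<in> topspace T. q x \<in> q ` topspace T} = topspace T" by auto
  then have "openin (quotient_topology T q) (q ` topspace T)"
    by (simp add: openin_quotient_topology)
  then show "q ` topspace T \<subseteq> topspace (quotient_topology T q)"
    by (rule openin_subset)
qed

lemma quotient_map_quotient_topology: "quotient_map T (quotient_topology T q) q"
  by (auto simp: quotient_map_def topspace_quotient_topology openin_quotient_topology)

text \<open>Points of the \<open>n\<close>-th symmetric product are effective divisors of degree \<open>n\<close>.\<close>

definition sym_topology :: "'a surface \<Rightarrow> nat \<Rightarrow> 'a multiset topology" where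
  "sym_topology R n =
     quotient_topology (product_topology (\<lambda>_. stop R) {..<n}) (\<lambda>x. mset (map x [0..<n]))"

text \<open>
  For a local coordinate \<open>\<phi>\<close> on \<open>U\<close>, the complex coordinates on the open subset \<open>U\<^sup>(\<^sup>n\<^sup>)\<close> of the
  symmetric product are the elementary symmetric functions of the values of \<open>\<phi>\<close>, up to sign. They
  are the coefficients below degree \<open>n\<close> of the following monic polynomial.
\<close>

definition sym_coordinate :: "('a \<Rightarrow> complex) \<Rightarrow> 'a multiset \<Rightarrow> complex poly" where
  "sym_coordinate \<phi> \<zeta> = (\<Prod>p\<in>#\<zeta>. [:- \<phi> p, 1:])"

section \<open>The fibre product\<close>

definition Ctilde ::
  "'t surface \<Rightarrow> 'x surface \<Rightarrow> 'y surface \<Rightarrow> ('t \<Rightarrow> 'x) \<Rightarrow> ('x \<Rightarrow> 'y) \<Rightarrow> 't multiset set" where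
  "Ctilde T X Y \<kappa> \<rho> =
     {z. set_mset z \<subseteq> pts T \<and> (\<exists>y\<in>pts Y. image_mset \<kappa> z = pullback_divisor X Y \<rho> y)}"

definition Ctilde_topology ::
  "'t surface \<Rightarrow> 'x surface \<Rightarrow> 'y surface \<Rightarrow> ('t \<Rightarrow> 'x) \<Rightarrow> ('x \<Rightarrow> 'y) \<Rightarrow> nat \<Rightarrow>
     't multiset topology" where
  "Ctilde_topology T X Y \<kappa> \<rho> n = subtopology (sym_topology T n) (Ctilde T X Y \<kappa> \<rho>)"

text \<open>
  The local expression, in symmetric coordinates, of the map induced by \<open>\<kappa>\<close> on symmetric products,
  and that of the map sending a point of \<open>Y\<close> to its pullback.
\<close>

definition sym_map_local ::
  "nat \<Rightarrow> 't set \<Rightarrow> ('t \<Rightarrow> complex) \<Rightarrow> ('t \<Rightarrow> 'x) \<Rightarrow> ('x \<Rightarrow> complex) \<Rightarrow>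
     complex poly \<Rightarrow> complex poly" where
  "sym_map_local n U \<phi> \<kappa> \<omega> a =
     sym_coordinate \<omega> (image_mset \<kappa>
       (inv_into {\<zeta>. size \<zeta> = n \<and> set_mset \<zeta> \<subseteq> U} (sym_coordinate \<phi>) a))"

definition pullback_local ::
  "'x surface \<Rightarrow> 'y surface \<Rightarrow> ('x \<Rightarrow> 'y) \<Rightarrow> 'y set \<Rightarrow> ('y \<Rightarrow> complex) \<Rightarrow> ('x \<Rightarrow> complex) \<Rightarrow>
     complex \<Rightarrow> complex poly" where
  "pullback_local X Y \<rho> W \<psi> \<omega> s =
     sym_coordinate \<omega> (pullback_divisor X Y \<rho> (inv_into W \<psi> s))"

text \<open>
  Smoothness of the fibre product as a complex space, not just of the underlying point set. Near
  \<open>(z, y)\<close> it is given by \<open>n\<close> equations in \<open>n + 1\<close> variables, and its dimension is one; hence it is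
  smooth there if and only if the Jacobian matrix of the equations has rank \<open>n\<close>, i.e.\ the
  difference of the differentials of the two maps is surjective.
\<close>

definition smooth_fibre_product_at ::
  "'t surface \<Rightarrow> 'x surface \<Rightarrow> 'y surface \<Rightarrow> ('t \<Rightarrow> 'x) \<Rightarrow> ('x \<Rightarrow> 'y) \<Rightarrow> nat \<Rightarrow>
     't multiset \<Rightarrow> 'y \<Rightarrow> bool" where
  "smooth_fibre_product_at T X Y \<kappa> \<rho> n z y \<longleftrightarrow>
     (\<exists>U \<phi> V \<omega> W \<psi>.
        local_coordinate T U \<phi> \<and> set_mset z \<subseteq> U \<and>
        local_coordinate X V \<omega> \<and> set_mset (pullback_divisor X Y \<rho> y) \<subseteq> V \<and>
        local_coordinate Y W \<psi> \<and> y \<in> W \<and>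
        (\<forall>b :: nat \<Rightarrow> complex. \<exists>(v :: nat \<Rightarrow> complex) (c :: complex). \<forall>i<n.
           (\<Sum>j<n. v j * deriv (\<lambda>t. coeff
               (sym_map_local n U \<phi> \<kappa> \<omega> (sym_coordinate \<phi> z + monom t j)) i) 0)
           - c * deriv (\<lambda>s. coeff (pullback_local X Y \<rho> W \<psi> \<omega> s) i) (\<psi> y) = b i))"

definition smooth_Ctilde ::
  "'t surface \<Rightarrow> 'x surface \<Rightarrow> 'y surface \<Rightarrow> ('t \<Rightarrow> 'x) \<Rightarrow> ('x \<Rightarrow> 'y) \<Rightarrow> nat \<Rightarrow> bool" where
  "smooth_Ctilde T X Y \<kappa> \<rho> n \<longleftrightarrow>
     (\<forall>z y. set_mset z \<subseteq> pts T \<and> y \<in> pts Y \<and> image_mset \<kappa> z = pullback_divisor X Y \<rho> y \<longrightarrow>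
        smooth_fibre_product_at T X Y \<kappa> \<rho> n z y)"

text \<open>
  The complex structure of the one-dimensional complex submanifold: charts are the inverses of
  local holomorphic parametrizations with nonzero derivative.
\<close>

definition Ctilde_surface ::
  "'t surface \<Rightarrow> 'x surface \<Rightarrow> 'y surface \<Rightarrow> ('t \<Rightarrow> 'x) \<Rightarrow> ('x \<Rightarrow> 'y) \<Rightarrow> nat \<Rightarrow>
     't multiset surface" where
  "Ctilde_surface T X Y \<kappa> \<rho> n =
     \<lparr>stop = Ctilde_topology T X Y \<kappa> \<rho> n,
      charts = {(U, t). openin (Ctilde_topology T X Y \<kappa> \<rho> n) U \<and> open (t ` U) \<and>
        homeomorphic_map (subtopology (Ctilde_topology T X Y \<kappa> \<rho> n) U) (top_of_set (t ` U)) t \<and>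
        (\<forall>z\<in>U. \<exists>V \<phi>. local_coordinate T V \<phi> \<and> set_mset z \<subseteq> V \<and>
           (\<forall>i<n. (\<lambda>u. coeff (sym_coordinate \<phi> (inv_into U t u)) i) analytic_on {t z}) \<and>
           (\<exists>i<n. deriv (\<lambda>u. coeff (sym_coordinate \<phi> (inv_into U t u)) i) (t z) \<noteq> 0))}\<rparr>"

section \<open>The curve \<open>C\<close> and the correspondence \<open>D\<close>\<close>

definition conj_divisor :: "'t surface \<Rightarrow> ('t \<Rightarrow> 'x) \<Rightarrow> 't multiset \<Rightarrow> 't multiset" where
  "conj_divisor T \<kappa> z = image_mset (other_point T \<kappa>) z"

text \<open>Points of \<open>C\<close> are the orbits of the involution \<open>\<sigma>\<close>, which is \<^const>\<open>conj_divisor\<close>.\<close>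

definition conj_orbit :: "'t surface \<Rightarrow> ('t \<Rightarrow> 'x) \<Rightarrow> 't multiset \<Rightarrow> 't multiset set" where
  "conj_orbit T \<kappa> z = {z, conj_divisor T \<kappa> z}"

definition C_surface ::
  "'t surface \<Rightarrow> 'x surface \<Rightarrow> 'y surface \<Rightarrow> ('t \<Rightarrow> 'x) \<Rightarrow> ('x \<Rightarrow> 'y) \<Rightarrow> nat \<Rightarrow>
     't multiset set surface" where
  "C_surface T X Y \<kappa> \<rho> n =
     \<lparr>stop = quotient_topology (Ctilde_topology T X Y \<kappa> \<rho> n) (conj_orbit T \<kappa>),
      charts = {(conj_orbit T \<kappa> ` U, \<lambda>c. t (inv_into U (conj_orbit T \<kappa>) c)) |U t.
        (U, t) \<in> charts (Ctilde_surface T X Y \<kappa> \<rho> n) \<and> inj_on (conj_orbit T \<kappa>) U}\<rparr>"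

text \<open>The pairs \<open>(x\<^sub>1 + \<dots> + x\<^sub>n, x\<^sub>1 + x\<^sub>2' + \<dots> + x\<^sub>n')\<close> whose first member lies in \<open>K\<close>.\<close>

definition flip_curve ::
  "'t surface \<Rightarrow> ('t \<Rightarrow> 'x) \<Rightarrow> 't multiset set \<Rightarrow> ('t multiset \<times> 't multiset) set" where
  "flip_curve T \<kappa> K = {(z, add_mset x (conj_divisor T \<kappa> (z - {#x#}))) |z x. z \<in> K \<and> x \<in># z}"

definition D_curve ::
  "'t surface \<Rightarrow> 'x surface \<Rightarrow> 'y surface \<Rightarrow> ('t \<Rightarrow> 'x) \<Rightarrow> ('x \<Rightarrow> 'y) \<Rightarrow>
     ('t multiset set \<times> 't multiset set) set" where
  "D_curve T X Y \<kappa> \<rho> = map_prod (conj_orbit T \<kappa>) (conj_orbit T \<kappa>) ` flip_curve T \<kappa> (Ctilde T X Y \<kappa> \<rho>)"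

text \<open>
  The definition uses both components at once. When \<open>\<sigma>\<close> exchanges them, either one of them alone
  has the same image; see \<open>D_curve_component\<close> below.
\<close>

lemma other_point_props:
  assumes "etale_double_cover T X \<kappa>" "x \<in> pts T"
  shows "other_point T \<kappa> x \<in> pts T" "\<kappa> (other_point T \<kappa> x) = \<kappa> x"
    "other_point T \<kappa> (other_point T \<kappa> x) = x"
proof -
  have "\<kappa> x \<in> pts X"
    using assms by (auto simp: etale_double_cover_def covering_def holomorphic_map_def
        dest: continuous_map_image_subset_topspace)
  then have "(\<Sum>x\<in>fibre T \<kappa> (\<kappa> x). ramification_index T X \<kappa> x) = 2"
    using assms(1) by (auto simp: etale_double_cover_def covering_def)
  moreover have "(\<Sum>x\<in>fibre T \<kappa> (\<kappa> x). ramification_index T X \<kappa> x) = (\<Sum>x\<in>fibre T \<kappa> (\<kappa> x). 1)"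
    using assms(1)
    by (intro sum.cong) (auto simp: etale_double_cover_def ramified_def ramification_point_def fibre_def)
  ultimately have "card (fibre T \<kappa> (\<kappa> x)) = 2" by simp
  then obtain a b where ab: "fibre T \<kappa> (\<kappa> x) = {a, b}" "a \<noteq> b"
    by (auto simp: card_2_iff)
  have other: "other_point T \<kappa> p = q"
    if pq: "fibre T \<kappa> (\<kappa> x) = {p, q}" "p \<noteq> q" for p q
  proof -
    have \<kappa>: "\<kappa> p = \<kappa> x" using pq(1) unfolding fibre_def by blast
    have "(x' \<in> pts T \<and> \<kappa> x' = \<kappa> p \<and> x' \<noteq> p) = (x' = q)" for x'
      unfolding \<kappa> using pq unfolding fibre_def by blast
    then show ?thesis by (simp add: other_point_def)
  qed
  have "x \<in> {a, b}" using assms(2) ab by (auto simp: fibre_def)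
  then obtain c where c: "fibre T \<kappa> (\<kappa> x) = {x, c}" "x \<noteq> c" using ab by blast
  have "other_point T \<kappa> x = c" "other_point T \<kappa> c = x"
    using other[of x c] other[of c x] c by auto
  with c show "other_point T \<kappa> x \<in> pts T" "\<kappa> (other_point T \<kappa> x) = \<kappa> x"
    "other_point T \<kappa> (other_point T \<kappa> x) = x"
    unfolding fibre_def by auto
qed

lemma conj_divisor_conj_divisor:
  assumes "etale_double_cover T X \<kappa>" "set_mset z \<subseteq> pts T"
  shows "conj_divisor T \<kappa> (conj_divisor T \<kappa> z) = z"
proof -
  have "image_mset (other_point T \<kappa> \<circ> other_point T \<kappa>) z = image_mset id z"
    by (rule image_mset_cong) (use assms other_point_props(3)[OF assms(1)] in auto)
  then show ?thesis by (simp add: conj_divisor_def multiset.map_comp)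
qed

lemma D_curve_component:
  assumes et: "etale_double_cover T X \<kappa>"
    and comp: "Ctilde T X Y \<kappa> \<rho> = K \<union> conj_divisor T \<kappa> ` K"
  shows "map_prod (conj_orbit T \<kappa>) (conj_orbit T \<kappa>) ` flip_curve T \<kappa> K = D_curve T X Y \<kappa> \<rho>"
proof
  show "map_prod (conj_orbit T \<kappa>) (conj_orbit T \<kappa>) ` flip_curve T \<kappa> K \<subseteq> D_curve T X Y \<kappa> \<rho>"
    unfolding D_curve_def using comp by (auto simp: flip_curve_def)
  show "D_curve T X Y \<kappa> \<rho> \<subseteq> map_prod (conj_orbit T \<kappa>) (conj_orbit T \<kappa>) ` flip_curve T \<kappa> K"
  proof
    fix p
    assume "p \<in> D_curve T X Y \<kappa> \<rho>"
    then obtain z x where z: "z \<in> Ctilde T X Y \<kappa> \<rho>" "x \<in># z"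
      and p: "p = (conj_orbit T \<kappa> z, conj_orbit T \<kappa> (add_mset x (conj_divisor T \<kappa> (z - {#x#}))))"
      unfolding D_curve_def flip_curve_def by auto
    have sub: "set_mset z \<subseteq> pts T" using z by (auto simp: Ctilde_def)
    show "p \<in> map_prod (conj_orbit T \<kappa>) (conj_orbit T \<kappa>) ` flip_curve T \<kappa> K"
    proof (cases "z \<in> K")
      case True
      then show ?thesis using z p by (force simp: flip_curve_def)
    next
      case False
      then obtain z' where z': "z' \<in> K" "z = conj_divisor T \<kappa> z'" using z comp by auto
      have sub': "set_mset z' \<subseteq> pts T"
        using z'(1) comp by (auto simp: Ctilde_def)
      have zz: "z' = conj_divisor T \<kappa> z" using z' conj_divisor_conj_divisor[OF et sub'] by simp
      define x' where "x' = other_point T \<kappa> x"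
      have x': "x' \<in># z'" using z(2) zz by (auto simp: x'_def conj_divisor_def)
      have x: "x \<in> pts T" using z(2) sub by auto
      define w where "w = z - {#x#}"
      have wz: "z = add_mset x w" using z(2) by (simp add: w_def)
      have w_sub: "set_mset w \<subseteq> pts T" using sub wz by auto
      have "z' = add_mset x' (conj_divisor T \<kappa> w)" using zz wz by (simp add: conj_divisor_def x'_def)
      then have "z' - {#x'#} = conj_divisor T \<kappa> w" by simp
      then have 1: "add_mset x' (conj_divisor T \<kappa> (z' - {#x'#})) = add_mset x' w"
        using conj_divisor_conj_divisor[OF et w_sub] by simp
      have "conj_divisor T \<kappa> (add_mset x' w) = add_mset x (conj_divisor T \<kappa> w)"
        using other_point_props(3)[OF et x] by (simp add: conj_divisor_def x'_def)
      moreover have "conj_divisor T \<kappa> (add_mset x (conj_divisor T \<kappa> w)) = add_mset x' w"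
        using conj_divisor_conj_divisor[OF et w_sub] by (simp add: conj_divisor_def x'_def)
      ultimately have "conj_orbit T \<kappa> (add_mset x' w) = conj_orbit T \<kappa> (add_mset x (conj_divisor T \<kappa> w))"
        by (auto simp: conj_orbit_def)
      moreover have "conj_orbit T \<kappa> z' = conj_orbit T \<kappa> z"
        using zz z'(2) by (auto simp: conj_orbit_def)
      ultimately have "p = map_prod (conj_orbit T \<kappa>) (conj_orbit T \<kappa>)
          (z', add_mset x' (conj_divisor T \<kappa> (z' - {#x'#})))"
        using p 1 by (simp add: w_def)
      moreover have "(z', add_mset x' (conj_divisor T \<kappa> (z' - {#x'#}))) \<in> flip_curve T \<kappa> K"
        using z'(1) x' by (auto simp: flip_curve_def)
      ultimately show ?thesis by blast
    qed
  qed
qed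

section \<open>Correspondences\<close>

definition holomorphic_on2 :: "(complex \<times> complex \<Rightarrow> complex) \<Rightarrow> (complex \<times> complex) set \<Rightarrow> bool" where
  "holomorphic_on2 g W \<longleftrightarrow>
     (\<forall>p\<in>W. \<exists>a b. (g has_derivative (\<lambda>(u, v). a * u + b * v)) (at p))"

text \<open>
  The multiplicity at \<open>(z, w)\<close> of the intersection of \<open>{z} \<times> R\<close> with a reduced curve \<open>D\<close> in
  \<open>R \<times> R\<close>: the colength of the ideal of germs vanishing on \<open>D\<close> after restriction to
  \<open>{z} \<times> R\<close>, i.e.\ the least order at \<open>w\<close> of the restriction of such a germ. It is attained by a
  local equation of \<open>D\<close>. The value is meaningful if \<open>D\<close> does not contain \<open>{z} \<times> R\<close> near
  \<open>(z, w)\<close>.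
\<close>

definition fibre_multiplicity :: "'a surface \<Rightarrow> ('a \<times> 'a) set \<Rightarrow> 'a \<Rightarrow> 'a \<Rightarrow> nat" where
  "fibre_multiplicity R D z w =
     (LEAST m. \<exists>(U, s)\<in>charts R. \<exists>(V, t)\<in>charts R. \<exists>W g.
        z \<in> U \<and> w \<in> V \<and> open W \<and> (s z, t w) \<in> W \<and> holomorphic_on2 g W \<and>
        (\<forall>a\<in>U. \<forall>b\<in>V. (a, b) \<in> D \<and> (s a, t b) \<in> W \<longrightarrow> g (s a, t b) = 0) \<and>
        (\<exists>\<^sub>F u in at (t w). g (s z, u) \<noteq> 0) \<and>
        m = nat (zorder (\<lambda>u. g (s z, u)) (t w)))"

text \<open>The divisor \<open>D(z) = p\<^sub>2\<^sub>* (p\<^sub>1\<^sup>* z \<cdot> D)\<close>; divisors are elements of \<^typ>\<open>'a \<Rightarrow>\<^sub>0 int\<close>.\<close>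

definition correspondence :: "'a surface \<Rightarrow> ('a \<times> 'a) set \<Rightarrow> 'a \<Rightarrow> ('a \<Rightarrow>\<^sub>0 int)" where
  "correspondence R D z =
     (\<Sum>w | (z, w) \<in> D. frag_cmul (int (fibre_multiplicity R D z w)) (frag_of w))"

text \<open>The divisor \<open>P(D)(z)\<close>; composition is composition of the linear extensions to divisors.\<close>

definition poly_correspondence :: "int poly \<Rightarrow> ('a \<Rightarrow> ('a \<Rightarrow>\<^sub>0 int)) \<Rightarrow> 'a \<Rightarrow> ('a \<Rightarrow>\<^sub>0 int)" where
  "poly_correspondence P E z =
     (\<Sum>i\<le>degree P. frag_cmul (coeff P i) ((frag_extend E ^^ i) (frag_of z)))"

definition satisfies_equation :: "'a surface \<Rightarrow> ('a \<times> 'a) set \<Rightarrow> int poly \<Rightarrow> bool" where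
  "satisfies_equation R D P \<longleftrightarrow> (\<forall>z\<in>pts R. poly_correspondence P (correspondence R D) z = 0)"

end

theory Submission
  imports Defs
begin

text \<open>
  Over a point of \<open>Y\<close> with \<open>n\<close> distinct preimages, a point of the fibre product chooses one of two
  lifts for each preimage, so that the fibre is the cube \<open>{0,1}\<^sup>n\<close>, the involution is the antipodal map
  and the fibre of \<open>C\<close> is the folded cube. Flipping all coordinates but one equals flipping that one
  coordinate up to the antipodal map, so \<open>D\<close> acts as the sum of the \<open>n\<close> commuting coordinate flips.
  The Walsh characters \<open>\<chi>\<^sub>A\<close>, for \<open>A\<close> a set of coordinates, diagonalise this sum with eigenvalue
  \<open>n - 2|A|\<close>. As \<open>\<chi>\<^sub>A\<close> changes sign under the antipodal map when \<open>|A|\<close> is odd, only even \<open>|A|\<close>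
  survive on the folded cube, and the eigenvalues \<open>2k + 1 - 4m\<close> with \<open>0 \<le> m \<le> k\<close> are exactly the
  roots of the polynomial. Each point of the fibre is, up to the factor \<open>2\<^sup>n\<close>, a sum of such
  eigenvectors, and the group of divisors has no torsion. This is \<open>folded_cube_equation\<close>; the roots
  are distinct because their absolute values are.

  The argument remains valid if several vertices of the cube give the same point. It therefore covers
  the ramified fibres too, provided that \<open>D(z)\<close> is there also the sum of the \<open>n\<close> flips of \<open>z\<close>, with
  repetitions. This amounts to \<open>multiplicity_eq_count\<close>: the intersection multiplicity at the flip of
  \<open>z\<close> in its member \<open>x\<close> is the multiplicity of \<open>x\<close> in \<open>z\<close>. For it to be enough, flips in different
  members must give different points of \<open>C\<close>. The reason is a parity: choose one point in each fibre
  of \<open>\<kappa>\<close> and count the members of \<open>z\<close> among the chosen ones. As \<open>n\<close> is odd, the involution always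
  changes the parity of this number, and a flip never does.

  The multiplicity is computed in a local model. At a ramification point \<open>\<rho>\<close> is the square in
  suitable coordinates, and \<open>\<kappa>\<close> is a local isomorphism. Let \<open>w\<close> be a coordinate of \<open>Y\<close> vanishing at
  the branch value, and \<open>x, x'\<close> the points of \<open>T\<close> above the ramification point. Near a divisor
  \<open>x + x + \<dots>\<close> the fibre product is parametrised by \<open>w\<close>, the two members moving as \<open>\<plusminus>\<surd>w\<close>; near
  \<open>x + x' + \<dots>\<close> it is parametrised by the coordinate \<open>b\<close> of the member near \<open>x\<close>, with \<open>w = b\<^sup>2\<close>
  (\<open>chart_double_point\<close>, \<open>chart_ramified\<close>).
  A flip in \<open>x\<close> leads from the first type to the second, where \<open>D\<close> has the equation \<open>u = v\<^sup>2\<close> and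
  hence multiplicity 2 over the first factor, and from the second to the first, with equation
  \<open>u\<^sup>2 = v\<close> and multiplicity 1. Any other flip preserves the type and leads to a local equation \<open>u = v\<close>.
  No function vanishing on \<open>D\<close> can have smaller order: multiplicity 1 only needs a zero, and for
  multiplicity 2 the zeros at \<open>b\<close> and \<open>-b\<close> over the same point collide as \<open>b \<rightarrow> 0\<close>
  (\<open>deriv_eq_0_if_two_zeros_collide\<close>).
\<close>

section \<open>The folded cube\<close>

abbreviation flip_bit :: "nat set \<Rightarrow> nat \<Rightarrow> nat set" where
  "flip_bit S i \<equiv> (if i \<in> S then S - {i} else insert i S)"

text \<open>
  The character \<open>\<chi>\<^sub>A\<close> of \<open>{0,1}\<^sup>N\<close>, with vertices of the cube encoded as subsets \<open>S\<close> of \<open>N\<close>.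
\<close>

definition walsh :: "nat set \<Rightarrow> nat set \<Rightarrow> int" where
  "walsh A S = (-1) ^ card (A \<inter> S)"

lemma walsh_flip_bit:
  assumes "finite A"
  shows "walsh A (flip_bit S i) = (if i \<in> A then - walsh A S else walsh A S)"
proof (cases "i \<in> A")
  case True
  show ?thesis
  proof (cases "i \<in> S")
    case iS: True
    have "A \<inter> S = insert i (A \<inter> (S - {i}))" using True iS by auto
    then have "card (A \<inter> S) = Suc (card (A \<inter> (S - {i})))"
      using assms by (metis Diff_iff IntD2 card_insert_disjoint finite_Int insertCI)
    then show ?thesis using True iS by (simp add: walsh_def)
  next
    case False
    have "A \<inter> insert i S = insert i (A \<inter> S)" using True by auto
    then have "card (A \<inter> insert i S) = Suc (card (A \<inter> S))"
      using assms False by (simp add: card_insert_if)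
    then show ?thesis using True False by (simp add: walsh_def)
  qed
next
  case False
  then have "A \<inter> flip_bit S i = A \<inter> S" by auto
  then show ?thesis using False by (simp add: walsh_def)
qed

lemma walsh_complement:
  assumes "A \<subseteq> N" "finite N"
  shows "walsh A (N - S) = (-1) ^ card A * walsh A S"
proof -
  have fin: "finite A" using assms by (rule finite_subset)
  have "A \<inter> (N - S) \<union> A \<inter> S = A" using assms by auto
  then have "card A = card (A \<inter> (N - S)) + card (A \<inter> S)"
    using card_Un_disjoint[of "A \<inter> (N - S)" "A \<inter> S"] fin by fastforce
  then show ?thesis by (simp add: walsh_def power_add mult.assoc flip: power_mult_distrib)
qed

text \<open>
  Orthogonality of characters: for nonempty \<open>S\<close>, toggling an element of \<open>S\<close> in \<open>A\<close> changes the sign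
  of the summand.
\<close>

lemma sum_walsh:
  assumes "finite N" "S \<subseteq> N"
  shows "(\<Sum>A\<in>Pow N. walsh A S) = (if S = {} then 2 ^ card N else 0)"
proof (cases "S = {}")
  case True
  then show ?thesis using assms by (simp add: walsh_def card_Pow)
next
  case False
  then obtain i where i: "i \<in> S" by auto
  have fin: "finite S" using assms by (auto intro: finite_subset)
  have "(\<Sum>A\<in>Pow N. walsh A S) = (\<Sum>A\<in>Pow N. walsh (flip_bit A i) S)"
    using assms i
    by (intro sum.reindex_bij_witness[where i="\<lambda>A. flip_bit A i" and j="\<lambda>A. flip_bit A i"])
      (auto split: if_splits simp: insert_absorb)
  also have "\<dots> = (\<Sum>A\<in>Pow N. - walsh A S)"
    using walsh_flip_bit[OF fin] i by (intro sum.cong) (simp_all add: walsh_def Int_commute)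
  also have "\<dots> = - (\<Sum>A\<in>Pow N. walsh A S)" by (simp add: sum_negf)
  finally show ?thesis using False by simp
qed

text \<open>
  The extension of \<^const>\<open>poly_correspondence\<close> from points to all divisors, needed because the
  eigenvectors are not points.
\<close>

definition poly_operator :: "int poly \<Rightarrow> ('a \<Rightarrow> 'a \<Rightarrow>\<^sub>0 int) \<Rightarrow> ('a \<Rightarrow>\<^sub>0 int) \<Rightarrow> ('a \<Rightarrow>\<^sub>0 int)" where
  "poly_operator P E v = (\<Sum>i\<le>degree P. frag_cmul (coeff P i) ((frag_extend E ^^ i) v))"

lemma poly_operator_sum:
  "finite I \<Longrightarrow> poly_operator P E (\<Sum>j\<in>I. v j) = (\<Sum>j\<in>I. poly_operator P E (v j))"
proof -
  assume I: "finite I"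
  have "(frag_extend E ^^ i) (\<Sum>j\<in>I. v j) = (\<Sum>j\<in>I. (frag_extend E ^^ i) (v j))" for i
    by (induction i) (simp_all add: frag_extend_sum[OF I, unfolded o_def])
  then show ?thesis
    unfolding poly_operator_def by (simp add: frag_cmul_sum sum.swap[of _ I])
qed

lemma poly_operator_cmul:
  "poly_operator P E (frag_cmul c v) = frag_cmul c (poly_operator P E v)"
proof -
  have "(frag_extend E ^^ i) (frag_cmul c v) = frag_cmul c ((frag_extend E ^^ i) v)" for i
    by (induction i) (simp_all add: frag_extend_cmul)
  then show ?thesis
    unfolding poly_operator_def by (simp add: frag_cmul_sum mult.commute)
qed

lemma poly_operator_eigenvector:
  assumes "frag_extend E v = frag_cmul l v"
  shows "poly_operator P E v = frag_cmul (poly P l) v"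
proof -
  have "(frag_extend E ^^ i) v = frag_cmul (l ^ i) v" for i
    by (induction i) (simp_all add: frag_extend_cmul assms mult.commute)
  moreover have "(\<Sum>i\<in>I. frag_cmul (f i) v) = frag_cmul (\<Sum>i\<in>I. f i) v" if "finite I" for f :: "nat \<Rightarrow> int" and I
    using that by (induction I) (simp_all add: frag_cmul_distrib)
  ultimately show ?thesis
    unfolding poly_operator_def by (simp add: poly_altdef)
qed

text \<open>
  The factor that vanishes at \<open>2k + 1 - 4m\<close> is the one with \<open>i = k - 2m\<close> or \<open>i = 2m - k - 1\<close>, depending
  on the sign of the eigenvalue.
\<close>

lemma poly_root_even_eigenvalue:
  assumes "m \<le> k"
  shows "poly (\<Prod>i\<le>k. [:(- 1) ^ (i + k + 1) * (2 * int i + 1), 1:]) (2 * int k + 1 - 4 * int m) = 0"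
proof -
  have "\<exists>i\<le>k. (- 1) ^ (i + k + 1) * (2 * int i + 1) + (2 * int k + 1 - 4 * int m) = 0"
  proof (cases "2 * m \<le> k")
    case True
    have "odd (k - 2 * m + k + 1)" using True by presburger
    then show ?thesis using True by (intro exI[of _ "k - 2 * m"]) (auto simp: of_nat_diff)
  next
    case False
    have "even (2 * m - k - 1 + k + 1)" using False by presburger
    then show ?thesis using False assms by (intro exI[of _ "2 * m - k - 1"]) (auto simp: of_nat_diff)
  qed
  then show ?thesis by (auto simp: poly_prod)
qed

text \<open>
  The vertices are mapped to arbitrary points by \<open>orb\<close>, which identifies antipodes and may identify
  more. The operator \<open>E\<close> sends a vertex to the sum of its neighbours, so every image \<open>v A\<close> of a character is an eigenvector or zero, and these images span a
  multiple of \<open>orb {}\<close>.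
\<close>

lemma folded_cube_equation:
  fixes orb :: "nat set \<Rightarrow> 'a" and E :: "'a \<Rightarrow> 'a \<Rightarrow>\<^sub>0 int"
  assumes n: "n = 2 * k + 1"
    and antipodal: "\<And>S. S \<subseteq> {..<n} \<Longrightarrow> orb ({..<n} - S) = orb S"
    and E: "\<And>S. S \<subseteq> {..<n} \<Longrightarrow> E (orb S) = (\<Sum>i<n. frag_of (orb (flip_bit S i)))"
  shows "poly_correspondence (\<Prod>i\<le>k. [:(- 1) ^ (i + k + 1) * (2 * int i + 1), 1:]) E (orb {}) = 0"
proof -
  define P where "P = (\<Prod>i\<le>k. [:(- 1) ^ (i + k + 1) * (2 * int i + 1), 1:])"
  define N where "N = {..<n}"
  have fN: "finite N" "finite (Pow N)" by (auto simp: N_def)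
  define v where "v A = (\<Sum>S\<in>Pow N. frag_cmul (walsh A S) (frag_of (orb S)))" for A
  have flip_v: "(\<Sum>S\<in>Pow N. frag_cmul (walsh A S) (frag_of (orb (flip_bit S i))))
      = (if i \<in> A then - v A else v A)" if "A \<subseteq> N" "i \<in> N" for A i
  proof -
    have fA: "finite A" using that fN by (auto intro: finite_subset)
    have "(\<Sum>S\<in>Pow N. frag_cmul (walsh A S) (frag_of (orb (flip_bit S i))))
        = (\<Sum>S\<in>Pow N. frag_cmul (walsh A (flip_bit S i)) (frag_of (orb S)))"
      using that
      by (intro sum.reindex_bij_witness[where i="\<lambda>A. flip_bit A i" and j="\<lambda>A. flip_bit A i"])
        (auto split: if_splits simp: insert_absorb)
    also have "\<dots> = (\<Sum>S\<in>Pow N. if i \<in> A then - frag_cmul (walsh A S) (frag_of (orb S))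
        else frag_cmul (walsh A S) (frag_of (orb S)))"
      unfolding walsh_flip_bit[OF fA] by (intro sum.cong) auto
    finally show ?thesis by (simp add: v_def sum_negf del: minus_frag_cmul)
  qed
  have eigen: "frag_extend E (v A) = frag_cmul (int n - 2 * int (card A)) (v A)" if A: "A \<subseteq> N" for A
  proof -
    have "frag_extend E (v A) = (\<Sum>S\<in>Pow N. frag_cmul (walsh A S) (\<Sum>i\<in>N. frag_of (orb (flip_bit S i))))"
      unfolding v_def using fN E by (simp add: frag_extend_sum[unfolded o_def] frag_extend_cmul N_def)
    also have "\<dots> = (\<Sum>i\<in>N. if i \<in> A then - v A else v A)"
      using flip_v[OF A] by (simp add: frag_cmul_sum sum.swap[of _ N])
    also have "\<dots> = (\<Sum>i\<in>A. - v A) + (\<Sum>i\<in>N - A. v A)"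
      using A fN by (subst sum.subset_diff[OF A fN(1)]) (simp add: add.commute)
    also have "(\<Sum>i\<in>I. w) = frag_cmul (int (card I)) w" if "finite I" for I :: "nat set" and w :: "'a \<Rightarrow>\<^sub>0 int"
      using that by (induction I) (simp_all add: frag_cmul_distrib)
    ultimately have "frag_extend E (v A) = frag_cmul (int (card A)) (- v A) + frag_cmul (int (card (N - A))) (v A)"
      using A fN by (metis finite_Diff finite_subset)
    also have "\<dots> = frag_cmul (int (card (N - A)) - int (card A)) (v A)"
      by (rule poly_mapping_eqI) (simp add: lookup_add lookup_minus algebra_simps)
    also have "int (card (N - A)) = int n - int (card A)"
      using A fN by (simp add: card_Diff_subset finite_subset N_def of_nat_diff card_mono[of "{..<n}" A, simplified])
    finally show ?thesis by (simp add: algebra_simps)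
  qed
  have odd_zero: "v A = 0" if A: "A \<subseteq> N" "odd (card A)" for A
  proof -
    have "v A = (\<Sum>S\<in>Pow N. frag_cmul (walsh A (N - S)) (frag_of (orb (N - S))))"
      unfolding v_def
      by (intro sum.reindex_bij_witness[where i="\<lambda>S. N - S" and j="\<lambda>S. N - S"]) (auto simp: double_diff)
    also have "\<dots> = (\<Sum>S\<in>Pow N. - frag_cmul (walsh A S) (frag_of (orb S)))"
      using A fN antipodal by (intro sum.cong) (auto simp: walsh_complement N_def)
    finally have "v A = - v A" by (simp add: v_def sum_negf del: minus_frag_cmul)
    then have "frag_cmul 2 (v A) = 0"
      by (metis add.right_inverse frag_cmul_distrib frag_cmul_one one_add_one)
    then show ?thesis by simp
  qed
  have killed: "poly_operator P E (v A) = 0" if A: "A \<subseteq> N" for A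
  proof (cases "odd (card A)")
    case True
    then show ?thesis using odd_zero[OF A] poly_operator_eigenvector[OF eigen[OF A]] by simp
  next
    case False
    then obtain m where m: "card A = 2 * m" by (auto elim: evenE)
    have "card A \<le> n" using A card_mono[of N A] by (simp add: N_def)
    then have "m \<le> k" using m n by simp
    moreover have "int n - 2 * int (card A) = 2 * int k + 1 - 4 * int m" using m n by simp
    ultimately show ?thesis
      unfolding poly_operator_eigenvector[OF eigen[OF A]]
      using poly_root_even_eigenvalue[of m k] by (simp add: P_def)
  qed
  have "(\<Sum>A\<in>Pow N. v A) = (\<Sum>S\<in>Pow N. \<Sum>A\<in>Pow N. frag_cmul (walsh A S) (frag_of (orb S)))"
    unfolding v_def by (rule sum.swap)
  also have "\<dots> = (\<Sum>S\<in>Pow N. frag_cmul (\<Sum>A\<in>Pow N. walsh A S) (frag_of (orb S)))"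
  proof (intro sum.cong refl)
    fix S
    have "(\<Sum>A\<in>I. frag_cmul (walsh A S) w) = frag_cmul (\<Sum>A\<in>I. walsh A S) w" if "finite I" for I w
      using that by (induction I) (simp_all add: frag_cmul_distrib)
    then show "(\<Sum>A\<in>Pow N. frag_cmul (walsh A S) (frag_of (orb S)))
        = frag_cmul (\<Sum>A\<in>Pow N. walsh A S) (frag_of (orb S))"
      using fN by blast
  qed
  also have "\<dots> = (\<Sum>S\<in>Pow N. if S = {} then frag_cmul (2 ^ n) (frag_of (orb {})) else 0)"
    using fN by (intro sum.cong) (auto simp: sum_walsh N_def)
  also have "\<dots> = frag_cmul (2 ^ n) (frag_of (orb {}))"
    using fN by (simp add: sum.delta)
  finally have "frag_cmul (2 ^ n) (poly_operator P E (frag_of (orb {}))) = (\<Sum>A\<in>Pow N. poly_operator P E (v A))"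
    by (simp flip: poly_operator_cmul poly_operator_sum[OF fN(2)])
  also have "\<dots> = 0" using killed by simp
  finally show ?thesis
    by (simp add: poly_operator_def poly_correspondence_def P_def)
qed

lemma order_prod_distinct_linear:
  fixes c :: "'i \<Rightarrow> complex"
  assumes "finite I" "inj_on c I"
  shows "order r (\<Prod>i\<in>I. [:c i, 1:]) \<le> 1"
  using assms
proof (induction I)
  case (insert i I)
  have nz: "[:c i, 1:] \<noteq> 0" "(\<Prod>i\<in>I. [:c i, 1:]) \<noteq> 0" "[:c i, 1:] * (\<Prod>i\<in>I. [:c i, 1:]) \<noteq> 0"
    using insert by (simp_all only: mult_eq_0_iff prod_zero_iff) auto
  have eq: "order r (\<Prod>i\<in>insert i I. [:c i, 1:]) = order r [:c i, 1:] + order r (\<Prod>i\<in>I. [:c i, 1:])"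
    using insert order_mult[OF nz(3)] by simp
  show ?case
  proof (cases "r = - c i")
    case True
    have "poly (\<Prod>i\<in>I. [:c i, 1:]) r \<noteq> 0"
      using insert True by (auto simp: poly_prod prod_zero_iff inj_on_def add_eq_0_iff)
    then have "order r (\<Prod>i\<in>I. [:c i, 1:]) = 0" by (rule order_0I)
    moreover have "order r [:c i, 1:] \<le> 1" using order_degree[OF nz(1), of r] by simp
    ultimately show ?thesis using eq by simp
  next
    case False
    then have "order r [:c i, 1:] = 0" by (intro order_0I) (auto simp: add_eq_0_iff)
    then show ?thesis using eq insert by simp
  qed
qed simp

lemma flip_polynomial_simple_roots:
  "order (r :: complex) (map_poly of_int (\<Prod>i\<le>k. [:(- 1) ^ (i + k + 1) * (2 * int i + 1), 1:])) \<le> 1"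
proof -
  define c :: "nat \<Rightarrow> int" where "c i = (- 1) ^ (i + k + 1) * (2 * int i + 1)" for i
  have abs_c: "\<bar>c i\<bar> = 2 * int i + 1" for i by (simp add: c_def abs_mult power_abs)
  have "inj_on (\<lambda>i. complex_of_int (c i)) {..k}"
  proof (rule inj_onI)
    fix i j assume "complex_of_int (c i) = complex_of_int (c j)"
    then have "\<bar>c i\<bar> = \<bar>c j\<bar>" by simp
    then show "i = j" unfolding abs_c by simp
  qed
  moreover have "map_poly of_int (\<Prod>i\<in>I. [:c i, 1:]) = (\<Prod>i\<in>I. [:complex_of_int (c i), 1:])"
    if "finite I" for I
    using that
  proof (induction I)
    case (insert i I)
    have "map_poly of_int (p * q) = map_poly of_int p * (map_poly of_int q :: complex poly)" for p q :: "int poly"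
      by (rule poly_eqI) (simp add: coeff_map_poly coeff_mult)
    then show ?case using insert by (simp add: map_poly_pCons del: mult_pCons_left)
  qed simp
  ultimately show ?thesis
    using order_prod_distinct_linear[of "{..k}" "\<lambda>i. complex_of_int (c i)" r] by (simp add: c_def)
qed

section \<open>Orders of zeros\<close>

lemma frequently_neq_imp_eventually_neq:
  fixes F :: "complex \<Rightarrow> complex"
  assumes "F analytic_on {a}" "\<exists>\<^sub>F u in at a. F u \<noteq> c"
  shows "\<forall>\<^sub>F u in at a. F u \<noteq> c"
proof -
  have an: "(\<lambda>u. F u - c) analytic_on {a}" using assms(1) by (intro analytic_intros)
  have "\<forall>\<^sub>F u in at a. F u - c \<noteq> 0"
    using assms(2) by (intro non_zero_neighbour isolated_singularity_at_analytic[OF an] not_essential_analytic[OF an]) simp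
  then show ?thesis by simp
qed

lemma zorder_simple_zero:
  assumes "F analytic_on {a}" "F a = 0" "deriv F a \<noteq> 0"
  shows "zorder F a = 1"
  using assms by (intro zorder_zero_eqI') auto

lemma deriv_nonzero_imp_frequently_neq:
  fixes F :: "complex \<Rightarrow> complex"
  assumes "F analytic_on {a}" "deriv F a \<noteq> 0"
  shows "\<exists>\<^sub>F u in at a. F u \<noteq> c"
proof (rule ccontr)
  assume "\<not> ?thesis"
  then have ev: "\<forall>\<^sub>F u in at a. F u = c" by (simp add: frequently_def)
  have "isCont F a" using assms(1) by (simp add: analytic_at_imp_isCont)
  then have "F \<midarrow>a\<rightarrow> F a" by (simp add: isCont_def)
  moreover have "F \<midarrow>a\<rightarrow> c" using ev by (intro tendsto_eventually)
  ultimately have "F a = c" using LIM_unique by blast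
  with ev have "\<forall>\<^sub>F u in nhds a. F u = c" by (auto simp: eventually_nhds_conv_at)
  then have "deriv F a = deriv (\<lambda>_. c) a" by (intro deriv_cong_ev) auto
  then show False using assms(2) by simp
qed

text \<open>
  Orders of zeros are unchanged by regular changes of coordinate in the target and, in the next lemma,
  in the source. This makes the ramification index independent of charts.
\<close>

lemma zorder_compose_coordinate_left:
  assumes "F analytic_on {a}" "\<exists>\<^sub>F u in at a. F u \<noteq> F a"
    and "\<tau> analytic_on {F a}" "deriv \<tau> (F a) \<noteq> 0"
  shows "zorder (\<lambda>u. \<tau> (F u) - \<tau> (F a)) a = zorder (\<lambda>u. F u - F a) a"
proof -
  have an: "(\<lambda>v. \<tau> v - \<tau> (F a)) analytic_on {F a}" using assms(3) by (intro analytic_intros)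
  have d: "deriv (\<lambda>v. \<tau> v - \<tau> (F a)) (F a) = deriv \<tau> (F a)"
    using assms(3) by (subst deriv_diff) (auto simp: analytic_on_imp_differentiable_at)
  have "zorder ((\<lambda>v. \<tau> v - \<tau> (F a)) \<circ> F) a = zorder (\<lambda>v. \<tau> v - \<tau> (F a)) (F a) * zorder (\<lambda>u. F u - F a) a"
  proof (rule zorder_compose')
    show "\<forall>\<^sub>F w in at (F a). \<tau> w - \<tau> (F a) \<noteq> 0"
      using frequently_neq_imp_eventually_neq[OF assms(3)]
        deriv_nonzero_imp_frequently_neq[OF assms(3,4)] by simp
    show "\<forall>\<^sub>F w in at a. F w \<noteq> F a"
      using frequently_neq_imp_eventually_neq[OF assms(1,2)] .
  qed (use assms isolated_singularity_at_analytic[OF an] not_essential_analytic[OF an] in auto)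
  also have "zorder (\<lambda>v. \<tau> v - \<tau> (F a)) (F a) = 1"
    by (rule zorder_simple_zero) (use an d assms in auto)
  finally show ?thesis by (simp add: o_def)
qed

lemma zorder_compose_coordinate_right:
  assumes "F analytic_on {\<theta> b}" "\<exists>\<^sub>F u in at (\<theta> b). F u \<noteq> F (\<theta> b)"
    and "\<theta> analytic_on {b}" "deriv \<theta> b \<noteq> 0"
  shows "zorder (\<lambda>u. F (\<theta> u) - F (\<theta> b)) b = zorder (\<lambda>u. F u - F (\<theta> b)) (\<theta> b)"
proof -
  have an: "(\<lambda>v. F v - F (\<theta> b)) analytic_on {\<theta> b}" using assms(1) by (intro analytic_intros)
  have an2: "(\<lambda>v. \<theta> v - \<theta> b) analytic_on {b}" using assms(3) by (intro analytic_intros)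
  have d: "deriv (\<lambda>v. \<theta> v - \<theta> b) b = deriv \<theta> b"
    using assms(3) by (subst deriv_diff) (auto simp: analytic_on_imp_differentiable_at)
  have "zorder ((\<lambda>v. F v - F (\<theta> b)) \<circ> \<theta>) b = zorder (\<lambda>v. F v - F (\<theta> b)) (\<theta> b) * zorder (\<lambda>u. \<theta> u - \<theta> b) b"
  proof (rule zorder_compose')
    show "\<forall>\<^sub>F w in at (\<theta> b). F w - F (\<theta> b) \<noteq> 0"
      using frequently_neq_imp_eventually_neq[OF assms(1,2)] by simp
    show "\<forall>\<^sub>F w in at b. \<theta> w \<noteq> \<theta> b"
      using frequently_neq_imp_eventually_neq[OF assms(3)]
        deriv_nonzero_imp_frequently_neq[OF assms(3,4)] by simp
  qed (use assms isolated_singularity_at_analytic[OF an] not_essential_analytic[OF an] in auto)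
  also have "zorder (\<lambda>v. \<theta> v - \<theta> b) b = 1"
    by (rule zorder_simple_zero) (use an2 d assms in auto)
  finally show ?thesis by (simp add: o_def)
qed

text \<open>
  Near a zero of order \<open>e\<close> the function \<open>F - F a\<close> is \<open>(u - a)\<^sup>e\<close> times a function without zeros, which
  has an \<open>e\<close>-th root on a disc. So \<open>F - F a = h\<^sup>e\<close> with \<open>h\<close> locally invertible, and \<open>k\<close> is the
  inverse of \<open>h\<close>.
\<close>

lemma holomorphic_power_normal_form:
  assumes S: "open S" "a \<in> S" "F holomorphic_on S" and nc: "\<exists>\<^sub>F u in at a. F u \<noteq> F a"
  obtains e k \<delta> where "e = nat (zorder (\<lambda>u. F u - F a) a)" "zorder (\<lambda>u. F u - F a) a > 0" "0 < \<delta>"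
    "k holomorphic_on ball 0 \<delta>" "inj_on k (ball 0 \<delta>)" "k 0 = a" "k ` ball 0 \<delta> \<subseteq> S"
    "\<And>u. u \<in> ball 0 \<delta> \<Longrightarrow> F (k u) = F a + u ^ e"
proof -
  define e where "e = nat (zorder (\<lambda>u. F u - F a) a)"
  obtain r0 where r0: "r0 > 0" "ball a r0 \<subseteq> S" using S by (meson openE)
  have hol0: "(\<lambda>u. F u - F a) holomorphic_on ball a r0"
    using S r0 by (intro holomorphic_intros) (rule holomorphic_on_subset)
  have "\<forall>\<^sub>F u in at a. u \<in> ball a r0"
    using r0 by (intro eventually_at_in_open') auto
  then have "\<exists>\<^sub>F u in at a. F u \<noteq> F a \<and> u \<in> ball a r0"
    by (intro frequently_rev_mp[OF nc]) (auto elim: eventually_mono)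
  then have ex: "\<exists>w\<in>ball a r0. F w - F a \<noteq> 0" using frequently_ex by fastforce
  have order: "zorder (\<lambda>u. F u - F a) a > 0 \<and> (\<exists>r>0. cball a r \<subseteq> ball a r0 \<and>
      zor_poly (\<lambda>u. F u - F a) a holomorphic_on cball a r \<and>
      (\<forall>w\<in>cball a r. F w - F a = zor_poly (\<lambda>u. F u - F a) a w * (w - a) ^ e \<and>
        zor_poly (\<lambda>u. F u - F a) a w \<noteq> 0))"
    using zorder_exist_zero[OF hol0 open_ball convex_connected[OF convex_ball], of a] ex r0(1)
    unfolding e_def by simp
  then obtain r where pos: "zorder (\<lambda>u. F u - F a) a > 0" and r: "r > 0" "cball a r \<subseteq> ball a r0"
    and gh: "zor_poly (\<lambda>u. F u - F a) a holomorphic_on cball a r"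
    and g: "\<And>w. w \<in> cball a r \<Longrightarrow> F w - F a = zor_poly (\<lambda>u. F u - F a) a w * (w - a) ^ e \<and>
        zor_poly (\<lambda>u. F u - F a) a w \<noteq> 0"
    by blast
  define G where "G = zor_poly (\<lambda>u. F u - F a) a"
  have e: "e > 0" using pos by (simp add: e_def)
  have "G holomorphic_on ball a r" using gh by (auto simp: G_def intro: holomorphic_on_subset)
  moreover have "\<And>z. z \<in> ball a r \<Longrightarrow> G z \<noteq> 0" using g by (auto simp: G_def)
  ultimately obtain L where L: "L holomorphic_on ball a r" "\<And>z. z \<in> ball a r \<Longrightarrow> exp (L z) = G z"
    using holomorphic_logarithm_exists[OF convex_ball open_ball, of G a r a] r by (metis centre_in_ball)
  define h where "h u = (u - a) * exp (L u / of_nat e)" for u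
  have hh: "h holomorphic_on ball a r" unfolding h_def using L by (intro holomorphic_intros) (use e in auto)
  have Fh: "F u = F a + h u ^ e" if "u \<in> ball a r" for u
  proof -
    have "exp (L u / of_nat e) ^ e = G u"
      using L(2)[OF that] e by (simp flip: exp_of_nat_mult)
    then have "h u ^ e = F u - F a" using g[of u] that by (simp add: h_def power_mult_distrib G_def mult.commute)
    then show ?thesis by simp
  qed
  have "(\<lambda>u. exp (L u / of_nat e)) holomorphic_on ball a r"
    using L by (intro holomorphic_intros) (use e in auto)
  then have "(\<lambda>u. exp (L u / of_nat e)) field_differentiable at a"
    using r by (intro holomorphic_on_imp_differentiable_at[of _ "ball a r"]) auto
  then have "deriv (\<lambda>u. (u - a) * exp (L u / of_nat e)) a = exp (L a / of_nat e)"
    by (subst deriv_mult) (auto intro!: derivative_intros)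
  then have "deriv h a \<noteq> 0" by (simp add: h_def[abs_def])
  then obtain r1 where r1: "r1 > 0" "ball a r1 \<subseteq> ball a r" "open (h ` ball a r1)" "inj_on h (ball a r1)"
    using has_complex_derivative_locally_invertible[OF hh _ open_ball] r by (metis centre_in_ball)
  have hh1: "h holomorphic_on ball a r1" using hh r1 by (auto intro: holomorphic_on_subset)
  obtain k where k: "k holomorphic_on h ` ball a r1" "\<And>z. z \<in> ball a r1 \<Longrightarrow> k (h z) = z"
    using holomorphic_has_inverse[OF hh1 open_ball r1(4)] by metis
  have h0: "h a = 0" by (simp add: h_def)
  then have "0 \<in> h ` ball a r1" using r1(1) by (metis centre_in_ball imageI)
  then obtain \<delta> where \<delta>: "\<delta> > 0" "ball 0 \<delta> \<subseteq> h ` ball a r1" using r1(3) by (meson openE)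
  have hk: "h (k u) = u \<and> k u \<in> ball a r1" if u: "u \<in> ball 0 \<delta>" for u
  proof -
    obtain z where "z \<in> ball a r1" "u = h z" using \<delta>(2) u by auto
    then show ?thesis using k(2) by simp
  qed
  show thesis
  proof (rule that[of e \<delta> k])
    show "k holomorphic_on ball 0 \<delta>" using k \<delta> holomorphic_on_subset by blast
    show "inj_on k (ball 0 \<delta>)" using hk by (metis inj_onI)
    show "k 0 = a" using k(2)[of a] h0 r1 by simp
    show "k ` ball 0 \<delta> \<subseteq> S" using hk r1 r r0 by auto (meson mem_ball subset_iff ball_subset_cball)
    show "F (k u) = F a + u ^ e" if "u \<in> ball 0 \<delta>" for u
      using Fh[of "k u"] hk[OF that] r1 by auto
  qed (use e_def pos \<delta> in auto)
qed

lemma holomorphic_on2_imp_continuous_on: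
  assumes "holomorphic_on2 g W"
  shows "continuous_on W g"
proof (rule continuous_at_imp_continuous_on, rule ballI)
  fix p assume "p \<in> W"
  then obtain D where "(g has_derivative D) (at p)" using assms unfolding holomorphic_on2_def by blast
  then show "isCont g p" by (rule has_derivative_continuous)
qed

lemma holomorphic_on2_slice:
  assumes "holomorphic_on2 g W" "\<And>u. u \<in> B \<Longrightarrow> (s, u) \<in> W"
  shows "(\<lambda>u. g (s, u)) holomorphic_on B"
  unfolding holomorphic_on_def field_differentiable_def
proof
  fix u assume "u \<in> B"
  then obtain a b where "(g has_derivative (\<lambda>(u, v). a * u + b * v)) (at (s, u))"
    using assms unfolding holomorphic_on2_def by blast
  moreover have "((\<lambda>u. (s, u)) has_derivative (\<lambda>h. (0, h))) (at u)"
    by (auto intro!: derivative_eq_intros)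
  ultimately have "((\<lambda>u. g (s, u)) has_derivative (\<lambda>h. b * h)) (at u)"
    using has_derivative_compose[of "\<lambda>u. (s, u)" "\<lambda>h. (0, h)" u UNIV g "\<lambda>(u, v). a * u + b * v"] by simp
  then have "((\<lambda>u. g (s, u)) has_field_derivative b) (at u)"
    by (simp add: has_field_derivative_def)
  then show "\<exists>f'. ((\<lambda>u. g (s, u)) has_field_derivative f') (at u within B)"
    using has_field_derivative_at_within by blast
qed

text \<open>
  If the slice of \<open>g\<close> over \<open>a\<close> had a nonzero derivative \<open>d\<close> at \<open>b\<close>, then by Cauchy's estimate the nearby
  slices would have derivative close to \<open>d\<close> near \<open>b\<close>, and hence would be injective there.
\<close>

lemma deriv_eq_0_if_two_zeros_collide:
  assumes W: "open W" "(a, b) \<in> W" and g: "holomorphic_on2 g W"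
    and zeros: "\<And>\<eta>. \<eta> > 0 \<Longrightarrow> \<exists>s t t'. dist s a < \<eta> \<and> dist t b < \<eta> \<and> dist t' b < \<eta> \<and> t \<noteq> t' \<and>
      g (s, t) = 0 \<and> g (s, t') = 0"
  shows "deriv (\<lambda>u. g (a, u)) b = 0"
proof (rule ccontr)
  define h where "h s u = g (s, u)" for s u
  define d where "d = deriv (h a) b"
  assume "deriv (\<lambda>u. g (a, u)) b \<noteq> 0"
  then have d: "d \<noteq> 0" by (simp add: d_def h_def[abs_def])
  obtain A B where "open A" "open B" "a \<in> A" "b \<in> B" "A \<times> B \<subseteq> W"
    using W by (auto elim: open_prod_elim)
  then obtain r1 r2 where "r1 > 0" "cball a r1 \<subseteq> A" "r2 > 0" "cball b r2 \<subseteq> B"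
    by (meson open_contains_cball)
  then obtain r where r: "r > 0" "cball a r \<times> cball b r \<subseteq> W"
    using \<open>A \<times> B \<subseteq> W\<close>
    by (intro that[of "min r1 r2"]) (auto simp: subset_iff)
  have hol: "h s holomorphic_on cball b r" if "s \<in> cball a r" for s
    unfolding h_def by (rule holomorphic_on2_slice[OF g]) (use that r in auto)
  have "uniformly_continuous_on (cball a r \<times> cball b r) g"
    using holomorphic_on2_imp_continuous_on[OF g] r
    by (intro compact_uniformly_continuous compact_Times) (auto intro: continuous_on_subset)
  then obtain \<delta> where \<delta>: "\<delta> > 0"
    and unif: "\<And>p q. p \<in> cball a r \<times> cball b r \<Longrightarrow> q \<in> cball a r \<times> cball b r \<Longrightarrow> dist p q < \<delta> \<Longrightarrow>
      dist (g p) (g q) < norm d * r / 6"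
    unfolding uniformly_continuous_on_def using r d
    by (metis (no_types, lifting) divide_pos_pos mult_pos_pos zero_less_norm_iff zero_less_numeral dist_commute)
  have "h a holomorphic_on ball b r" using hol[of a] r by (auto intro: holomorphic_on_subset)
  then have "continuous_on (ball b r) (deriv (h a))"
    by (intro holomorphic_on_imp_continuous_on holomorphic_deriv) auto
  then have "isCont (deriv (h a)) b" using r by (auto simp: continuous_on_eq_continuous_at)
  then obtain \<delta>2 where \<delta>2: "\<delta>2 > 0" "\<And>v. dist v b < \<delta>2 \<Longrightarrow> dist (deriv (h a) v) d < norm d / 3"
    unfolding continuous_at_eps_delta d_def[symmetric] using d by (metis divide_pos_pos zero_less_norm_iff zero_less_numeral)
  (* Radius r/2 leaves room for Cauchy's estimate on discs inside cball b r; the bound |d| r/6 becomes |d|/3. *)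
  define \<rho> where "\<rho> = min \<delta>2 (r / 2)"
  have \<rho>: "\<rho> > 0" "\<rho> \<le> r / 2" "\<rho> \<le> \<delta>2" using \<delta>2 r by (auto simp: \<rho>_def)
  obtain s t t' where st: "dist s a < min (min \<delta> r) \<rho>" "dist t b < min (min \<delta> r) \<rho>" "dist t' b < min (min \<delta> r) \<rho>"
      "t \<noteq> t'" "h s t = 0" "h s t' = 0"
    using zeros[of "min (min \<delta> r) \<rho>"] \<delta> r \<rho> unfolding h_def by auto
  have s: "s \<in> cball a r" using st by (auto simp: dist_commute)
  have near: "norm (deriv (h s) v - d) \<le> 2 / 3 * norm d" if v: "v \<in> ball b \<rho>" for v
  proof -
    have sub: "cball v (r / 2) \<subseteq> cball b r"
      using v \<rho> by (subst cball_subset_cball_iff) (auto simp: dist_commute)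
    have diff: "(\<lambda>u. h s u - h a u) holomorphic_on cball v (r / 2)"
      using hol[OF s] hol[of a] sub r by (intro holomorphic_intros) (auto intro: holomorphic_on_subset)
    have "cmod ((deriv ^^ 1) (\<lambda>u. h s u - h a u) v) \<le> fact 1 * (norm d * r / 6) / (r / 2) ^ 1"
    proof (rule Cauchy_higher_deriv_bound)
      show "(\<lambda>u. h s u - h a u) holomorphic_on ball v (r / 2)"
        using diff by (rule holomorphic_on_subset) auto
      show "continuous_on (cball v (r / 2)) (\<lambda>u. h s u - h a u)"
        using diff by (rule holomorphic_on_imp_continuous_on)
      show "h s w - h a w \<in> ball 0 (norm d * r / 6)" if "w \<in> ball v (r / 2)" for w
      proof -
        have "w \<in> cball v (r / 2)" using that by auto
        then have "w \<in> cball b r" using sub by blast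
        then show ?thesis using unif[of "(s, w)" "(a, w)"] s r st
          by (auto simp: h_def dist_norm dist_Pair_Pair norm_minus_commute)
      qed
    qed (use r in auto)
    then have "cmod (deriv (\<lambda>u. h s u - h a u) v) \<le> norm d / 3" using r by simp
    also have "deriv (\<lambda>u. h s u - h a u) v = deriv (h s) v - deriv (h a) v"
    proof (rule deriv_diff)
      have "v \<in> ball b r" using v \<rho> r by auto
      then show "h s field_differentiable at v" "h a field_differentiable at v"
        using hol[OF s] hol[of a] r
        by (auto intro!: holomorphic_on_imp_differentiable_at[OF holomorphic_on_subset, of _ "cball b r" "ball b r"])
    qed
    finally have 1: "norm (deriv (h s) v - deriv (h a) v) \<le> norm d / 3" .
    have 2: "norm (deriv (h a) v - d) \<le> norm d / 3"
      using \<delta>2(2)[of v] v \<rho> by (auto simp: dist_norm norm_minus_commute)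
    show ?thesis using norm_triangle_ineq[of "deriv (h s) v - deriv (h a) v" "deriv (h a) v - d"] 1 2 by simp
  qed
  have "norm ((h s t - d * t) - (h s t' - d * t')) \<le> 2 / 3 * norm d * norm (t - t')"
  proof (rule field_differentiable_bound[where S="ball b \<rho>"])
    show "((\<lambda>u. h s u - d * u) has_field_derivative (deriv (h s) v - d)) (at v within ball b \<rho>)"
      if "v \<in> ball b \<rho>" for v
    proof -
      have "v \<in> ball b r" using that \<rho> r by auto
      moreover have "h s holomorphic_on ball b r"
        using hol[OF s] by (rule holomorphic_on_subset) auto
      ultimately have "(h s has_field_derivative deriv (h s) v) (at v)"
        using holomorphic_derivI[OF _ open_ball] by blast
      then have "((\<lambda>u. h s u - d * u) has_field_derivative (deriv (h s) v - d * 1)) (at v)"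
        by (intro DERIV_diff DERIV_cmult DERIV_ident)
      then show ?thesis using has_field_derivative_at_within by fastforce
    qed
  qed (use near st in \<open>auto simp: dist_commute\<close>)
  then have "norm d * norm (t - t') \<le> 2 / 3 * norm d * norm (t - t')"
    using st by (simp add: norm_mult norm_minus_commute flip: right_diff_distrib)
  moreover have "norm d * norm (t - t') > 0" using d st by simp
  ultimately show False by simp
qed

lemma zorder_ge_2I:
  assumes "f analytic_on {b}" "\<exists>\<^sub>F u in at b. f u \<noteq> 0" "f b = 0" "deriv f b = 0"
  shows "zorder f b \<ge> 2"
proof -
  obtain A where A: "open A" "b \<in> A" "f holomorphic_on A" using assms(1) analytic_at by blast
  then obtain r where r: "r > 0" "ball b r \<subseteq> A" by (meson openE)
  have "\<forall>\<^sub>F u in at b. u \<in> ball b r"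
    using r by (intro eventually_at_in_open') auto
  then have "\<exists>\<^sub>F u in at b. f u \<noteq> 0 \<and> u \<in> ball b r"
    by (intro frequently_rev_mp[OF assms(2)]) (auto elim: eventually_mono)
  then obtain w where w: "w \<in> ball b r" "f w \<noteq> 0" by (auto dest: frequently_ex)
  have "int 2 \<le> zorder f b"
  proof (rule zorder_geI[where A="ball b r" and z=w])
    show "(deriv ^^ k) f b = 0" if "k < 2" for k
      using that assms by (cases k) (auto simp: less_2_cases_iff)
  qed (use assms A r w in \<open>auto intro: holomorphic_on_subset\<close>)
  then show ?thesis by simp
qed

section \<open>Charts, ramification and local sections\<close>

lemma chartD:
  assumes "riemann_surface R" "(A, \<alpha>) \<in> charts R"
  shows "openin (stop R) A" "open (\<alpha> ` A)" "inj_on \<alpha> A" "A \<subseteq> pts R"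
    "homeomorphic_map (subtopology (stop R) A) (top_of_set (\<alpha> ` A)) \<alpha>"
proof -
  show 1: "openin (stop R) A" "open (\<alpha> ` A)"
    and 2: "homeomorphic_map (subtopology (stop R) A) (top_of_set (\<alpha> ` A)) \<alpha>"
    using assms unfolding riemann_surface_def by auto
  show 3: "A \<subseteq> pts R" using 1(1) by (rule openin_subset)
  show "inj_on \<alpha> A"
    using 2 3 by (auto simp: homeomorphic_eq_everything_map topspace_subtopology Int_absorb1)
qed

lemma chart_transition:
  assumes "riemann_surface R" "(A, \<alpha>) \<in> charts R" "(B, \<beta>) \<in> charts R"
  shows "(\<lambda>u. \<beta> (inv_into A \<alpha> u)) holomorphic_on \<alpha> ` (A \<inter> B)"
  using assms unfolding riemann_surface_def by auto

lemma chart_at: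
  assumes "riemann_surface R" "x \<in> pts R"
  obtains A \<alpha> where "(A, \<alpha>) \<in> charts R" "x \<in> A"
  using assms unfolding riemann_surface_def by blast

lemma chart_local_coordinate:
  assumes "riemann_surface R" "(A, \<alpha>) \<in> charts R"
  shows "local_coordinate R A \<alpha>"
  unfolding local_coordinate_def
  using chartD[OF assms] chart_transition[OF assms(1) _ assms(2)] by (auto simp: Int_commute)

lemma open_chart_image:
  assumes "riemann_surface R" "(A, \<alpha>) \<in> charts R" "openin (stop R) Q"
  shows "open (\<alpha> ` (Q \<inter> A))"
proof -
  note A = chartD[OF assms(1,2)]
  have "open_map (subtopology (stop R) A) (top_of_set (\<alpha> ` A)) \<alpha>"
    using A(5) by (rule homeomorphic_imp_open_map)
  moreover have "openin (subtopology (stop R) A) (Q \<inter> A)"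
    using assms(3) by (auto simp: openin_subtopology)
  ultimately have "openin (top_of_set (\<alpha> ` A)) (\<alpha> ` (Q \<inter> A))"
    unfolding open_map_def by blast
  then show ?thesis using A(2) openin_open_trans by blast
qed

lemma openin_chart_preimage:
  assumes "riemann_surface R" "(A, \<alpha>) \<in> charts R" "open W"
  shows "openin (stop R) {x \<in> A. \<alpha> x \<in> W}"
proof -
  note A = chartD[OF assms(1,2)]
  have "continuous_map (subtopology (stop R) A) (top_of_set (\<alpha> ` A)) \<alpha>"
    using A(5) by (rule homeomorphic_imp_continuous_map)
  then have "openin (subtopology (stop R) A) {x \<in> topspace (subtopology (stop R) A). \<alpha> x \<in> \<alpha> ` A \<inter> W}"
    by (rule openin_continuous_map_preimage) (use assms(3) in \<open>auto simp: openin_open\<close>)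
  moreover have "{x \<in> topspace (subtopology (stop R) A). \<alpha> x \<in> \<alpha> ` A \<inter> W} = {x \<in> A. \<alpha> x \<in> W}"
    using A(4) by auto
  ultimately show ?thesis using A(1) openin_trans_full by metis
qed

lemma continuous_map_inv_chart:
  assumes "riemann_surface R" "(A, \<alpha>) \<in> charts R"
  shows "continuous_map (top_of_set (\<alpha> ` A)) (stop R) (inv_into A \<alpha>)"
  unfolding continuous_map_def
proof (intro conjI allI impI)
  note A = chartD[OF assms]
  show "inv_into A \<alpha> \<in> topspace (top_of_set (\<alpha> ` A)) \<rightarrow> topspace (stop R)"
    using A(4) inv_into_into[of _ \<alpha> A] by auto
  fix Q assume Q: "openin (stop R) Q"
  have "{u \<in> topspace (top_of_set (\<alpha> ` A)). inv_into A \<alpha> u \<in> Q} = \<alpha> ` (Q \<inter> A)"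
    using A(3) by (auto simp: image_iff intro: f_inv_into_f[symmetric] inv_into_into)
  then show "openin (top_of_set (\<alpha> ` A)) {u \<in> topspace (top_of_set (\<alpha> ` A)). inv_into A \<alpha> u \<in> Q}"
    using open_chart_image[OF assms Q] by (auto intro!: open_openin_trans A(2))
qed

lemma holomorphic_on_if_locally:
  assumes "\<And>u. u \<in> S \<Longrightarrow> \<exists>N. open N \<and> u \<in> N \<and> N \<subseteq> S \<and> f holomorphic_on N"
  shows "f holomorphic_on S"
  unfolding holomorphic_on_def
proof
  fix u assume "u \<in> S"
  then obtain N where "open N" "u \<in> N" "f holomorphic_on N" using assms by blast
  then show "f field_differentiable at u within S"
    using holomorphic_on_imp_differentiable_at field_differentiable_at_within by blast
qed

lemma open_local_domain:
  assumes "riemann_surface R" "continuous_map (stop R) (stop S) f" "(A, \<alpha>) \<in> charts R" "openin (stop S) V"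
  shows "open (\<alpha> ` {a \<in> A. f a \<in> V})"
proof -
  have "openin (stop R) {x \<in> pts R. f x \<in> V}"
    using assms(2,4) by (rule openin_continuous_map_preimage)
  then have "open (\<alpha> ` ({x \<in> pts R. f x \<in> V} \<inter> A))" by (rule open_chart_image[OF assms(1,3)])
  moreover have "{x \<in> pts R. f x \<in> V} \<inter> A = {a \<in> A. f a \<in> V}" using chartD(4)[OF assms(1,3)] by auto
  ultimately show ?thesis by simp
qed

text \<open>
  A local coordinate is only known to be compatible with the charts, so the expression is factored
  through a chart of the target near each point.
\<close>

lemma holomorphic_local_expression:
  assumes R: "riemann_surface R" and S: "riemann_surface S" and f: "holomorphic_map R S f"
    and A: "(A, \<alpha>) \<in> charts R" and V: "local_coordinate S V \<gamma>"
  shows "(\<lambda>u. \<gamma> (f (inv_into A \<alpha> u))) holomorphic_on \<alpha> ` {a \<in> A. f a \<in> V}"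
proof (rule holomorphic_on_if_locally)
  fix u assume "u \<in> \<alpha> ` {a \<in> A. f a \<in> V}"
  then obtain a where a: "a \<in> A" "f a \<in> V" "u = \<alpha> a" by auto
  have oV: "openin (stop S) V" and cf: "continuous_map (stop R) (stop S) f"
    using V f by (auto simp: local_coordinate_def holomorphic_map_def)
  have "f a \<in> pts S" using oV a openin_subset by blast
  then obtain B \<beta> where B: "(B, \<beta>) \<in> charts S" "f a \<in> B" using chart_at[OF S] by blast
  define N where "N = \<alpha> ` {a \<in> A. f a \<in> V \<inter> B}"
  have "open N" unfolding N_def
    by (rule open_local_domain[OF R cf A]) (use oV chartD(1)[OF S B(1)] in auto)
  moreover have "u \<in> N" "N \<subseteq> \<alpha> ` {a \<in> A. f a \<in> V}" using a B by (auto simp: N_def)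
  moreover have "(\<lambda>u. \<gamma> (f (inv_into A \<alpha> u))) holomorphic_on N"
  proof -
    have inv: "inv_into A \<alpha> (\<alpha> b) = b" if "b \<in> A" for b using chartD(3)[OF R A] that by simp
    have 1: "(\<lambda>v. \<gamma> (inv_into B \<beta> v)) holomorphic_on \<beta> ` (V \<inter> B)"
      using V B by (auto simp: local_coordinate_def)
    have "(\<lambda>u. \<beta> (f (inv_into A \<alpha> u))) holomorphic_on \<alpha> ` {a \<in> A. f a \<in> B}"
      using f A B by (auto simp: holomorphic_map_def)
    then have 2: "(\<lambda>u. \<beta> (f (inv_into A \<alpha> u))) holomorphic_on N"
      by (rule holomorphic_on_subset) (auto simp: N_def)
    have 3: "(\<lambda>u. \<beta> (f (inv_into A \<alpha> u))) ` N \<subseteq> \<beta> ` (V \<inter> B)"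
      by (auto simp: N_def inv)
    have "((\<lambda>v. \<gamma> (inv_into B \<beta> v)) \<circ> (\<lambda>u. \<beta> (f (inv_into A \<alpha> u)))) holomorphic_on N"
      by (rule holomorphic_on_compose_gen[OF 2 1 3])
    then show ?thesis
      by (rule holomorphic_transform) (use chartD(3)[OF S B(1)] in \<open>auto simp: N_def inv\<close>)
  qed
  ultimately show "\<exists>N. open N \<and> u \<in> N \<and> N \<subseteq> \<alpha> ` {a \<in> A. f a \<in> V} \<and>
      (\<lambda>u. \<gamma> (f (inv_into A \<alpha> u))) holomorphic_on N" by blast
qed

lemma coordinate_change_regular:
  assumes S: "riemann_surface S" and V: "local_coordinate S V \<gamma>" and B: "(B, \<beta>) \<in> charts S"
    and y: "y \<in> V" "y \<in> B"
  shows "(\<lambda>v. \<gamma> (inv_into B \<beta> v)) analytic_on {\<beta> y}" "deriv (\<lambda>v. \<gamma> (inv_into B \<beta> v)) (\<beta> y) \<noteq> 0"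
proof -
  have hol: "(\<lambda>v. \<gamma> (inv_into B \<beta> v)) holomorphic_on \<beta> ` (V \<inter> B)"
    using V B by (auto simp: local_coordinate_def)
  have op: "open (\<beta> ` (V \<inter> B))"
    using V by (intro open_chart_image[OF S B]) (auto simp: local_coordinate_def)
  have mem: "\<beta> y \<in> \<beta> ` (V \<inter> B)" using y by auto
  have "inj_on \<gamma> V" using V by (auto simp: local_coordinate_def)
  then have "inj_on (\<lambda>v. \<gamma> (inv_into B \<beta> v)) (\<beta> ` (V \<inter> B))"
    using chartD(3)[OF S B] by (auto simp: inj_on_def)
  with hol op mem show "deriv (\<lambda>v. \<gamma> (inv_into B \<beta> v)) (\<beta> y) \<noteq> 0"
    by (intro holomorphic_injective_imp_regular)
  show "(\<lambda>v. \<gamma> (inv_into B \<beta> v)) analytic_on {\<beta> y}"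
    using hol op mem analytic_at by blast
qed

locale finite_holomorphic_map =
  fixes R :: "'a surface" and S :: "'b surface" and f :: "'a \<Rightarrow> 'b"
  assumes R: "riemann_surface R" and S: "riemann_surface S" and f: "holomorphic_map R S f"
    and finite_fibre: "\<And>y. y \<in> pts S \<Longrightarrow> finite (fibre R f y)"
begin

lemma map_in: "x \<in> pts R \<Longrightarrow> f x \<in> pts S"
  using f by (auto simp: holomorphic_map_def dest: continuous_map_image_subset_topspace)

text \<open>
  Were the local expression constant near a point, a fibre would contain a whole disc.
\<close>

lemma local_expression:
  assumes A: "(A, \<alpha>) \<in> charts R" "x \<in> A" and V: "local_coordinate S V \<gamma>" "f x \<in> V"
  shows "(\<lambda>u. \<gamma> (f (inv_into A \<alpha> u))) analytic_on {\<alpha> x}"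
    "\<exists>\<^sub>F u in at (\<alpha> x). \<gamma> (f (inv_into A \<alpha> u)) \<noteq> \<gamma> (f (inv_into A \<alpha> (\<alpha> x)))"
proof -
  define N where "N = \<alpha> ` {a \<in> A. f a \<in> V}"
  have N: "open N" "\<alpha> x \<in> N"
    using A V f open_local_domain[OF R _ A(1), of S f V]
    by (auto simp: N_def local_coordinate_def holomorphic_map_def)
  show "(\<lambda>u. \<gamma> (f (inv_into A \<alpha> u))) analytic_on {\<alpha> x}"
    using holomorphic_local_expression[OF R S f A(1) V(1)] N analytic_at unfolding N_def by blast
  have inv: "inv_into A \<alpha> (\<alpha> b) = b" if "b \<in> A" for b using chartD(3)[OF R A(1)] that by simp
  show "\<exists>\<^sub>F u in at (\<alpha> x). \<gamma> (f (inv_into A \<alpha> u)) \<noteq> \<gamma> (f (inv_into A \<alpha> (\<alpha> x)))"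
  proof (rule ccontr)
    assume "\<not> ?thesis"
    then have "\<forall>\<^sub>F u in at (\<alpha> x). \<gamma> (f (inv_into A \<alpha> u)) = \<gamma> (f x)"
      using A by (simp add: frequently_def inv)
    then have "\<forall>\<^sub>F u in nhds (\<alpha> x). \<gamma> (f (inv_into A \<alpha> u)) = \<gamma> (f x)"
      using A by (auto simp: eventually_nhds_conv_at inv)
    moreover have "\<forall>\<^sub>F u in nhds (\<alpha> x). u \<in> N" using N by (rule eventually_nhds_in_open)
    ultimately have "\<forall>\<^sub>F u in nhds (\<alpha> x). \<gamma> (f (inv_into A \<alpha> u)) = \<gamma> (f x) \<and> u \<in> N"
      by eventually_elim simp
    then obtain M where M: "open M" "\<alpha> x \<in> M" "\<And>u. u \<in> M \<Longrightarrow> \<gamma> (f (inv_into A \<alpha> u)) = \<gamma> (f x) \<and> u \<in> N"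
      unfolding eventually_nhds by blast
    have "inv_into A \<alpha> ` M \<subseteq> fibre R f (f x)"
    proof
      fix a assume "a \<in> inv_into A \<alpha> ` M"
      then obtain u where u: "u \<in> M" "a = inv_into A \<alpha> u" by auto
      then obtain b where b: "b \<in> A" "f b \<in> V" "u = \<alpha> b" using M(3) unfolding N_def by blast
      then have "a = b" using u inv by simp
      moreover have "\<gamma> (f b) = \<gamma> (f x)" using M(3)[OF u(1)] b inv by simp
      then have "f b = f x" using V b unfolding local_coordinate_def inj_on_def by blast
      ultimately show "a \<in> fibre R f (f x)" using b chartD(4)[OF R A(1)] by (auto simp: fibre_def)
    qed
    moreover have "finite (fibre R f (f x))"
      using A chartD(4)[OF R A(1)] by (intro finite_fibre map_in) auto
    ultimately have "finite (inv_into A \<alpha> ` M)" by (rule finite_subset)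
    moreover have "inj_on (inv_into A \<alpha>) M"
      using M(3) by (intro inj_on_inv_into) (auto simp: N_def)
    ultimately have "finite M" by (simp add: finite_image_iff)
    then show False using M finite_imp_not_open by blast
  qed
qed

lemma zorder_target_coordinate:
  assumes A: "(A, \<alpha>) \<in> charts R" "x \<in> A" and V: "local_coordinate S V \<gamma>" "f x \<in> V"
    and B: "(B, \<beta>) \<in> charts S" "f x \<in> B"
  shows "zorder (\<lambda>u. \<gamma> (f (inv_into A \<alpha> u)) - \<gamma> (f x)) (\<alpha> x) =
    zorder (\<lambda>u. \<beta> (f (inv_into A \<alpha> u)) - \<beta> (f x)) (\<alpha> x)"
proof -
  define H where "H u = \<beta> (f (inv_into A \<alpha> u))" for u
  define \<tau> where "\<tau> v = \<gamma> (inv_into B \<beta> v)" for v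
  have inv: "inv_into A \<alpha> (\<alpha> b) = b" if "b \<in> A" for b using chartD(3)[OF R A(1)] that by simp
  have invB: "inv_into B \<beta> (\<beta> b) = b" if "b \<in> B" for b using chartD(3)[OF S B(1)] that by simp
  have Hx: "H (\<alpha> x) = \<beta> (f x)" using inv A by (simp add: H_def)
  define N where "N = \<alpha> ` {a \<in> A. f a \<in> B}"
  have N: "open N" "\<alpha> x \<in> N"
    using A B f open_local_domain[OF R _ A(1) chartD(1)[OF S B(1)]]
    by (auto simp: N_def holomorphic_map_def)
  have "zorder (\<lambda>u. \<gamma> (f (inv_into A \<alpha> u)) - \<gamma> (f x)) (\<alpha> x) = zorder (\<lambda>u. \<tau> (H u) - \<tau> (H (\<alpha> x))) (\<alpha> x)"
  proof (rule zorder_cong)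
    have "\<forall>\<^sub>F u in at (\<alpha> x). u \<in> N" using N by (intro eventually_at_in_open') auto
    then show "\<forall>\<^sub>F u in at (\<alpha> x). \<gamma> (f (inv_into A \<alpha> u)) - \<gamma> (f x) = \<tau> (H u) - \<tau> (H (\<alpha> x))"
      by eventually_elim (use A B in \<open>auto simp: N_def H_def \<tau>_def inv invB\<close>)
  qed simp
  also have "\<dots> = zorder (\<lambda>u. H u - H (\<alpha> x)) (\<alpha> x)"
    using local_expression[OF A chart_local_coordinate[OF S B(1)] B(2), folded H_def]
      coordinate_change_regular[OF S V(1) B(1) V(2) B(2)]
    by (intro zorder_compose_coordinate_left)
      (simp_all add: Hx H_def[abs_def, symmetric] \<tau>_def[abs_def, symmetric])
  finally show ?thesis by (simp add: Hx) (simp add: H_def)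
qed

lemma zorder_source_chart:
  assumes A: "(A, \<alpha>) \<in> charts R" "x \<in> A" and A': "(A', \<alpha>') \<in> charts R" "x \<in> A'"
    and B: "(B, \<beta>) \<in> charts S" "f x \<in> B"
  shows "zorder (\<lambda>u. \<beta> (f (inv_into A \<alpha> u)) - \<beta> (f x)) (\<alpha> x) =
    zorder (\<lambda>u. \<beta> (f (inv_into A' \<alpha>' u)) - \<beta> (f x)) (\<alpha>' x)"
proof -
  define H where "H u = \<beta> (f (inv_into A' \<alpha>' u))" for u
  define \<theta> where "\<theta> u = \<alpha>' (inv_into A \<alpha> u)" for u
  have inv: "inv_into A \<alpha> (\<alpha> b) = b" if "b \<in> A" for b using chartD(3)[OF R A(1)] that by simp
  have inv': "inv_into A' \<alpha>' (\<alpha>' b) = b" if "b \<in> A'" for b using chartD(3)[OF R A'(1)] that by simp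
  have \<theta>: "\<theta> (\<alpha> x) = \<alpha>' x" using inv A by (simp add: \<theta>_def)
  have Hx: "H (\<alpha>' x) = \<beta> (f x)" using inv' A' by (simp add: H_def)
  define N where "N = \<alpha> ` (A' \<inter> A)"
  have N: "open N" "\<alpha> x \<in> N"
    using A A' open_chart_image[OF R A(1) chartD(1)[OF R A'(1)]] by (auto simp: N_def)
  have "zorder (\<lambda>u. \<beta> (f (inv_into A \<alpha> u)) - \<beta> (f x)) (\<alpha> x) = zorder (\<lambda>u. H (\<theta> u) - H (\<theta> (\<alpha> x))) (\<alpha> x)"
  proof (rule zorder_cong)
    have "\<forall>\<^sub>F u in at (\<alpha> x). u \<in> N" using N by (intro eventually_at_in_open') auto
    then show "\<forall>\<^sub>F u in at (\<alpha> x). \<beta> (f (inv_into A \<alpha> u)) - \<beta> (f x) = H (\<theta> u) - H (\<theta> (\<alpha> x))"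
      by eventually_elim (use A A' in \<open>auto simp: N_def H_def \<theta>_def inv inv'\<close>)
  qed simp
  also have "\<dots> = zorder (\<lambda>u. H u - H (\<theta> (\<alpha> x))) (\<theta> (\<alpha> x))"
    using local_expression[OF A' chart_local_coordinate[OF S B(1)] B(2), folded H_def]
      coordinate_change_regular[OF R chart_local_coordinate[OF R A'(1)] A(1) A'(2) A(2)]
    by (intro zorder_compose_coordinate_right)
      (simp_all add: \<theta> H_def[abs_def, symmetric] \<theta>_def[abs_def, symmetric])
  finally show ?thesis by (simp add: \<theta> Hx) (simp add: H_def)
qed

text \<open>
  The definite description in \<^const>\<open>ramification_index\<close> is justified: all charts give the same order,
  and so does any local coordinate of the target. The latter matters because the sheets over a disc
  are obtained from a coordinate that need not be in the atlas.
\<close>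

lemma ramification_index_eq:
  assumes A: "(A, \<alpha>) \<in> charts R" "x \<in> A" and V: "local_coordinate S V \<gamma>" "f x \<in> V"
  shows "ramification_index R S f x = nat (zorder (\<lambda>u. \<gamma> (f (inv_into A \<alpha> u)) - \<gamma> (f x)) (\<alpha> x))"
  unfolding ramification_index_def
proof (rule the_equality)
  have "f x \<in> pts S" using A chartD(4)[OF R A(1)] map_in by blast
  then obtain B \<beta> where B: "(B, \<beta>) \<in> charts S" "f x \<in> B" using chart_at[OF S] by blast
  show "\<exists>(U, \<phi>)\<in>charts R. \<exists>(V', \<psi>)\<in>charts S. x \<in> U \<and> f x \<in> V' \<and>
      nat (zorder (\<lambda>u. \<gamma> (f (inv_into A \<alpha> u)) - \<gamma> (f x)) (\<alpha> x)) =
      nat (zorder (\<lambda>u. \<psi> (f (inv_into U \<phi> u)) - \<psi> (f x)) (\<phi> x))"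
    using A B zorder_target_coordinate[OF A V B] by (intro bexI[of _ "(A, \<alpha>)"] bexI[of _ "(B, \<beta>)"]) auto
next
  fix e
  assume "\<exists>(U, \<phi>)\<in>charts R. \<exists>(V, \<psi>)\<in>charts S. x \<in> U \<and> f x \<in> V \<and>
      e = nat (zorder (\<lambda>u. \<psi> (f (inv_into U \<phi> u)) - \<psi> (f x)) (\<phi> x))"
  then obtain A' \<alpha>' B \<beta> where A': "(A', \<alpha>') \<in> charts R" "x \<in> A'" and B: "(B, \<beta>) \<in> charts S" "f x \<in> B"
    and e: "e = nat (zorder (\<lambda>u. \<beta> (f (inv_into A' \<alpha>' u)) - \<beta> (f x)) (\<alpha>' x))"
    by blast
  show "e = nat (zorder (\<lambda>u. \<gamma> (f (inv_into A \<alpha> u)) - \<gamma> (f x)) (\<alpha> x))"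
    unfolding e zorder_target_coordinate[OF A V B] zorder_source_chart[OF A A' B] ..
qed

end

text \<open>
  A parametrised disc, the inverse of whose parametrisation is a local coordinate. Parametrisations are
  more convenient than coordinates here, since divisors are built from them.
\<close>

definition embedded_disc :: "'a surface \<Rightarrow> real \<Rightarrow> (complex \<Rightarrow> 'a) \<Rightarrow> bool" where
  "embedded_disc R \<delta> s \<longleftrightarrow> \<delta> > 0 \<and> inj_on s (ball 0 \<delta>) \<and>
     (\<forall>W. open W \<and> W \<subseteq> ball 0 \<delta> \<longrightarrow> openin (stop R) (s ` W)) \<and>
     continuous_map (top_of_set (ball 0 \<delta>)) (stop R) s \<and>
     local_coordinate R (s ` ball 0 \<delta>) (inv_into (ball 0 \<delta>) s)"

lemma embedded_disc_shrink:
  assumes R: "riemann_surface R" and s: "embedded_disc R \<delta> s" and \<epsilon>: "0 < \<epsilon>" "\<epsilon> \<le> \<delta>"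
  shows "embedded_disc R \<epsilon> s"
proof -
  have sub: "ball 0 \<epsilon> \<subseteq> (ball 0 \<delta> :: complex set)" using \<epsilon> by auto
  have inj: "inj_on s (ball 0 \<delta>)" using s by (simp add: embedded_disc_def)
  have inj': "inj_on s (ball 0 \<epsilon>)" using inj sub by (rule inj_on_subset)
  have op: "openin (stop R) (s ` W)" if "open W" "W \<subseteq> ball 0 \<epsilon>" for W
    using s that sub by (auto simp: embedded_disc_def)
  have "local_coordinate R (s ` ball 0 \<epsilon>) (inv_into (ball 0 \<epsilon>) s)"
    unfolding local_coordinate_def
  proof (intro conjI ballI, goal_cases)
    case 1
    show ?case by (rule op) auto
  next
    case 2
    show ?case by (rule inj_on_inv_into) auto
  next
    case (3 c)
    obtain V \<psi> where c: "c = (V, \<psi>)" by force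
    with 3 s have hol: "(\<lambda>u. inv_into (ball 0 \<delta>) s (inv_into V \<psi> u)) holomorphic_on \<psi> ` (s ` ball 0 \<delta> \<inter> V)"
      by (auto simp: embedded_disc_def local_coordinate_def)
    have "(\<lambda>u. inv_into (ball 0 \<epsilon>) s (inv_into V \<psi> u)) holomorphic_on \<psi> ` (s ` ball 0 \<epsilon> \<inter> V)"
    proof (rule holomorphic_transform)
      show "(\<lambda>u. inv_into (ball 0 \<delta>) s (inv_into V \<psi> u)) holomorphic_on \<psi> ` (s ` ball 0 \<epsilon> \<inter> V)"
        using hol by (rule holomorphic_on_subset) (use sub in auto)
      fix u assume "u \<in> \<psi> ` (s ` ball 0 \<epsilon> \<inter> V)"
      then have "inv_into V \<psi> u \<in> s ` ball 0 \<epsilon>"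
        using chartD(3)[OF R] 3 c by auto
      then obtain v where v: "v \<in> ball 0 \<epsilon>" "inv_into V \<psi> u = s v" by blast
      then have "v \<in> ball 0 \<delta>" using sub by blast
      then show "inv_into (ball 0 \<delta>) s (inv_into V \<psi> u) = inv_into (ball 0 \<epsilon>) s (inv_into V \<psi> u)"
        using v inj inj' by (simp only: inv_into_f_f)
    qed
    then show ?case by (simp add: c)
  qed
  then show ?thesis
    using s \<epsilon> sub inj' op by (auto simp: embedded_disc_def intro: continuous_map_from_subtopology_mono)
qed

context finite_holomorphic_map
begin

text \<open>
  A parametrisation of a neighbourhood of \<open>x\<close> in which \<open>f\<close> becomes a power. If \<open>x\<close> is unramified, this is
  a local section of \<open>f\<close>.
\<close>

lemma local_section:
  assumes x: "x \<in> pts R" and V: "local_coordinate S V \<gamma>" "f x \<in> V"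
  obtains \<delta> s where "ramification_index R S f x > 0" "embedded_disc R \<delta> s" "s 0 = x"
    "\<And>u. u \<in> ball 0 \<delta> \<Longrightarrow> f (s u) \<in> V \<and> \<gamma> (f (s u)) = \<gamma> (f x) + u ^ ramification_index R S f x"
proof -
  obtain A \<alpha> where A: "(A, \<alpha>) \<in> charts R" "x \<in> A" using chart_at[OF R x] by blast
  define F where "F u = \<gamma> (f (inv_into A \<alpha> u))" for u
  define N where "N = \<alpha> ` {a \<in> A. f a \<in> V}"
  have inv: "inv_into A \<alpha> (\<alpha> b) = b" if "b \<in> A" for b using chartD(3)[OF R A(1)] that by simp
  have Fx: "F (\<alpha> x) = \<gamma> (f x)" using A inv by (simp add: F_def)
  have N: "open N" "\<alpha> x \<in> N"
    using A V f open_local_domain[OF R _ A(1), of S f V]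
    by (auto simp: N_def local_coordinate_def holomorphic_map_def)
  have "F holomorphic_on N" unfolding F_def[abs_def] N_def
    by (rule holomorphic_local_expression[OF R S f A(1) V(1)])
  moreover have "\<exists>\<^sub>F u in at (\<alpha> x). F u \<noteq> F (\<alpha> x)"
    using local_expression(2)[OF A V] by (simp add: F_def)
  ultimately obtain e k \<delta> where e: "e = nat (zorder (\<lambda>u. F u - F (\<alpha> x)) (\<alpha> x))"
      "zorder (\<lambda>u. F u - F (\<alpha> x)) (\<alpha> x) > 0" and \<delta>: "0 < \<delta>"
    and k: "k holomorphic_on ball 0 \<delta>" "inj_on k (ball 0 \<delta>)" "k 0 = \<alpha> x" "k ` ball 0 \<delta> \<subseteq> N"
    and Fk: "\<And>u. u \<in> ball 0 \<delta> \<Longrightarrow> F (k u) = F (\<alpha> x) + u ^ e"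
    by (rule holomorphic_power_normal_form[OF N]) blast
  have e_eq: "ramification_index R S f x = e"
    using ramification_index_eq[OF A V] e(1) by (simp add: Fx) (simp add: F_def)
  define s where "s u = inv_into A \<alpha> (k u)" for u
  have NA: "N \<subseteq> \<alpha> ` A" by (auto simp: N_def)
  have kA: "k u \<in> \<alpha> ` A" if "u \<in> ball 0 \<delta>" for u using that k(4) NA by blast
  have \<alpha>s: "\<alpha> (s u) = k u" if "u \<in> ball 0 \<delta>" for u
    using kA[OF that] by (simp add: s_def f_inv_into_f)
  have sA: "s u \<in> A" if "u \<in> ball 0 \<delta>" for u
    using kA[OF that] by (simp add: s_def inv_into_into)
  have inj: "inj_on s (ball 0 \<delta>)"
  proof (rule inj_onI)
    fix u v assume *: "u \<in> ball 0 \<delta>" "v \<in> ball 0 \<delta>" "s u = s v"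
    then have "k u = k v" using \<alpha>s by metis
    then show "u = v" using * k(2) by (auto dest: inj_onD)
  qed
  have s_image: "s ` W = {a \<in> A. \<alpha> a \<in> k ` W}" if W: "W \<subseteq> ball 0 \<delta>" for W
  proof (intro equalityI subsetI)
    fix a assume "a \<in> s ` W"
    then show "a \<in> {a \<in> A. \<alpha> a \<in> k ` W}" using W \<alpha>s sA by auto
  next
    fix a assume "a \<in> {a \<in> A. \<alpha> a \<in> k ` W}"
    then obtain u where "a \<in> A" "u \<in> W" "\<alpha> a = k u" by auto
    then have "a = s u" using inv[of a] by (simp add: s_def)
    then show "a \<in> s ` W" using \<open>u \<in> W\<close> by blast
  qed
  have op: "openin (stop R) (s ` W)" if "open W" "W \<subseteq> ball 0 \<delta>" for W
  proof -
    have "open (k ` W)"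
      using that k by (intro open_mapping_thm3) (auto intro: holomorphic_on_subset inj_on_subset)
    then show ?thesis unfolding s_image[OF that(2)] by (rule openin_chart_preimage[OF R A(1)])
  qed
  have cont: "continuous_map (top_of_set (ball 0 \<delta>)) (stop R) s"
  proof -
    have "continuous_map (top_of_set (ball 0 \<delta>)) (top_of_set (\<alpha> ` A)) k"
      using k(1) kA holomorphic_on_imp_continuous_on by (auto simp: image_subset_iff)
    from continuous_map_compose[OF this continuous_map_inv_chart[OF R A(1)]]
    show ?thesis by (simp add: s_def[abs_def] o_def)
  qed
  have loc: "local_coordinate R (s ` ball 0 \<delta>) (inv_into (ball 0 \<delta>) s)"
    unfolding local_coordinate_def
  proof (intro conjI ballI, goal_cases)
    case 1
    show ?case by (rule op) auto
  next
    case 2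
    show ?case by (rule inj_on_inv_into) auto
  next
    case (3 c)
    obtain B \<beta> where c: "c = (B, \<beta>)" by force
    have B: "(B, \<beta>) \<in> charts R" using 3 c by simp
    obtain g where g: "g holomorphic_on k ` ball 0 \<delta>" "\<And>z. z \<in> ball 0 \<delta> \<Longrightarrow> g (k z) = z"
      using holomorphic_has_inverse[OF k(1) open_ball k(2)] by metis
    have invB: "inv_into B \<beta> (\<beta> b) = b" if "b \<in> B" for b using chartD(3)[OF R B] that by simp
    have sub: "\<beta> ` (s ` ball 0 \<delta> \<inter> B) \<subseteq> \<beta> ` (B \<inter> A)" using sA by auto
    have 1: "(\<lambda>u. \<alpha> (inv_into B \<beta> u)) holomorphic_on \<beta> ` (s ` ball 0 \<delta> \<inter> B)"
      using chart_transition[OF R B A(1)] sub by (rule holomorphic_on_subset)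
    have 2: "(\<lambda>u. \<alpha> (inv_into B \<beta> u)) ` \<beta> ` (s ` ball 0 \<delta> \<inter> B) \<subseteq> k ` ball 0 \<delta>"
    proof
      fix v assume "v \<in> (\<lambda>u. \<alpha> (inv_into B \<beta> u)) ` \<beta> ` (s ` ball 0 \<delta> \<inter> B)"
      then obtain u where "u \<in> ball 0 \<delta>" "s u \<in> B" "v = \<alpha> (inv_into B \<beta> (\<beta> (s u)))" by blast
      then show "v \<in> k ` ball 0 \<delta>" using invB \<alpha>s by auto
    qed
    have "(\<lambda>u. inv_into (ball 0 \<delta>) s (inv_into B \<beta> u)) holomorphic_on \<beta> ` (s ` ball 0 \<delta> \<inter> B)"
    proof (rule holomorphic_transform[OF holomorphic_on_compose_gen[OF 1 g(1) 2]])
      fix v assume "v \<in> \<beta> ` (s ` ball 0 \<delta> \<inter> B)"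
      then obtain u where "u \<in> ball 0 \<delta>" "s u \<in> B" "v = \<beta> (s u)" by blast
      then show "(g \<circ> (\<lambda>u. \<alpha> (inv_into B \<beta> u))) v = inv_into (ball 0 \<delta>) s (inv_into B \<beta> v)"
        using invB \<alpha>s g(2) inv_into_f_f[OF inj] by simp
    qed
    then show ?case by (simp add: c)
  qed
  show thesis
  proof (rule that[of \<delta> s])
    show "ramification_index R S f x > 0" using e e_eq by simp
    show "embedded_disc R \<delta> s" using \<delta> inj op cont loc by (auto simp: embedded_disc_def)
    show "s 0 = x" using k(3) inv A by (simp add: s_def)
    show "f (s u) \<in> V \<and> \<gamma> (f (s u)) = \<gamma> (f x) + u ^ ramification_index R S f x" if u: "u \<in> ball 0 \<delta>" for u
    proof -
      have "k u \<in> N" using k(4) u by blast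
      then have "f (s u) \<in> V" using inv unfolding N_def s_def by auto
      then show ?thesis using Fk[OF u] Fx by (simp add: e_eq F_def s_def)
    qed
  qed
qed

end

section \<open>Flips and the involution\<close>

locale covering_pair =
  fixes T :: "'t surface" and X :: "'x surface" and Y :: "'y surface"
    and \<kappa> :: "'t \<Rightarrow> 'x" and \<rho> :: "'x \<Rightarrow> 'y" and n :: nat
  assumes surfaces: "riemann_surface T" "riemann_surface X" "riemann_surface Y"
    and cover: "covering X Y \<rho> n" and simple: "simply_ramified X Y \<rho>"
    and etale: "etale_double_cover T X \<kappa>" and odd_degree: "odd n" and degree: "n \<ge> 3"
begin

abbreviation "other \<equiv> other_point T \<kappa>"
abbreviation "primed \<equiv> conj_divisor T \<kappa>"
abbreviation "orbit \<equiv> conj_orbit T \<kappa>"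
abbreviation "Ct \<equiv> Ctilde T X Y \<kappa> \<rho>"

lemma kappa_in: "x \<in> pts T \<Longrightarrow> \<kappa> x \<in> pts X"
  using etale by (auto simp: etale_double_cover_def covering_def holomorphic_map_def
    dest: continuous_map_image_subset_topspace)

lemma rho_in: "p \<in> pts X \<Longrightarrow> \<rho> p \<in> pts Y"
  using cover by (auto simp: covering_def holomorphic_map_def dest: continuous_map_image_subset_topspace)

text \<open>
  The ramification indices over a point are all 1 and add up to 2.
\<close>

lemma fibre_kappa:
  assumes "x \<in> pts T"
  shows "fibre T \<kappa> (\<kappa> x) = {x, other x}" "other x \<noteq> x"
proof -
  have "(\<Sum>x\<in>fibre T \<kappa> (\<kappa> x). ramification_index T X \<kappa> x) = 2"
    using etale kappa_in[OF assms] by (auto simp: etale_double_cover_def covering_def)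
  moreover have "(\<Sum>x\<in>fibre T \<kappa> (\<kappa> x). ramification_index T X \<kappa> x) = (\<Sum>x\<in>fibre T \<kappa> (\<kappa> x). 1)"
    using etale
    by (intro sum.cong) (auto simp: etale_double_cover_def ramified_def ramification_point_def fibre_def)
  ultimately have "card (fibre T \<kappa> (\<kappa> x)) = 2" by simp
  then obtain a b where ab: "fibre T \<kappa> (\<kappa> x) = {a, b}" "a \<noteq> b" by (auto simp: card_2_iff)
  have "x \<in> {a, b}" using assms ab by (auto simp: fibre_def)
  then obtain c where c: "fibre T \<kappa> (\<kappa> x) = {x, c}" "x \<noteq> c" using ab by blast
  have "(x' \<in> pts T \<and> \<kappa> x' = \<kappa> x \<and> x' \<noteq> x) = (x' = c)" for x'
    using c unfolding fibre_def by blast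
  then have "other x = c" by (simp add: other_point_def)
  then show "fibre T \<kappa> (\<kappa> x) = {x, other x}" "other x \<noteq> x" using c by auto
qed

lemma other_point_eqI:
  assumes "x \<in> pts T" "v \<in> pts T" "\<kappa> v = \<kappa> x" "v \<noteq> x"
  shows "other x = v"
  using fibre_kappa[OF assms(1)] assms by (auto simp: fibre_def)

lemmas other_in = other_point_props(1)[OF etale]
  and kappa_other = other_point_props(2)[OF etale]
  and other_other = other_point_props(3)[OF etale]

lemmas primed_primed = conj_divisor_conj_divisor[OF etale]

lemma primed_add_mset [simp]: "primed (add_mset x z) = add_mset (other x) (primed z)"
  and primed_union [simp]: "primed (z + w) = primed z + primed w"
  and primed_empty [simp]: "primed {#} = {#}"
  and size_primed [simp]: "size (primed z) = size z"
  by (simp_all add: conj_divisor_def)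

lemma primed_subset: "set_mset z \<subseteq> pts T \<Longrightarrow> set_mset (primed z) \<subseteq> pts T"
  using other_in by (auto simp: conj_divisor_def)

lemma image_kappa_primed: "set_mset z \<subseteq> pts T \<Longrightarrow> image_mset \<kappa> (primed z) = image_mset \<kappa> z"
  unfolding conj_divisor_def multiset.map_comp
  by (rule image_mset_cong) (use kappa_other in auto)

text \<open>
  In \<open>D(z)\<close> the member \<open>x\<close> is kept and all others are replaced by their conjugates. Only one copy of
  \<open>x\<close> is kept if \<open>x\<close> is a multiple member.
\<close>

definition flip :: "'t \<Rightarrow> 't multiset \<Rightarrow> 't multiset" where
  "flip x z = add_mset x (primed (z - {#x#}))"

lemma flip_add_mset [simp]: "flip x (add_mset x w) = add_mset x (primed w)"
  by (simp add: flip_def)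

lemma primed_flip:
  assumes "set_mset z \<subseteq> pts T" "x \<in># z"
  shows "primed (flip x z) = add_mset (other x) (z - {#x#})"
proof -
  have "set_mset (z - {#x#}) \<subseteq> pts T" using assms by (auto dest: in_diffD)
  then show ?thesis by (simp add: flip_def primed_primed)
qed

lemma flip_primed:
  assumes "set_mset z \<subseteq> pts T" "x \<in># z"
  shows "flip (other x) (primed z) = primed (flip x z)"
proof -
  obtain w where w: "z = add_mset x w" using assms(2) by (metis multi_member_split)
  then show ?thesis using assms by (simp add: primed_primed)
qed

text \<open>
  One point from each fibre of \<open>\<kappa>\<close>. The choice is far from continuous; it serves only to define a
  parity in a single fibre.
\<close>

definition sheet :: "'t set" where
  "sheet = {x \<in> pts T. x = (SOME v. v \<in> pts T \<and> \<kappa> v = \<kappa> x)}"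

lemma other_in_sheet: "x \<in> pts T \<Longrightarrow> other x \<in> sheet \<longleftrightarrow> x \<notin> sheet"
proof -
  assume x: "x \<in> pts T"
  define v where "v = (SOME v. v \<in> pts T \<and> \<kappa> v = \<kappa> x)"
  have "v \<in> pts T \<and> \<kappa> v = \<kappa> x" unfolding v_def by (rule someI) (use x in simp)
  then have "v = x \<or> v = other x" using fibre_kappa(1)[OF x] by (auto simp: fibre_def)
  moreover have "x \<in> sheet \<longleftrightarrow> x = v" using x by (simp add: sheet_def v_def)
  moreover have "other x \<in> sheet \<longleftrightarrow> other x = v"
    using other_in[OF x] kappa_other[OF x] by (simp add: sheet_def v_def)
  ultimately show ?thesis using fibre_kappa(2)[OF x] by auto
qed

definition parity :: "'t multiset \<Rightarrow> bool" where
  "parity z \<longleftrightarrow> even (size (filter_mset (\<lambda>x. x \<in> sheet) z))"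

lemma parity_add_mset: "parity (add_mset x z) \<longleftrightarrow> (if x \<in> sheet then \<not> parity z else parity z)"
  by (simp add: parity_def)

text \<open>
  Conjugation exchanges the members in the chosen half with the others, so the two counts add up to
  the size.
\<close>

lemma parity_primed_gen: "set_mset z \<subseteq> pts T \<Longrightarrow> parity (primed z) \<longleftrightarrow> (parity z = even (size z))"
proof (induction z)
  case (add x z)
  then show ?case using other_in_sheet[of x] by (auto simp: parity_add_mset)
qed (simp add: parity_def)

lemma parity_primed: "set_mset z \<subseteq> pts T \<Longrightarrow> odd (size z) \<Longrightarrow> parity (primed z) \<longleftrightarrow> \<not> parity z"
  using parity_primed_gen by auto

text \<open>
  A flip conjugates an even number of members, namely all but one of an odd number.
\<close>

lemma parity_flip:
  assumes "set_mset z \<subseteq> pts T" "odd (size z)" "x \<in># z"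
  shows "parity (flip x z) = parity z"
proof -
  obtain w where w: "z = add_mset x w" using assms(3) by (metis multi_member_split)
  then show ?thesis using assms parity_primed_gen[of w] by (auto simp: parity_add_mset)
qed

lemma flip_subset: "set_mset z \<subseteq> pts T \<Longrightarrow> x \<in># z \<Longrightarrow> set_mset (flip x z) \<subseteq> pts T"
  unfolding flip_def using primed_subset[of "z - {#x#}"] by (auto dest: in_diffD)

lemma flip_inj:
  assumes "set_mset z \<subseteq> pts T" "x \<in># z" "v \<in># z" "flip x z = flip v z"
  shows "x = v"
proof (rule ccontr)
  assume ne: "x \<noteq> v"
  obtain w where "z = add_mset x w" using assms(2) by (metis multi_member_split)
  moreover then have "v \<in># w" using assms(3) ne by simp
  ultimately obtain u where z: "z = add_mset x (add_mset v u)" by (metis multi_member_split)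
  then have "z = add_mset v (add_mset x u)" by (simp add: add_mset_commute)
  then have "flip v z = add_mset v (add_mset (other x) (primed u))" by simp
  moreover have "flip x z = add_mset x (add_mset (other v) (primed u))" using z by simp
  ultimately have "add_mset x {#other v#} + primed u = add_mset v {#other x#} + primed u"
    using assms(4) by simp
  then have "add_mset x {#other v#} = add_mset v {#other x#}" by (rule add_right_imp_eq)
  then have "x = other x" using ne by (metis add_mset_eq_single add_eq_conv_diff)
  then show False using fibre_kappa(2)[of x] assms by auto
qed

lemma CtD:
  assumes "z \<in> Ct"
  shows "set_mset z \<subseteq> pts T" "size z = n" "odd (size z)"
    "\<exists>y\<in>pts Y. image_mset \<kappa> z = pullback_divisor X Y \<rho> y"
proof -
  show "set_mset z \<subseteq> pts T" "\<exists>y\<in>pts Y. image_mset \<kappa> z = pullback_divisor X Y \<rho> y"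
    using assms by (auto simp: Ctilde_def)
  then obtain y where y: "y \<in> pts Y" "image_mset \<kappa> z = pullback_divisor X Y \<rho> y" by blast
  have "size z = size (pullback_divisor X Y \<rho> y)" by (metis y(2) size_image_mset)
  also have "\<dots> = (\<Sum>p\<in>fibre X \<rho> y. ramification_index X Y \<rho> p)"
  proof -
    have "size (\<Sum>p\<in>F. replicate_mset (e p) p) = sum e F" if "finite F" for F and e :: "'x \<Rightarrow> nat"
      using that by (induction F) simp_all
    then show ?thesis using cover y(1) by (simp add: pullback_divisor_def covering_def)
  qed
  also have "\<dots> = n" using cover y(1) by (simp add: covering_def)
  finally show "size z = n" "odd (size z)" using odd_degree by auto
qed

lemma primed_Ct: "z \<in> Ct \<Longrightarrow> primed z \<in> Ct"
  unfolding Ctilde_def using primed_subset image_kappa_primed by auto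

lemma image_kappa_flip:
  assumes "set_mset z \<subseteq> pts T" "x \<in># z"
  shows "image_mset \<kappa> (flip x z) = image_mset \<kappa> z"
proof -
  obtain w where w: "z = add_mset x w" using assms(2) by (metis multi_member_split)
  then show ?thesis using assms by (simp add: image_kappa_primed)
qed

lemma flip_Ct: "z \<in> Ct \<Longrightarrow> x \<in># z \<Longrightarrow> flip x z \<in> Ct"
  using flip_subset[of z x] image_kappa_flip[of z x] unfolding Ctilde_def by auto

lemma parity_primed_Ct: "z \<in> Ct \<Longrightarrow> parity (primed z) \<longleftrightarrow> \<not> parity z"
  using parity_primed CtD by blast

lemma parity_flip_Ct: "z \<in> Ct \<Longrightarrow> x \<in># z \<Longrightarrow> parity (flip x z) = parity z"
  using parity_flip CtD by blast

lemma orbit_eq_iff: "z \<in> Ct \<Longrightarrow> orbit z = orbit w \<longleftrightarrow> w = z \<or> w = primed z"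
  unfolding conj_orbit_def doubleton_eq_iff using primed_primed[OF CtD(1)] by metis

lemma orbit_primed: "z \<in> Ct \<Longrightarrow> orbit (primed z) = orbit z"
  using orbit_eq_iff primed_Ct by metis

lemma orbit_eq_parity: "z \<in> Ct \<Longrightarrow> orbit z = orbit w \<Longrightarrow> parity z = parity w \<Longrightarrow> w = z"
  using orbit_eq_iff parity_primed_Ct by blast

text \<open>
  The definition of \<open>D\<close> allows either representative of an orbit. Flipping the conjugate divisor gives the
  conjugate of a flip, so that one representative is enough.
\<close>

lemma D_curve_iff:
  assumes z: "z \<in> Ct"
  shows "(orbit z, c) \<in> D_curve T X Y \<kappa> \<rho> \<longleftrightarrow> (\<exists>x. x \<in># z \<and> c = orbit (flip x z))"
proof
  assume "(orbit z, c) \<in> D_curve T X Y \<kappa> \<rho>"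
  then obtain w x where w: "w \<in> Ct" "x \<in># w" "orbit z = orbit w" "c = orbit (flip x w)"
    by (auto simp: D_curve_def flip_curve_def flip_def)
  then consider "w = z" | "w = primed z" using orbit_eq_iff[OF z] by blast
  then show "\<exists>x. x \<in># z \<and> c = orbit (flip x z)"
  proof cases
    case 2
    then obtain v where v: "v \<in># z" "x = other v" using w(2) by (auto simp: conj_divisor_def)
    then have "flip x w = primed (flip v z)" using flip_primed[OF CtD(1)[OF z]] 2 by simp
    then show ?thesis using v w orbit_primed[OF flip_Ct[OF z v(1)]] by auto
  qed (use w in auto)
next
  assume "\<exists>x. x \<in># z \<and> c = orbit (flip x z)"
  then show "(orbit z, c) \<in> D_curve T X Y \<kappa> \<rho>"
    using z unfolding D_curve_def flip_curve_def flip_def by force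
qed

text \<open>
  By parity, two flips of \<open>z\<close> cannot be conjugate to each other; so if their orbits agree, they are equal.
\<close>

lemma orbit_flip_inj:
  assumes z: "z \<in> Ct" and "x \<in># z" "v \<in># z" "orbit (flip x z) = orbit (flip v z)"
  shows "x = v"
proof -
  have "flip v z = flip x z"
    using assms parity_flip_Ct[OF z] by (intro orbit_eq_parity flip_Ct) auto
  then show ?thesis using flip_inj[OF CtD(1)[OF z]] assms by metis
qed

text \<open>
  Distinct members of \<open>z\<close> have distinct flips in \<open>C\<close>, so the assumption on multiplicities turns \<open>D(z)\<close>
  into a sum over the list of members.
\<close>

lemma correspondence_eq:
  assumes mult: "\<And>x. x \<in> set xs \<Longrightarrow> fibre_multiplicity C (D_curve T X Y \<kappa> \<rho>) (orbit (mset xs)) (orbit (flip x (mset xs))) = count (mset xs) x"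
    and z: "mset xs \<in> Ct"
  shows "correspondence C (D_curve T X Y \<kappa> \<rho>) (orbit (mset xs)) = (\<Sum>i<n. frag_of (orbit (flip (xs ! i) (mset xs))))"
proof -
  define z where "z = mset xs"
  have len: "length xs = n" using CtD(2)[OF assms(2)] by simp
  have W: "{c. (orbit z, c) \<in> D_curve T X Y \<kappa> \<rho>} = (\<lambda>x. orbit (flip x z)) ` set xs"
    using D_curve_iff[OF assms(2)] by (auto simp: z_def)
  have inj: "inj_on (\<lambda>x. orbit (flip x z)) (set xs)"
    using orbit_flip_inj[OF assms(2)] by (auto simp: inj_on_def z_def)
  have "correspondence C (D_curve T X Y \<kappa> \<rho>) (orbit z) =
      (\<Sum>x\<in>set xs. frag_cmul (int (count z x)) (frag_of (orbit (flip x z))))"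
    unfolding correspondence_def W sum.reindex[OF inj] using mult by (simp add: z_def)
  also have "\<dots> = (\<Sum>x\<in>set xs. \<Sum>i\<in>{i \<in> {..<n}. xs ! i = x}. frag_of (orbit (flip (xs ! i) z)))"
  proof (rule sum.cong[OF refl])
    fix x
    have "(\<Sum>i\<in>I. w) = frag_cmul (int (card I)) w" if "finite I" for I :: "nat set" and w :: "'t multiset set \<Rightarrow>\<^sub>0 int"
      using that by (induction I) (simp_all add: frag_cmul_distrib del: sum_constant)
    moreover have "count z x = card {i \<in> {..<n}. xs ! i = x}"
      by (simp add: z_def count_mset count_list_eq_length_filter length_filter_conv_card len eq_commute)
    ultimately show "frag_cmul (int (count z x)) (frag_of (orbit (flip x z))) =
        (\<Sum>i\<in>{i \<in> {..<n}. xs ! i = x}. frag_of (orbit (flip (xs ! i) z)))"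
      by (simp del: sum_constant)
  qed
  also have "\<dots> = (\<Sum>i<n. frag_of (orbit (flip (xs ! i) z)))"
    by (rule sum.group) (use len in auto)
  finally show ?thesis by (simp add: z_def)
qed

text \<open>
  The vertex \<open>S\<close> of the cube spanned by \<open>z\<close>: the members at positions in \<open>S\<close> are conjugated. Lists are used
  because a divisor with multiple members has no action of the coordinate flips.
\<close>

definition cube_vertex :: "'t list \<Rightarrow> nat set \<Rightarrow> 't list" where
  "cube_vertex xs S = map (\<lambda>i. if i \<in> S then other (xs ! i) else xs ! i) [0..<length xs]"

lemma length_cube_vertex [simp]: "length (cube_vertex xs S) = length xs"
  by (simp add: cube_vertex_def)

lemma cube_vertex_complement:
  assumes "set xs \<subseteq> pts T" "S \<subseteq> {..<length xs}"
  shows "mset (cube_vertex xs ({..<length xs} - S)) = primed (mset (cube_vertex xs S))"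
proof -
  have "cube_vertex xs ({..<length xs} - S) = map other (cube_vertex xs S)"
    using assms other_other by (intro nth_equalityI) (auto simp: cube_vertex_def subset_iff)
  then show ?thesis by (simp add: conj_divisor_def)
qed

lemma image_kappa_cube_vertex:
  assumes "set xs \<subseteq> pts T"
  shows "map \<kappa> (cube_vertex xs S) = map \<kappa> xs" "set (cube_vertex xs S) \<subseteq> pts T"
proof -
  have "xs ! i \<in> pts T" if "i < length xs" for i using assms that by (auto simp: subset_iff)
  then show "map \<kappa> (cube_vertex xs S) = map \<kappa> xs" "set (cube_vertex xs S) \<subseteq> pts T"
    using kappa_other other_in by (auto intro!: nth_equalityI simp: cube_vertex_def)
qed

lemma cube_vertex_Ct:
  assumes "mset xs \<in> Ct"
  shows "mset (cube_vertex xs S) \<in> Ct"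
proof -
  have "set xs \<subseteq> pts T" using CtD(1)[OF assms] by simp
  from image_kappa_cube_vertex[OF this, of S] show ?thesis
    using assms by (simp add: Ctilde_def flip: mset_map)
qed

text \<open>
  Keeping position \<open>i\<close> and conjugating all others is, up to the involution, conjugating position \<open>i\<close>.
\<close>

lemma orbit_flip_cube_vertex:
  assumes z: "mset xs \<in> Ct" and i: "i < n"
  shows "orbit (flip (cube_vertex xs S ! i) (mset (cube_vertex xs S))) = orbit (mset (cube_vertex xs (flip_bit S i)))"
proof -
  have len: "length xs = n" using CtD(2)[OF z] by simp
  have sub: "set xs \<subseteq> pts T" using CtD(1)[OF z] by simp
  have xi: "xs ! i \<in> pts T" using sub i len by (auto simp: subset_iff)
  define v where "v = cube_vertex xs S"
  have v: "mset v \<in> Ct" "length v = n" using cube_vertex_Ct[OF z] len by (auto simp: v_def)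
  have mem: "v ! i \<in># mset v" using v i by simp
  have "cube_vertex xs (flip_bit S i) = v[i := other (v ! i)]"
    using i len xi other_other by (intro nth_equalityI) (auto simp: cube_vertex_def v_def nth_list_update)
  then have "mset (cube_vertex xs (flip_bit S i)) = add_mset (other (v ! i)) (mset v - {#v ! i#})"
    using v i by (simp add: mset_update)
  then have "mset (cube_vertex xs (flip_bit S i)) = primed (flip (v ! i) (mset v))"
    using primed_flip[OF CtD(1)[OF v(1)] mem] by simp
  then show ?thesis using orbit_primed[OF flip_Ct[OF v(1) mem]] by (simp add: v_def)
qed

lemma satisfies_equation_if_multiplicity:
  assumes mult: "\<And>z x. z \<in> Ct \<Longrightarrow> x \<in># z \<Longrightarrow>
      fibre_multiplicity C (D_curve T X Y \<kappa> \<rho>) (orbit z) (orbit (flip x z)) = count z x"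
    and C: "pts C \<subseteq> orbit ` Ct" and n: "n = 2 * k + 1"
  shows "satisfies_equation C (D_curve T X Y \<kappa> \<rho>) (\<Prod>i\<le>k. [:(- 1) ^ (i + k + 1) * (2 * int i + 1), 1:])"
  unfolding satisfies_equation_def
proof
  fix c assume "c \<in> pts C"
  then obtain z where z: "z \<in> Ct" "c = orbit z" using C by blast
  obtain xs where xs: "z = mset xs" by (metis ex_mset)
  have Ct: "mset xs \<in> Ct" using z xs by simp
  have len: "length xs = n" using CtD(2)[OF Ct] by simp
  have sub: "set xs \<subseteq> pts T" using CtD(1)[OF Ct] by simp
  define orb where "orb S = orbit (mset (cube_vertex xs S))" for S
  have "poly_correspondence (\<Prod>i\<le>k. [:(- 1) ^ (i + k + 1) * (2 * int i + 1), 1:])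
      (correspondence C (D_curve T X Y \<kappa> \<rho>)) (orb {}) = 0"
  proof (rule folded_cube_equation[OF n])
    fix S assume S: "S \<subseteq> {..<n}"
    show "orb ({..<n} - S) = orb S"
      using cube_vertex_complement[OF sub, of S] S orbit_primed[OF cube_vertex_Ct[OF Ct]]
      by (simp add: orb_def len)
    show "correspondence C (D_curve T X Y \<kappa> \<rho>) (orb S) = (\<Sum>i<n. frag_of (orb (flip_bit S i)))"
      unfolding orb_def using mult cube_vertex_Ct[OF Ct] orbit_flip_cube_vertex[OF Ct]
      by (subst correspondence_eq) auto
  qed
  moreover have "cube_vertex xs {} = xs" by (simp add: cube_vertex_def map_nth)
  ultimately show "poly_correspondence (\<Prod>i\<le>k. [:(- 1) ^ (i + k + 1) * (2 * int i + 1), 1:])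
      (correspondence C (D_curve T X Y \<kappa> \<rho>)) c = 0"
    by (simp add: orb_def z xs)
qed

end

section \<open>Discs around a fibre\<close>

text \<open>
  All conditions are satisfied by every sufficiently small radius, so they can be met simultaneously
  for finitely many points.
\<close>

lemma disjoint_small_discs:
  fixes s :: "'a \<Rightarrow> complex \<Rightarrow> 'a"
  assumes M: "Hausdorff_space (stop M)" and F: "finite F" "F \<subseteq> pts M"
    and disc: "\<And>x. x \<in> F \<Longrightarrow> embedded_disc M (\<delta> x) (s x)" and centre: "\<And>x. x \<in> F \<Longrightarrow> s x 0 = x"
  obtains R where "0 < R" "R \<le> (1::real)" "\<And>x. x \<in> F \<Longrightarrow> R \<le> \<delta> x"
    "\<And>x x' u u'. x \<in> F \<Longrightarrow> x' \<in> F \<Longrightarrow> u \<in> ball 0 R \<Longrightarrow> u' \<in> ball 0 R \<Longrightarrow> s x u = s x' u' \<Longrightarrow> x = x' \<and> u = u'"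
proof -
  have small: "\<forall>\<^sub>F R in at_right 0. \<forall>u\<in>ball 0 R. s x u \<in> A" if x: "x \<in> F" and A: "openin (stop M) A" "x \<in> A" for x A
  proof -
    have "openin (top_of_set (ball 0 (\<delta> x))) {u \<in> topspace (top_of_set (ball 0 (\<delta> x))). s x u \<in> A}"
      using disc[OF x] A(1) by (intro openin_continuous_map_preimage) (auto simp: embedded_disc_def)
    then have "open {u \<in> ball 0 (\<delta> x). s x u \<in> A}" using openin_open_trans by auto
    moreover have "0 \<in> {u \<in> ball 0 (\<delta> x). s x u \<in> A}"
      using disc[OF x] centre[OF x] A by (auto simp: embedded_disc_def)
    ultimately obtain \<epsilon> where \<epsilon>: "\<epsilon> > 0" "ball 0 \<epsilon> \<subseteq> {u \<in> ball 0 (\<delta> x). s x u \<in> A}"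
      by (meson openE)
    have "\<forall>\<^sub>F R in at_right 0. R < \<epsilon>" using \<epsilon>(1) by (intro eventually_at_rightI[of 0 \<epsilon>]) auto
    then show ?thesis
    proof eventually_elim
      case (elim R)
      then have "ball 0 R \<subseteq> ball (0::complex) \<epsilon>" by auto
      then show ?case using \<epsilon>(2) by blast
    qed
  qed
  have "\<forall>\<^sub>F R in at_right 0. \<forall>x\<in>F. R \<le> \<delta> x \<and> (\<forall>x'\<in>F. \<forall>u\<in>ball 0 R. \<forall>u'\<in>ball 0 R. s x u = s x' u' \<longrightarrow> x = x' \<and> u = u')"
  proof (intro eventually_ball_finite[OF F(1)] ballI eventually_conj)
    fix x assume x: "x \<in> F"
    then have "\<delta> x > 0" using disc by (auto simp: embedded_disc_def)
    then have R\<delta>: "\<forall>\<^sub>F R in at_right 0. R \<le> \<delta> x"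
      by (intro eventually_at_rightI[of 0 "\<delta> x"]) auto
    then show "\<forall>\<^sub>F R in at_right 0. R \<le> \<delta> x" .
    fix x' assume x': "x' \<in> F"
    show "\<forall>\<^sub>F R in at_right 0. \<forall>u\<in>ball 0 R. \<forall>u'\<in>ball 0 R. s x u = s x' u' \<longrightarrow> x = x' \<and> u = u'"
    proof (cases "x = x'")
      case True
      from R\<delta> show ?thesis
      proof eventually_elim
        case (elim R)
        have "inj_on (s x) (ball 0 (\<delta> x))" using disc[OF x] by (simp add: embedded_disc_def)
        then have "inj_on (s x) (ball 0 R)" by (rule inj_on_subset) (use elim in auto)
        then show ?case using True by (auto dest: inj_onD)
      qed
    next
      case False
      then have "x \<in> pts M \<and> x' \<in> pts M \<and> x \<noteq> x'" using x x' F(2) by blast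
      from M[unfolded Hausdorff_space_def, rule_format, OF this]
      obtain A B where AB: "openin (stop M) A" "openin (stop M) B" "x \<in> A" "x' \<in> B" "disjnt A B"
        by blast
      from small[OF x AB(1,3)] small[OF x' AB(2,4)] show ?thesis
      proof eventually_elim
        case (elim R)
        show ?case
        proof (intro ballI impI)
          fix u u' assume u: "u \<in> ball 0 R" "u' \<in> ball 0 R" and eq: "s x u = s x' u'"
          have "s x u \<in> A" "s x' u' \<in> B" using elim u by blast+
          then have "s x u \<in> A \<inter> B" using eq by simp
          then show "x = x' \<and> u = u'" using AB(5) unfolding disjnt_def by blast
        qed
      qed
    qed
  qed
  moreover have "\<forall>\<^sub>F R in at_right (0::real). 0 < R \<and> R \<le> 1"
    by (intro eventually_at_rightI[of 0 1]) auto
  ultimately have "\<forall>\<^sub>F R in at_right 0. (0 < R \<and> R \<le> 1) \<and> (\<forall>x\<in>F. R \<le> \<delta> x \<and>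
      (\<forall>x'\<in>F. \<forall>u\<in>ball 0 R. \<forall>u'\<in>ball 0 R. s x u = s x' u' \<longrightarrow> x = x' \<and> u = u'))"
    by (rule eventually_conj[rotated])
  from eventually_happens[OF this] show thesis using that by (auto simp: trivial_limit_at_right_real)
qed

context covering_pair
begin

sublocale rho: finite_holomorphic_map X Y \<rho>
  using surfaces cover by unfold_locales (auto simp: covering_def)

sublocale kappa: finite_holomorphic_map T X \<kappa>
  using surfaces etale by unfold_locales (auto simp: etale_double_cover_def covering_def)

abbreviation idx :: "'x \<Rightarrow> nat" where
  "idx \<equiv> ramification_index X Y \<rho>"

lemma idx_pos: "p \<in> pts X \<Longrightarrow> idx p > 0"
proof -
  assume p: "p \<in> pts X"
  obtain A \<alpha> where "(A, \<alpha>) \<in> charts Y" "\<rho> p \<in> A"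
    using chart_at[OF surfaces(3) rho_in[OF p]] by blast
  then show ?thesis
    using rho.local_section[OF p chart_local_coordinate[OF surfaces(3)]] by blast
qed

lemma idx_cases: "p \<in> pts X \<Longrightarrow> idx p = 1 \<or> idx p = 2"
  using simple by (auto simp: simply_ramified_def ramification_point_def)

lemma idx_2_unique: "p \<in> pts X \<Longrightarrow> p' \<in> pts X \<Longrightarrow> idx p = 2 \<Longrightarrow> idx p' = 2 \<Longrightarrow> \<rho> p = \<rho> p' \<Longrightarrow> p = p'"
  using simple by (auto simp: simply_ramified_def ramification_point_def)

lemma idx_kappa: "x \<in> pts T \<Longrightarrow> ramification_index T X \<kappa> x = 1"
  using etale by (auto simp: etale_double_cover_def ramified_def ramification_point_def)

end

text \<open>
  The local model near the fibre over \<open>y\<close>. The discs \<open>r p\<close> around the points of \<open>X\<close> over \<open>y\<close> make \<open>\<rho>\<close> a power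
  in the coordinate \<open>\<gamma>\<close>, the discs \<open>s x\<close> around the points of \<open>\<kappa>\<^sup>-\<^sup>1(\<rho>\<^sup>-\<^sup>1(y))\<close> lift them,
  and all discs in the same surface are disjoint.
\<close>

locale fibre_discs = covering_pair T X Y \<kappa> \<rho> n
  for T :: "'t surface" and X :: "'x surface" and Y :: "'y surface"
    and \<kappa> :: "'t \<Rightarrow> 'x" and \<rho> :: "'x \<Rightarrow> 'y" and n :: nat +
  fixes y :: 'y and \<Gamma> :: "'y set" and \<gamma> :: "'y \<Rightarrow> complex" and R :: real
    and r :: "'x \<Rightarrow> complex \<Rightarrow> 'x" and s :: "'t \<Rightarrow> complex \<Rightarrow> 't"
  assumes y: "y \<in> pts Y" "y \<in> \<Gamma>" and \<gamma>: "local_coordinate Y \<Gamma> \<gamma>" and R: "0 < R" "R \<le> 1"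
    and r_inj: "\<And>p p' u u'. p \<in> fibre X \<rho> y \<Longrightarrow> p' \<in> fibre X \<rho> y \<Longrightarrow> u \<in> ball 0 R \<Longrightarrow> u' \<in> ball 0 R \<Longrightarrow>
      r p u = r p' u' \<Longrightarrow> p = p' \<and> u = u'"
    and r_in: "\<And>p u. p \<in> fibre X \<rho> y \<Longrightarrow> u \<in> ball 0 R \<Longrightarrow> r p u \<in> pts X \<and> \<rho> (r p u) \<in> \<Gamma> \<and> \<gamma> (\<rho> (r p u)) = \<gamma> y + u ^ idx p"
    and r_0: "\<And>p. p \<in> fibre X \<rho> y \<Longrightarrow> r p 0 = p"
    and s_inj: "\<And>x x' u u'. x \<in> fibre T (\<rho> \<circ> \<kappa>) y \<Longrightarrow> x' \<in> fibre T (\<rho> \<circ> \<kappa>) y \<Longrightarrow> u \<in> ball 0 R \<Longrightarrow> u' \<in> ball 0 R \<Longrightarrow>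
      s x u = s x' u' \<Longrightarrow> x = x' \<and> u = u'"
    and s_disc: "\<And>x. x \<in> fibre T (\<rho> \<circ> \<kappa>) y \<Longrightarrow> embedded_disc T R (s x)"
    and s_0: "\<And>x. x \<in> fibre T (\<rho> \<circ> \<kappa>) y \<Longrightarrow> s x 0 = x"
    and kappa_s: "\<And>x u. x \<in> fibre T (\<rho> \<circ> \<kappa>) y \<Longrightarrow> u \<in> ball 0 R \<Longrightarrow> \<kappa> (s x u) = r (\<kappa> x) u"

lemma embedded_disc_in: "embedded_disc M \<delta> s \<Longrightarrow> u \<in> ball 0 \<delta> \<Longrightarrow> s u \<in> pts M"
  unfolding embedded_disc_def continuous_map_def by auto

text \<open>
  The discs in \<open>T\<close> come from the same lemma as those in \<open>X\<close>, applied to \<open>\<kappa>\<close> and the coordinate on \<open>X\<close>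
  inverse to \<open>r p\<close>: the exponent is 1 because \<open>\<kappa>\<close> is unramified.
\<close>

lemma (in covering_pair) fibre_discs_exist:
  assumes y: "y \<in> pts Y"
  obtains \<Gamma> \<gamma> R r s where "fibre_discs T X Y \<kappa> \<rho> n y \<Gamma> \<gamma> R r s"
proof -
  define P where "P = fibre X \<rho> y"
  define F where "F = fibre T (\<rho> \<circ> \<kappa>) y"
  have P: "finite P" "P \<subseteq> pts X" "\<And>p. p \<in> P \<Longrightarrow> \<rho> p = y"
    using rho.finite_fibre[OF y] by (auto simp: P_def fibre_def)
  have F: "F \<subseteq> pts T" "\<And>x. x \<in> F \<Longrightarrow> \<kappa> x \<in> P" using kappa_in by (auto simp: F_def P_def fibre_def)
  have "F \<subseteq> (\<Union>p\<in>P. fibre T \<kappa> p)" using F by (auto simp: fibre_def)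
  then have fF: "finite F" using P kappa.finite_fibre by (meson finite_UN_I finite_subset subsetD)
  obtain \<Gamma> \<gamma> where \<Gamma>: "(\<Gamma>, \<gamma>) \<in> charts Y" "y \<in> \<Gamma>" using chart_at[OF surfaces(3) y] by blast
  note loc = chart_local_coordinate[OF surfaces(3) \<Gamma>(1)]
  have "\<exists>\<delta> r. embedded_disc X \<delta> r \<and> r 0 = p \<and>
      (\<forall>u\<in>ball 0 \<delta>. \<rho> (r u) \<in> \<Gamma> \<and> \<gamma> (\<rho> (r u)) = \<gamma> y + u ^ idx p)" if p: "p \<in> P" for p
  proof -
    have "p \<in> pts X" "\<rho> p \<in> \<Gamma>" using P p \<Gamma> by auto
    then obtain \<delta> r where "embedded_disc X \<delta> r" "r 0 = p"
      "\<And>u. u \<in> ball 0 \<delta> \<Longrightarrow> \<rho> (r u) \<in> \<Gamma> \<and> \<gamma> (\<rho> (r u)) = \<gamma> (\<rho> p) + u ^ idx p"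
      by (rule rho.local_section[OF _ loc]) (rule that)
    then show ?thesis using P(3)[OF p] by blast
  qed
  then obtain \<delta> r where r: "\<And>p. p \<in> P \<Longrightarrow> embedded_disc X (\<delta> p) (r p)" "\<And>p. p \<in> P \<Longrightarrow> r p 0 = p"
    "\<And>p u. p \<in> P \<Longrightarrow> u \<in> ball 0 (\<delta> p) \<Longrightarrow> \<rho> (r p u) \<in> \<Gamma> \<and> \<gamma> (\<rho> (r p u)) = \<gamma> y + u ^ idx p"
    by metis
  have "Hausdorff_space (stop X)" "Hausdorff_space (stop T)"
    using surfaces by (auto simp: riemann_surface_def)
  note H = this
  obtain R1 where R1: "0 < R1" "R1 \<le> 1" "\<And>p. p \<in> P \<Longrightarrow> R1 \<le> \<delta> p"
    and r_inj: "\<And>p p' u u'. p \<in> P \<Longrightarrow> p' \<in> P \<Longrightarrow> u \<in> ball 0 R1 \<Longrightarrow> u' \<in> ball 0 R1 \<Longrightarrow> r p u = r p' u' \<Longrightarrow> p = p' \<and> u = u'"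
    using disjoint_small_discs[OF H(1) P(1,2) r(1,2)] by metis
  have r1: "embedded_disc X R1 (r p)" if "p \<in> P" for p
    using embedded_disc_shrink[OF surfaces(2) r(1)[OF that] R1(1) R1(3)[OF that]] .
  have "\<exists>\<delta> s. embedded_disc T \<delta> s \<and> s 0 = x \<and> (\<forall>u\<in>ball 0 \<delta>. u \<in> ball 0 R1 \<and> \<kappa> (s u) = r (\<kappa> x) u)" if x: "x \<in> F" for x
  proof -
    define p where "p = \<kappa> x"
    have p: "p \<in> P" using F x by (simp add: p_def)
    have loc': "local_coordinate X (r p ` ball 0 R1) (inv_into (ball 0 R1) (r p))"
      and inj: "inj_on (r p) (ball 0 R1)"
      using r1[OF p] by (simp_all add: embedded_disc_def)
    have inv: "inv_into (ball 0 R1) (r p) (r p u) = u" if "u \<in> ball 0 R1" for u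
      using inj that by (rule inv_into_f_f)
    have "\<kappa> x = r p 0" using r(2)[OF p] by (simp add: p_def)
    then have mem: "\<kappa> x \<in> r p ` ball 0 R1" using R1(1) by (metis centre_in_ball imageI)
    have invx: "inv_into (ball 0 R1) (r p) (\<kappa> x) = 0"
      using inv[of 0] R1(1) \<open>\<kappa> x = r p 0\<close> by simp
    obtain \<delta>' s where s: "embedded_disc T \<delta>' s" "s 0 = x"
      "\<And>u. u \<in> ball 0 \<delta>' \<Longrightarrow> \<kappa> (s u) \<in> r p ` ball 0 R1 \<and>
        inv_into (ball 0 R1) (r p) (\<kappa> (s u)) = inv_into (ball 0 R1) (r p) (\<kappa> x) + u ^ ramification_index T X \<kappa> x"
      by (rule kappa.local_section[OF subsetD[OF F(1) x] loc' mem]) (rule that)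
    have "u \<in> ball 0 R1 \<and> \<kappa> (s u) = r p u" if u: "u \<in> ball 0 \<delta>'" for u
    proof -
      obtain v where v: "v \<in> ball 0 R1" "\<kappa> (s u) = r p v" using s(3)[OF u] by blast
      then have "v = u" using s(3)[OF u] inv[OF v(1)] invx idx_kappa F x by auto
      then show ?thesis using v by simp
    qed
    then show ?thesis using s(1,2) unfolding p_def by blast
  qed
  then obtain \<delta>' s where s: "\<And>x. x \<in> F \<Longrightarrow> embedded_disc T (\<delta>' x) (s x)" "\<And>x. x \<in> F \<Longrightarrow> s x 0 = x"
    "\<And>x u. x \<in> F \<Longrightarrow> u \<in> ball 0 (\<delta>' x) \<Longrightarrow> u \<in> ball 0 R1 \<and> \<kappa> (s x u) = r (\<kappa> x) u"
    by metis
  obtain R2 where R2: "0 < R2" "R2 \<le> 1" "\<And>x. x \<in> F \<Longrightarrow> R2 \<le> \<delta>' x"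
    and s_inj: "\<And>x x' u u'. x \<in> F \<Longrightarrow> x' \<in> F \<Longrightarrow> u \<in> ball 0 R2 \<Longrightarrow> u' \<in> ball 0 R2 \<Longrightarrow> s x u = s x' u' \<Longrightarrow> x = x' \<and> u = u'"
    using disjoint_small_discs[OF H(2) fF F(1) s(1,2)] by metis
  define R where "R = min R1 R2"
  have R: "0 < R" "R \<le> 1" "R \<le> R1" "R \<le> R2" using R1 R2 by (auto simp: R_def)
  have sub: "ball 0 R \<subseteq> (ball 0 R1 :: complex set)" "ball 0 R \<subseteq> (ball 0 R2 :: complex set)" using R by auto
  have "fibre_discs T X Y \<kappa> \<rho> n y \<Gamma> \<gamma> R r s"
  proof (unfold_locales, fold P_def F_def)
    show "p = p' \<and> u = u'" if "p \<in> P" "p' \<in> P" "u \<in> ball 0 R" "u' \<in> ball 0 R" "r p u = r p' u'" for p p' u u'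
      using r_inj[of p p' u u'] that sub by blast
    show "x = x' \<and> u = u'" if "x \<in> F" "x' \<in> F" "u \<in> ball 0 R" "u' \<in> ball 0 R" "s x u = s x' u'" for x x' u u'
      using s_inj[of x x' u u'] that sub by blast
    show "r p u \<in> pts X \<and> \<rho> (r p u) \<in> \<Gamma> \<and> \<gamma> (\<rho> (r p u)) = \<gamma> y + u ^ idx p" if "p \<in> P" "u \<in> ball 0 R" for p u
    proof -
      have "u \<in> ball 0 (\<delta> p)" using that sub R1(3)[OF that(1)] by auto
      then show ?thesis using r(3) embedded_disc_in[OF r(1)] that by blast
    qed
    show "embedded_disc T R (s x)" if "x \<in> F" for x
      using embedded_disc_shrink[OF surfaces(1) s(1)[OF that] R(1)] R2(3)[OF that] R(4) by simp
    show "\<kappa> (s x u) = r (\<kappa> x) u" if "x \<in> F" "u \<in> ball 0 R" for x u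
    proof -
      have "u \<in> ball 0 (\<delta>' x)" using that sub R2(3)[OF that(1)] by auto
      then show ?thesis using s(3) that by blast
    qed
  qed (use y \<Gamma> loc R r(2) s(2) in auto)
  then show thesis by (rule that)
qed

section \<open>Divisors near a fibre\<close>

text \<open>
  The roots of \<open>u\<^sup>e = w\<close> with multiplicity, for \<open>e \<in> {1, 2}\<close>.
\<close>

definition square_roots :: "nat \<Rightarrow> complex \<Rightarrow> complex multiset" where
  "square_roots e w = (if e = 1 then {#w#} else {#csqrt w, - csqrt w#})"

lemma sum_mset_set_disjoint:
  assumes "finite I" "\<And>i. i \<in> I \<Longrightarrow> finite (A i)" "\<And>i j. i \<in> I \<Longrightarrow> j \<in> I \<Longrightarrow> i \<noteq> j \<Longrightarrow> A i \<inter> A j = {}"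
  shows "(\<Sum>i\<in>I. mset_set (A i)) = mset_set (\<Union>i\<in>I. A i)"
  using assms
proof (induction I)
  case (insert i I)
  have "A i \<inter> \<Union> (A ` I) = {}" using insert by blast
  then show ?case using insert by (simp add: mset_set_Union)
qed simp

lemma size_sum_mset_family: "finite I \<Longrightarrow> size (\<Sum>i\<in>I. M i :: 'b multiset) = (\<Sum>i\<in>I. size (M i))"
  by (induction I rule: finite_induct) simp_all

lemma set_mset_sum_family: "finite I \<Longrightarrow> set_mset (\<Sum>i\<in>I. M i) = (\<Union>i\<in>I. set_mset (M i))"
  by (induction I rule: finite_induct) simp_all

lemma image_mset_sum_family: "finite I \<Longrightarrow> image_mset f (\<Sum>i\<in>I. M i) = (\<Sum>i\<in>I. image_mset f (M i))"
  by (induction I rule: finite_induct) simp_all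

context fibre_discs
begin

abbreviation "P \<equiv> fibre X \<rho> y"
abbreviation "F \<equiv> fibre T (\<rho> \<circ> \<kappa>) y"
abbreviation "E x \<equiv> idx (\<kappa> x)"

lemma finite_P: "finite P"
  by (rule rho.finite_fibre[OF y(1)])

lemma P_D: "p \<in> P \<Longrightarrow> p \<in> pts X" "p \<in> P \<Longrightarrow> \<rho> p = y"
  by (auto simp: fibre_def)

lemma F_D: "x \<in> F \<Longrightarrow> x \<in> pts T" "x \<in> F \<Longrightarrow> \<kappa> x \<in> P" "x \<in> F \<Longrightarrow> other x \<in> F" "x \<in> F \<Longrightarrow> E (other x) = E x"
  using kappa_in other_in kappa_other by (auto simp: fibre_def)

lemma idx_P: "p \<in> P \<Longrightarrow> idx p = 1 \<or> idx p = 2"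
  using idx_cases P_D by blast

lemma E_cases: "x \<in> F \<Longrightarrow> E x = 1 \<or> E x = 2"
  using idx_P F_D by blast

lemma idx_P_unique: "p \<in> P \<Longrightarrow> p' \<in> P \<Longrightarrow> idx p = 2 \<Longrightarrow> idx p' = 2 \<Longrightarrow> p = p'"
  using idx_2_unique P_D by metis

text \<open>
  For every point of the fibre, these parameters correspond to the same disc of radius \<open>R\<^sup>2\<close> around
  \<open>y\<close> in the coordinate \<open>\<gamma>\<close>.
\<close>

definition Dom :: "nat \<Rightarrow> complex set" where
  "Dom e = {u. norm (u ^ e) < R\<^sup>2}"

lemma Dom_ball:
  assumes "e = 1 \<or> e = 2" "u \<in> Dom e"
  shows "u \<in> ball 0 R"
proof -
  have "R\<^sup>2 \<le> R" using R by (simp add: power2_eq_square mult_le_one mult_left_le)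
  then show ?thesis using assms R
    by (auto simp: Dom_def norm_power abs_less_iff power2_less_imp_less)
qed

lemma Dom_F: "x \<in> F \<Longrightarrow> u \<in> Dom (E x) \<Longrightarrow> u \<in> ball 0 R"
  using Dom_ball E_cases by blast

lemma Dom_P: "p \<in> P \<Longrightarrow> u \<in> Dom (idx p) \<Longrightarrow> u \<in> ball 0 R"
  using Dom_ball idx_P by blast

lemma open_Dom: "open (Dom e)"
  unfolding Dom_def by (intro open_Collect_less continuous_intros)

lemma Dom_square: "b \<in> Dom 2 \<Longrightarrow> b\<^sup>2 \<in> Dom 1" "b \<in> Dom 2 \<Longrightarrow> - b \<in> Dom 2" "w \<in> Dom 1 \<Longrightarrow> csqrt w \<in> Dom 2"
  by (auto simp: Dom_def)

lemma zero_in_Dom: "e = 1 \<or> e = 2 \<Longrightarrow> 0 \<in> Dom e"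
  using R by (auto simp: Dom_def)

definition disc :: "'t \<Rightarrow> 't set" where
  "disc x = s x ` Dom (E x)"

definition tube :: "'t set" where
  "tube = (\<Union>x\<in>F. disc x)"

text \<open>
  A point of a disc is determined by the centre of the disc and the parameter. The centres of a nearby
  divisor tell which point of the fibre product it is close to.
\<close>

definition centre :: "'t \<Rightarrow> 't" where
  "centre q = (SOME x. x \<in> F \<and> q \<in> disc x)"

definition coord :: "'t \<Rightarrow> complex" where
  "coord q = (SOME u. u \<in> Dom (E (centre q)) \<and> q = s (centre q) u)"

lemma s_in_tube: "x \<in> F \<Longrightarrow> u \<in> Dom (E x) \<Longrightarrow> s x u \<in> tube"
  by (auto simp: tube_def disc_def)

lemma centre_s: assumes "x \<in> F" "u \<in> Dom (E x)" shows "centre (s x u) = x"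
  unfolding centre_def
proof (rule some_equality)
  show "x \<in> F \<and> s x u \<in> disc x" using assms by (auto simp: disc_def)
  show "x' = x" if "x' \<in> F \<and> s x u \<in> disc x'" for x'
    using that assms s_inj Dom_F unfolding disc_def by blast
qed

lemma coord_s: assumes "x \<in> F" "u \<in> Dom (E x)" shows "coord (s x u) = u"
  unfolding coord_def centre_s[OF assms]
  by (rule some_equality) (use assms s_inj Dom_F in blast)+

lemma tubeE:
  assumes "q \<in> tube" obtains x u where "x \<in> F" "u \<in> Dom (E x)" "q = s x u" "centre q = x" "coord q = u"
  using assms centre_s coord_s unfolding tube_def disc_def by blast

lemma tube_D:
  assumes "q \<in> tube"
  shows "centre q \<in> F" "coord q \<in> Dom (E (centre q))" "s (centre q) (coord q) = q" "q \<in> disc (centre q)"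
  using assms by (auto elim!: tubeE simp: disc_def)

lemma s_in: "x \<in> F \<Longrightarrow> u \<in> Dom (E x) \<Longrightarrow> s x u \<in> pts T"
  using embedded_disc_in[OF s_disc] Dom_F by blast

lemma tube_in: "q \<in> tube \<Longrightarrow> q \<in> pts T"
  using s_in by (auto elim!: tubeE)

lemma other_s:
  assumes x: "x \<in> F" and u: "u \<in> Dom (E x)"
  shows "other (s x u) = s (other x) u"
proof (rule other_point_eqI)
  have u': "u \<in> Dom (E (other x))" using u F_D(4)[OF x] by simp
  show "s x u \<in> pts T" "s (other x) u \<in> pts T" using s_in x u u' F_D(3) by auto
  have "u \<in> ball 0 R" using Dom_F x u by blast
  then show "\<kappa> (s (other x) u) = \<kappa> (s x u)"
    using kappa_s x F_D(3) kappa_other[OF F_D(1)[OF x]] by simp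
  show "s (other x) u \<noteq> s x u"
    using centre_s[OF x u] centre_s[OF F_D(3)[OF x] u'] fibre_kappa(2)[OF F_D(1)[OF x]] by auto
qed

lemma tube_other:
  assumes "q \<in> tube"
  shows "other q \<in> tube" "centre (other q) = other (centre q)" "coord (other q) = coord q"
proof -
  obtain x u where q: "x \<in> F" "u \<in> Dom (E x)" "q = s x u" "centre q = x" "coord q = u"
    using assms by (rule tubeE)
  have "other x \<in> F" "u \<in> Dom (E (other x))" using q F_D by auto
  then show "other q \<in> tube" "centre (other q) = other (centre q)" "coord (other q) = coord q"
    using q other_s s_in_tube centre_s coord_s by auto
qed

lemma rho_r:
  assumes "p \<in> P" "u \<in> Dom (idx p)" "y1 \<in> \<Gamma>"
  shows "\<rho> (r p u) = y1 \<longleftrightarrow> \<gamma> y1 = \<gamma> y + u ^ idx p"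
proof -
  have "r p u \<in> pts X \<and> \<rho> (r p u) \<in> \<Gamma> \<and> \<gamma> (\<rho> (r p u)) = \<gamma> y + u ^ idx p"
    using r_in Dom_P assms by blast
  moreover have "inj_on \<gamma> \<Gamma>" using \<gamma> by (simp add: local_coordinate_def)
  ultimately show ?thesis using assms(3) by (metis inj_onD)
qed

lemma square_roots_root:
  assumes "e = 1 \<or> e = 2" "w \<in> Dom 1" "u \<in># square_roots e w"
  shows "u \<in> Dom e" "u ^ e = w"
  using assms by (auto simp: square_roots_def Dom_def split: if_splits)

lemma sum_idx: "y1 \<in> pts Y \<Longrightarrow> (\<Sum>p\<in>fibre X \<rho> y1. idx p) = n"
  using cover by (auto simp: covering_def)

text \<open>
  The points on the right all lie over \<open>y1\<close>. If \<open>y1 \<noteq> y\<close>, then they are distinct, so the sum is contained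
  in the pullback, and it equals the pullback because both have degree \<open>n\<close>.
\<close>

lemma pullback_near:
  assumes y1: "y1 \<in> pts Y" "y1 \<in> \<Gamma>" "\<gamma> y1 = \<gamma> y + w" and w: "w \<in> Dom 1"
  shows "pullback_divisor X Y \<rho> y1 = (\<Sum>p\<in>P. image_mset (r p) (square_roots (idx p) w))"
proof (cases "w = 0")
  case True
  have "y1 = y" using y1 y True \<gamma> by (auto simp: local_coordinate_def dest: inj_onD)
  moreover have "image_mset (r p) (square_roots (idx p) 0) = replicate_mset (idx p) p" if "p \<in> P" for p
    using idx_P[OF that] r_0[OF that] by (auto simp: square_roots_def numeral_2_eq_2)
  ultimately show ?thesis using True by (simp add: pullback_divisor_def cong: sum.cong)
next
  case False
  define M where "M = (\<Sum>p\<in>P. image_mset (r p) (square_roots (idx p) w))"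
  define N where "N = pullback_divisor X Y \<rho> y1"
  define A where "A p = r p ` set_mset (square_roots (idx p) w)" for p
  have root: "u \<in> ball 0 R" if "p \<in> P" "u \<in># square_roots (idx p) w" for p u
    using square_roots_root(1)[OF idx_P[OF that(1)] w that(2)] Dom_P[OF that(1)] by blast
  have part: "image_mset (r p) (square_roots (idx p) w) = mset_set (A p)" if p: "p \<in> P" for p
  proof -
    have "square_roots (idx p) w = mset_set (set_mset (square_roots (idx p) w))"
      using False by (auto simp: square_roots_def)
    moreover have "inj_on (r p) (set_mset (square_roots (idx p) w))"
      using r_inj[OF p p] root[OF p] by (auto simp: inj_on_def)
    ultimately show ?thesis unfolding A_def by (metis image_mset_mset_set)
  qed
  have "M = (\<Sum>p\<in>P. mset_set (A p))" using part by (simp add: M_def)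
  also have "\<dots> = mset_set (\<Union>p\<in>P. A p)"
  proof (rule sum_mset_set_disjoint[OF finite_P])
    show "finite (A p)" for p by (simp add: A_def)
    show "A p \<inter> A p' = {}" if "p \<in> P" "p' \<in> P" "p \<noteq> p'" for p p'
      using r_inj root that unfolding A_def by blast
  qed
  finally have M: "M = mset_set (\<Union>p\<in>P. A p)" .
  have fin: "finite (fibre X \<rho> y1)" by (rule rho.finite_fibre[OF y1(1)])
  have setN: "set_mset N = fibre X \<rho> y1"
  proof -
    have "idx p \<noteq> 0" if "p \<in> fibre X \<rho> y1" for p using idx_pos[of p] that by (auto simp: fibre_def)
    then show ?thesis
      unfolding N_def pullback_divisor_def set_mset_sum_family[OF fin] by auto
  qed
  have "(\<Union>p\<in>P. A p) \<subseteq> set_mset N"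
  proof
    fix q assume "q \<in> (\<Union>p\<in>P. A p)"
    then obtain p u where p: "p \<in> P" and u: "u \<in># square_roots (idx p) w" and q: "q = r p u" by (auto simp: A_def)
    have "u \<in> Dom (idx p)" "u ^ idx p = w" using square_roots_root[OF idx_P[OF p] w u] by auto
    then have "\<rho> q = y1" "q \<in> pts X" using rho_r[OF p _ y1(2)] y1(3) r_in[OF p root[OF p u]] q by auto
    then show "q \<in> set_mset N" unfolding setN by (simp add: fibre_def)
  qed
  then have "mset_set (\<Union>p\<in>P. A p) \<subseteq># mset_set (set_mset N)"
    by (intro subset_imp_msubset_mset_set) auto
  then have "M \<subseteq># N" unfolding M using mset_set_set_mset_msubset subset_mset.order_trans by blast
  moreover have "size M = size N"
  proof -
    have "size M = (\<Sum>p\<in>P. size (square_roots (idx p) w))"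
      unfolding M_def size_sum_mset_family[OF finite_P] by simp
    also have "\<dots> = (\<Sum>p\<in>P. idx p)"
    proof (rule sum.cong[OF refl])
      fix p assume "p \<in> P"
      from idx_P[OF this] show "size (square_roots (idx p) w) = idx p" by (auto simp: square_roots_def)
    qed
    also have "\<dots> = size N"
      unfolding N_def pullback_divisor_def size_sum_mset_family[OF fin]
      using sum_idx[OF y(1)] sum_idx[OF y1(1)] by simp
    finally show ?thesis .
  qed
  ultimately have "M = N" by (metis mset_subset_size nat_neq_iff subset_mset.le_imp_less_or_eq)
  then show ?thesis by (simp add: M_def N_def)
qed

lemma pullback_y: "pullback_divisor X Y \<rho> y = (\<Sum>p\<in>P. replicate_mset (idx p) p)"
  by (simp add: pullback_divisor_def)

lemma count_pullback_y: "count (pullback_divisor X Y \<rho> y) p = (if p \<in> P then idx p else 0)"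
proof -
  have "count (\<Sum>p\<in>A. replicate_mset (e p) p) p = (if p \<in> A then e p else 0)" if "finite A" for A and e :: "'x \<Rightarrow> nat"
    using that by (induction A) auto
  then show ?thesis unfolding pullback_y using finite_P by simp
qed

definition over_y :: "'t multiset \<Rightarrow> bool" where
  "over_y z \<longleftrightarrow> set_mset z \<subseteq> pts T \<and> image_mset \<kappa> z = pullback_divisor X Y \<rho> y"

lemma over_y_Ct: "over_y z \<Longrightarrow> z \<in> Ct"
  using y by (auto simp: over_y_def Ctilde_def)

lemma over_y_F: "over_y z \<Longrightarrow> x \<in># z \<Longrightarrow> x \<in> F"
proof -
  assume z: "over_y z" "x \<in># z"
  then have "\<kappa> x \<in># pullback_divisor X Y \<rho> y" by (metis over_y_def image_eqI set_image_mset)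
  then have "\<kappa> x \<in> P" by (metis count_pullback_y not_in_iff)
  then show ?thesis using z by (auto simp: over_y_def fibre_def)
qed

lemma over_y_primed: "over_y z \<Longrightarrow> over_y (primed z)"
  unfolding over_y_def using primed_subset image_kappa_primed by auto

lemma over_y_flip: "over_y z \<Longrightarrow> x \<in># z \<Longrightarrow> over_y (flip x z)"
  unfolding over_y_def using flip_subset image_kappa_flip by auto

lemma simple_point_unique:
  assumes z: "over_y z" and x: "x \<in># z" "E x = 1"
  shows "count z x = 1" "\<And>x'. x' \<in># z - {#x#} \<Longrightarrow> \<kappa> x' \<noteq> \<kappa> x"
proof -
  obtain w where w: "z = add_mset x w" using x(1) by (metis multi_member_split)
  have "count (image_mset \<kappa> z) (\<kappa> x) = 1"
    using z over_y_F[OF z x(1)] F_D(2) x(2) by (simp add: over_y_def count_pullback_y)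
  then have "count (image_mset \<kappa> w) (\<kappa> x) = 0" by (simp add: w)
  then have "\<kappa> x \<notin># image_mset \<kappa> w" by (simp add: count_eq_zero_iff)
  then have *: "\<kappa> x' \<noteq> \<kappa> x" if "x' \<in># w" for x' using that by (metis image_eqI set_image_mset)
  then have "x \<notin># w" by blast
  then show "count z x = 1" by (simp add: w count_eq_zero_iff)
  show "\<kappa> x' \<noteq> \<kappa> x" if "x' \<in># z - {#x#}" for x' using * that by (simp add: w)
qed

text \<open>
  By simple ramification a divisor over \<open>y\<close> has at most two members over ramification points, and these
  lie over the same one.
\<close>

lemma over_y_ramified:
  assumes z: "over_y z" and x1: "x1 \<in># z" "E x1 = 2"
  obtains x2 w where "z = {#x1, x2#} + w" "\<kappa> x2 = \<kappa> x1" "\<And>x. x \<in># w \<Longrightarrow> E x = 1"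
proof -
  obtain w1 where w1: "z = add_mset x1 w1" using x1(1) by (metis multi_member_split)
  have "count (image_mset \<kappa> z) (\<kappa> x1) = 2"
    using z over_y_F[OF z x1(1)] F_D(2) x1(2) by (simp add: over_y_def count_pullback_y)
  then have c1: "count (image_mset \<kappa> w1) (\<kappa> x1) = 1" by (simp add: w1)
  then have "\<kappa> x1 \<in># image_mset \<kappa> w1" by (metis count_greater_zero_iff zero_less_one)
  then obtain x2 where x2: "x2 \<in># w1" "\<kappa> x2 = \<kappa> x1" by auto
  then obtain w where w: "w1 = add_mset x2 w" by (metis multi_member_split)
  have "count (image_mset \<kappa> w) (\<kappa> x1) = 0" using c1 x2 by (simp add: w)
  then have notin: "\<kappa> x1 \<notin># image_mset \<kappa> w" by (simp add: count_eq_zero_iff)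
  show thesis
  proof (rule that[of x2 w])
    show "E x = 1" if x: "x \<in># w" for x
    proof (rule ccontr)
      assume "E x \<noteq> 1"
      moreover have "x \<in> F" "x1 \<in> F" using over_y_F[OF z] x x1 by (auto simp: w1 w)
      ultimately have "\<kappa> x = \<kappa> x1" using E_cases[of x] idx_P_unique[of "\<kappa> x" "\<kappa> x1"] F_D(2) x1 by auto
      then show False using notin x by (metis image_eqI set_image_mset)
    qed
  qed (use w1 w x2 in auto)
qed

lemma P_covered: "over_y z \<Longrightarrow> p \<in> P \<Longrightarrow> \<exists>x\<in>#z. \<kappa> x = p"
proof -
  assume z: "over_y z" "p \<in> P"
  then have "count (image_mset \<kappa> z) p > 0"
    using idx_pos[OF P_D(1)] by (simp add: over_y_def count_pullback_y)
  then have "p \<in># image_mset \<kappa> z" by simp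
  then show ?thesis by auto
qed

text \<open>
  Points of the fibre product whose members can be matched with those of \<open>z\<close>, each lying in
  the disc around its match.
\<close>

definition Nb :: "'t multiset \<Rightarrow> 't multiset set" where
  "Nb z = {z1 \<in> Ct. set_mset z1 \<subseteq> tube \<and> image_mset centre z1 = z}"

text \<open>
  The two kinds of families parametrise the neighbourhoods of divisors over \<open>y\<close>: \<open>simple_family\<close> if \<open>\<rho>\<close> is
  unramified over \<open>y\<close>, and \<open>ramified_family\<close> otherwise. In the latter, \<open>x1\<close> and \<open>x2\<close> are the
  members over the ramification point, equal or conjugate.
\<close>

definition simple_family :: "'t multiset \<Rightarrow> complex \<Rightarrow> 't multiset" where
  "simple_family z w = image_mset (\<lambda>x. s x w) z"

definition ramified_family :: "'t \<Rightarrow> 't \<Rightarrow> 't multiset \<Rightarrow> complex \<Rightarrow> 't multiset" where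
  "ramified_family x1 x2 z b = {#s x1 b, s x2 (- b)#} + simple_family z (b\<^sup>2)"

text \<open>
  All members lie over the same point of \<open>Y\<close>, whose coordinate can be read off from any of them.
\<close>

lemma displacement:
  assumes z: "z \<in> Ct" "set_mset z \<subseteq> tube"
  obtains w where "w \<in> Dom 1" "\<And>q. q \<in># z \<Longrightarrow> coord q ^ E (centre q) = w"
    "image_mset \<kappa> z = (\<Sum>p\<in>P. image_mset (r p) (square_roots (idx p) w))"
proof -
  obtain y1 where y1: "y1 \<in> pts Y" "image_mset \<kappa> z = pullback_divisor X Y \<rho> y1" using CtD(4)[OF z(1)] by blast
  have fin: "finite (fibre X \<rho> y1)" by (rule rho.finite_fibre[OF y1(1)])
  have \<rho>q: "\<rho> (\<kappa> q) = y1" if "q \<in># z" for q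
  proof -
    have "\<kappa> q \<in># pullback_divisor X Y \<rho> y1" using that y1(2) by (metis image_eqI set_image_mset)
    then show ?thesis unfolding pullback_divisor_def set_mset_sum_family[OF fin] by (auto simp: fibre_def split: if_splits)
  qed
  have q: "y1 \<in> \<Gamma> \<and> \<gamma> y1 = \<gamma> y + coord q ^ E (centre q) \<and> coord q ^ E (centre q) \<in> Dom 1" if q: "q \<in># z" for q
  proof -
    obtain x u where x: "x \<in> F" "u \<in> Dom (E x)" "q = s x u" "centre q = x" "coord q = u"
      using z(2) q by (blast elim: tubeE)
    have "\<kappa> q = r (\<kappa> x) u" using kappa_s x Dom_F by blast
    moreover have "\<rho> (r (\<kappa> x) u) \<in> \<Gamma> \<and> \<gamma> (\<rho> (r (\<kappa> x) u)) = \<gamma> y + u ^ E x"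
      using r_in F_D(2)[OF x(1)] Dom_F x by blast
    ultimately show ?thesis using \<rho>q[OF q] x by (simp add: Dom_def)
  qed
  have "z \<noteq> {#}" using CtD(2)[OF z(1)] degree by auto
  then obtain q0 where q0: "q0 \<in># z" by auto
  define w where "w = coord q0 ^ E (centre q0)"
  show thesis
  proof (rule that[of w])
    show "w \<in> Dom 1" using q[OF q0] by (simp add: w_def)
    show "coord q' ^ E (centre q') = w" if "q' \<in># z" for q' using q[OF q0] q[OF that] by (simp add: w_def)
    show "image_mset \<kappa> z = (\<Sum>p\<in>P. image_mset (r p) (square_roots (idx p) w))"
      using pullback_near[OF y1(1), of w] q[OF q0] y1(2) by (simp add: w_def)
  qed
qed

lemma Nb_simple_part:
  assumes "image_mset centre z1 = z" "set_mset z1 \<subseteq> tube" "\<And>q. q \<in># z1 \<Longrightarrow> coord q ^ E (centre q) = w"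
    and "\<And>x. x \<in># z \<Longrightarrow> E x = 1"
  shows "z1 = simple_family z w"
proof -
  have "image_mset (\<lambda>q. s (centre q) w) z1 = image_mset id z1"
  proof (rule image_mset_cong)
    fix q assume q: "q \<in># z1"
    then have "E (centre q) = 1" using assms(1,4) by auto
    then have "coord q = w" using assms(3)[OF q] by simp
    then show "s (centre q) w = id q" using tube_D(3)[of q] q assms(2) by auto
  qed
  then show ?thesis unfolding simple_family_def assms(1)[symmetric] by (simp add: multiset.map_comp o_def)
qed

lemma Nb_simple:
  assumes z: "over_y z" and simple: "\<And>x. x \<in># z \<Longrightarrow> E x = 1" and z1: "z1 \<in> Nb z"
  obtains w where "w \<in> Dom 1" "z1 = simple_family z w"
proof -
  have z1': "z1 \<in> Ct" "set_mset z1 \<subseteq> tube" "image_mset centre z1 = z" using z1 by (auto simp: Nb_def)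
  obtain w where w: "w \<in> Dom 1" "\<And>q. q \<in># z1 \<Longrightarrow> coord q ^ E (centre q) = w"
    using displacement[OF z1'(1,2)] by blast
  show thesis using that[OF w(1)] Nb_simple_part[OF z1'(3,2) w(2) simple] by blast
qed

text \<open>
  The parameters \<open>b1, b2\<close> of the two members near the ramification point are both square roots of \<open>w\<close>.
  If they were equal and nonzero, then \<open>r p b1\<close> would occur twice in the image under \<open>\<kappa>\<close>, but pullbacks
  of points near \<open>y\<close>, other than \<open>y\<close> itself, have no multiple members.
\<close>

lemma Nb_ramified:
  assumes z: "over_y z" "z = {#x1, x2#} + v" and \<kappa>: "\<kappa> x2 = \<kappa> x1" "E x1 = 2" and simple: "\<And>x. x \<in># v \<Longrightarrow> E x = 1"
    and z1: "z1 \<in> Nb z"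
  obtains b where "b \<in> Dom 2" "z1 = ramified_family x1 x2 v b"
proof -
  have z1': "z1 \<in> Ct" "set_mset z1 \<subseteq> tube" "image_mset centre z1 = z" using z1 by (auto simp: Nb_def)
  obtain w where w: "w \<in> Dom 1" "\<And>q. q \<in># z1 \<Longrightarrow> coord q ^ E (centre q) = w"
    and image: "image_mset \<kappa> z1 = (\<Sum>p\<in>P. image_mset (r p) (square_roots (idx p) w))"
    using displacement[OF z1'(1,2)] by blast
  have "image_mset centre z1 = add_mset x1 (add_mset x2 v)" using z1'(3) z(2) by simp
  then obtain q1 z2 where q1: "z1 = add_mset q1 z2" "centre q1 = x1" "image_mset centre z2 = add_mset x2 v"
    by (metis msed_map_invR)
  then obtain q2 z3 where q2: "z2 = add_mset q2 z3" "centre q2 = x2" "image_mset centre z3 = v"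
    by (metis msed_map_invR)
  have z1_eq: "z1 = {#q1, q2#} + z3" using q1 q2 by simp
  define b1 where "b1 = coord q1"
  define b2 where "b2 = coord q2"
  have t: "q1 \<in> tube" "q2 \<in> tube" using z1'(2) z1_eq by auto
  have x: "x1 \<in> F" "x2 \<in> F" using tube_D(1)[OF t(1)] tube_D(1)[OF t(2)] q1 q2 by auto
  have E2: "E x2 = 2" using \<kappa> by simp
  have b: "b1 \<in> Dom 2" "b2 \<in> Dom 2" "s x1 b1 = q1" "s x2 b2 = q2"
    using tube_D[OF t(1)] tube_D[OF t(2)] q1 q2 \<kappa> E2 by (auto simp: b1_def b2_def)
  have sq: "b1\<^sup>2 = w" "b2\<^sup>2 = w" using w(2)[of q1] w(2)[of q2] z1_eq q1(2) q2(2) \<kappa> E2 by (auto simp: b1_def b2_def)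
  define p where "p = \<kappa> x1"
  have p: "p \<in> P" "idx p = 2" using F_D(2)[OF x(1)] \<kappa> by (auto simp: p_def)
  have bb: "b1 \<in> ball 0 R" "b2 \<in> ball 0 R" using Dom_ball b by blast+
  have \<kappa>q: "\<kappa> q1 = r p b1" "\<kappa> q2 = r p b2"
    using kappa_s[OF x(1) bb(1)] kappa_s[OF x(2) bb(2)] b \<kappa> by (auto simp: p_def)
  have "b2 = - b1"
  proof (rule ccontr)
    assume ne: "b2 \<noteq> - b1"
    then have eq: "b2 = b1" using sq power2_eq_iff by metis
    then have nz: "b1 \<noteq> 0" using ne by auto
    define c where "c = csqrt w"
    have c: "c \<in> Dom 2" "c\<^sup>2 = w" using Dom_square(3)[OF w(1)] by (auto simp: c_def)
    have cne: "c \<noteq> - c" using c sq nz by auto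
    have cb: "c \<in> ball 0 R" "- c \<in> ball 0 R" using Dom_ball[of 2] c(1) Dom_square(2) by blast+
    have rne: "r p c \<noteq> r p (- c)" using r_inj[OF p(1) p(1) cb] cne by blast
    have "image_mset \<kappa> z1 = {#r p c, r p (- c)#} + (\<Sum>p'\<in>P - {p}. image_mset (r p') (square_roots (idx p') w))"
      unfolding image sum.remove[OF finite_P p(1)] using p by (simp add: square_roots_def c_def)
    moreover have "r p b1 \<notin># (\<Sum>p'\<in>P - {p}. image_mset (r p') (square_roots (idx p') w))"
    proof
      assume "r p b1 \<in># (\<Sum>p'\<in>P - {p}. image_mset (r p') (square_roots (idx p') w))"
      then obtain p' u where *: "p' \<in> P" "p' \<noteq> p" "u \<in># square_roots (idx p') w" "r p b1 = r p' u"
        using finite_P by (auto simp: set_mset_sum_family)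
      then have "u \<in> ball 0 R" using square_roots_root(1)[OF idx_P w(1)] Dom_P by blast
      then show False using r_inj[OF p(1) *(1) bb(1)] * by blast
    qed
    then have "count (\<Sum>p'\<in>P - {p}. image_mset (r p') (square_roots (idx p') w)) (r p b1) = 0"
      by (rule iffD1[OF not_in_iff])
    ultimately have "count (image_mset \<kappa> z1) (r p b1) \<le> 1" using rne by auto
    moreover have "count (image_mset \<kappa> z1) (r p b1) \<ge> 2" using z1_eq \<kappa>q eq by simp
    ultimately show False by simp
  qed
  moreover have "z3 = simple_family v w"
    using Nb_simple_part[OF q2(3) _ _ simple] z1'(2) w(2) z1_eq by auto
  ultimately have "z1 = ramified_family x1 x2 v b1" using z1_eq b sq by (simp add: ramified_family_def)
  then show thesis using that b by blast
qed

lemma simple_family_centre: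
  assumes "\<forall>x\<in>#z. x \<in> F \<and> E x = 1" "w \<in> Dom 1"
  shows "set_mset (simple_family z w) \<subseteq> tube" "image_mset centre (simple_family z w) = z"
    "image_mset \<kappa> (simple_family z w) = image_mset (\<lambda>p. r p w) (image_mset \<kappa> z)"
proof -
  show "set_mset (simple_family z w) \<subseteq> tube"
    using assms s_in_tube by (auto simp: simple_family_def)
  have "image_mset (\<lambda>x. centre (s x w)) z = image_mset id z"
    by (rule image_mset_cong) (use assms centre_s in auto)
  then show "image_mset centre (simple_family z w) = z"
    by (simp add: simple_family_def multiset.map_comp o_def)
  have "image_mset (\<lambda>x. \<kappa> (s x w)) z = image_mset (\<lambda>x. r (\<kappa> x) w) z"
    by (rule image_mset_cong) (metis assms Dom_F kappa_s)
  then show "image_mset \<kappa> (simple_family z w) = image_mset (\<lambda>p. r p w) (image_mset \<kappa> z)"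
    by (simp add: simple_family_def multiset.map_comp o_def)
qed

lemma exists_displaced:
  assumes z: "over_y z" and w: "w \<in> Dom 1"
  obtains y1 where "y1 \<in> pts Y" "y1 \<in> \<Gamma>" "\<gamma> y1 = \<gamma> y + w"
proof -
  have "z \<noteq> {#}" using CtD(2)[OF over_y_Ct[OF z]] degree by auto
  then obtain x where x: "x \<in># z" by auto
  then have p: "\<kappa> x \<in> P" using over_y_F[OF z] F_D by blast
  have "\<exists>u. u \<in># square_roots (E x) w" by (cases "E x = 1") (auto simp: square_roots_def)
  then obtain u where u: "u \<in># square_roots (E x) w" by blast
  have "u \<in> Dom (E x)" "u ^ E x = w" using square_roots_root[OF idx_P[OF p] w u] by auto
  then have "r (\<kappa> x) u \<in> pts X \<and> \<rho> (r (\<kappa> x) u) \<in> \<Gamma> \<and> \<gamma> (\<rho> (r (\<kappa> x) u)) = \<gamma> y + w"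
    using r_in[OF p] Dom_P[OF p] by blast
  then show thesis using that rho_in by blast
qed

lemma in_CtI:
  assumes z: "over_y z" and w: "w \<in> Dom 1" and z1: "set_mset z1 \<subseteq> tube"
    "image_mset \<kappa> z1 = (\<Sum>p\<in>P. image_mset (r p) (square_roots (idx p) w))"
  shows "z1 \<in> Ct"
proof -
  obtain y1 where y1: "y1 \<in> pts Y" "y1 \<in> \<Gamma>" "\<gamma> y1 = \<gamma> y + w" using exists_displaced[OF z w] .
  show ?thesis unfolding Ctilde_def
    by (intro CollectI conjI bexI[of _ y1]) (use pullback_near[OF y1 w] z1 tube_in y1 in auto)
qed

lemma simple_family_Nb:
  assumes z: "over_y z" and simple: "\<And>x. x \<in># z \<Longrightarrow> E x = 1" and w: "w \<in> Dom 1"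
  shows "simple_family z w \<in> Nb z"
proof -
  have xs: "\<forall>x\<in>#z. x \<in> F \<and> E x = 1" using simple over_y_F[OF z] by blast
  note fam = simple_family_centre[of z w, OF xs w]
  have idx1: "idx p = 1" if "p \<in> P" for p using P_covered[OF z that] simple by auto
  have "image_mset \<kappa> z = (\<Sum>p\<in>P. {#p#})"
    using z idx1 by (simp add: over_y_def pullback_y)
  then have "image_mset \<kappa> (simple_family z w) = (\<Sum>p\<in>P. image_mset (\<lambda>p. r p w) {#p#})"
    unfolding fam(3) by (simp only: image_mset_sum_family[OF finite_P])
  also have "\<dots> = (\<Sum>p\<in>P. image_mset (r p) (square_roots (idx p) w))"
    using idx1 by (intro sum.cong) (simp_all add: square_roots_def)
  finally have "image_mset \<kappa> (simple_family z w) = (\<Sum>p\<in>P. image_mset (r p) (square_roots (idx p) w))" .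
  then show ?thesis using in_CtI[OF z w] fam by (auto simp: Nb_def)
qed

lemma ramified_family_Nb:
  assumes z: "over_y z" "z = {#x1, x2#} + v" and \<kappa>: "\<kappa> x2 = \<kappa> x1" "E x1 = 2" and simple: "\<And>x. x \<in># v \<Longrightarrow> E x = 1"
    and b: "b \<in> Dom 2"
  shows "ramified_family x1 x2 v b \<in> Nb z"
proof -
  define w where "w = b\<^sup>2"
  have w: "w \<in> Dom 1" using Dom_square(1)[OF b] by (simp add: w_def)
  have b': "- b \<in> Dom 2" using Dom_square(2)[OF b] .
  have bb: "b \<in> ball 0 R" "- b \<in> ball 0 R" using Dom_ball b b' by blast+
  have x: "x1 \<in> F" "x2 \<in> F" "E x2 = 2" using over_y_F[OF z(1)] z(2) \<kappa> by auto
  have vF: "\<forall>x\<in>#v. x \<in> F \<and> E x = 1" using simple over_y_F[OF z(1)] z(2) by auto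
  note fam = simple_family_centre[of v w, OF vF w]
  define p where "p = \<kappa> x1"
  have p: "p \<in> P" "idx p = 2" using F_D(2)[OF x(1)] \<kappa> by (auto simp: p_def)
  have idx1: "idx p' = 1" if "p' \<in> P - {p}" for p'
    using idx_P[of p'] idx_P_unique[of p' p] p that by auto
  have "image_mset \<kappa> z = replicate_mset (idx p) p + (\<Sum>p'\<in>P - {p}. replicate_mset (idx p') p')"
    using z(1) by (simp add: over_y_def pullback_y sum.remove[OF finite_P p(1)])
  then have "{#p, p#} + image_mset \<kappa> v = {#p, p#} + (\<Sum>p'\<in>P - {p}. replicate_mset (idx p') p')"
    using z(2) \<kappa> p(2) by (simp add: p_def numeral_2_eq_2)
  then have "image_mset \<kappa> v = (\<Sum>p'\<in>P - {p}. {#p'#})" using idx1 by simp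
  then have "image_mset \<kappa> (simple_family v w) = (\<Sum>p'\<in>P - {p}. image_mset (\<lambda>p. r p w) {#p'#})"
    unfolding fam(3) by (simp only: image_mset_sum_family[OF finite_Diff[OF finite_P]])
  also have "\<dots> = (\<Sum>p'\<in>P - {p}. image_mset (r p') (square_roots (idx p') w))"
    using idx1 by (intro sum.cong) (simp_all add: square_roots_def)
  finally have v: "image_mset \<kappa> (simple_family v w) = (\<Sum>p'\<in>P - {p}. image_mset (r p') (square_roots (idx p') w))" .
  have "csqrt w = b \<or> csqrt w = - b" using power2_eq_iff[of "csqrt w" b] by (simp add: w_def)
  then have roots: "square_roots 2 w = {#b, - b#}" by (auto simp: square_roots_def)
  have "image_mset \<kappa> (ramified_family x1 x2 v b) = {#r p b, r p (- b)#} + image_mset \<kappa> (simple_family v w)"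
    using kappa_s[OF x(1) bb(1)] kappa_s[OF x(2) bb(2)] \<kappa> by (simp add: ramified_family_def w_def p_def)
  also have "\<dots> = (\<Sum>p\<in>P. image_mset (r p) (square_roots (idx p) w))"
    unfolding v sum.remove[OF finite_P p(1)] using p(2) roots by simp
  finally have \<kappa>Z: "image_mset \<kappa> (ramified_family x1 x2 v b) = (\<Sum>p\<in>P. image_mset (r p) (square_roots (idx p) w))" .
  have t: "set_mset (ramified_family x1 x2 v b) \<subseteq> tube"
    using fam(1) s_in_tube[OF x(1)] s_in_tube[OF x(2)] b b' \<kappa> by (simp add: ramified_family_def w_def x(3))
  have c: "image_mset centre (ramified_family x1 x2 v b) = z"
    using fam(2) centre_s[OF x(1)] centre_s[OF x(2)] b b' \<kappa> z(2) by (simp add: ramified_family_def w_def x(3))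
  show ?thesis using in_CtI[OF z(1) w t \<kappa>Z] t c by (simp add: Nb_def)
qed

end

section \<open>Local coordinates on the symmetric product\<close>

lemma topspace_sym_topology: "topspace (sym_topology M n) = {z. size z = n \<and> set_mset z \<subseteq> pts M}"
proof (intro equalityI subsetI)
  fix z assume "z \<in> topspace (sym_topology M n)"
  then obtain f where f: "f \<in> topspace (product_topology (\<lambda>_. stop M) {..<n})" "z = mset (map f [0..<n])"
    unfolding sym_topology_def topspace_quotient_topology by blast
  have "f i \<in> pts M" if "i < n" for i using f(1) that by (simp add: PiE_iff)
  then show "z \<in> {z. size z = n \<and> set_mset z \<subseteq> pts M}" using f(2) by auto
next
  fix z assume z: "z \<in> {z. size z = n \<and> set_mset z \<subseteq> pts M}"
  obtain xs where xs: "z = mset xs" by (metis ex_mset)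
  define f where "f = restrict ((!) xs) {..<n}"
  have "map f [0..<n] = xs" using z xs by (intro nth_equalityI) (auto simp: f_def)
  moreover have "f \<in> topspace (product_topology (\<lambda>_. stop M) {..<n})"
    using z xs by (auto simp: f_def subset_iff)
  ultimately show "z \<in> topspace (sym_topology M n)"
    unfolding sym_topology_def topspace_quotient_topology xs by (metis (mono_tags, lifting) imageI)
qed

text \<open>
  The preimage in the product is the union of boxes, one for each ordering of \<open>z0\<close>.
\<close>

lemma openin_sym_topology_rel_mset:
  assumes z0: "size z0 = n" and Q: "\<And>x. x \<in># z0 \<Longrightarrow> openin (stop M) (Q x)"
  shows "openin (sym_topology M n) {z. rel_mset (\<lambda>x q. q \<in> Q x) z0 z}"
proof -
  let ?prod = "product_topology (\<lambda>_::nat. stop M) {..<n}"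
  let ?q = "\<lambda>f. mset (map f [0..<n])"
  have len: "length xs = n" if "mset xs = z0" for xs using that z0 by auto
  have sub: "set qs \<subseteq> pts M" if "list_all2 (\<lambda>x q. q \<in> Q x) xs qs" "mset xs = z0" for xs qs
    using that Q openin_subset unfolding list_all2_conv_all_nth
    by (fastforce simp: set_conv_nth)
  have "{z. rel_mset (\<lambda>x q. q \<in> Q x) z0 z} \<subseteq> topspace (sym_topology M n)"
    unfolding topspace_sym_topology
  proof (intro subsetI, elim CollectE)
    fix z assume "rel_mset (\<lambda>x q. q \<in> Q x) z0 z"
    then obtain xs qs where *: "mset xs = z0" "mset qs = z" "list_all2 (\<lambda>x q. q \<in> Q x) xs qs"
      unfolding rel_mset_def by blast
    have "size z = n" using len[OF *(1)] list_all2_lengthD[OF *(3)] *(2) by auto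
    moreover have "set_mset z \<subseteq> pts M" using sub[OF *(3,1)] *(2) by auto
    ultimately show "z \<in> {z. size z = n \<and> set_mset z \<subseteq> pts M}" by simp
  qed
  then have 1: "{z. rel_mset (\<lambda>x q. q \<in> Q x) z0 z} \<subseteq> ?q ` topspace ?prod"
    by (simp add: sym_topology_def topspace_quotient_topology)
  have "{f \<in> topspace ?prod. ?q f \<in> {z. rel_mset (\<lambda>x q. q \<in> Q x) z0 z}} =
      (\<Union>xs\<in>{xs. mset xs = z0}. PiE {..<n} (\<lambda>i. Q (xs ! i)))" (is "?L = ?R")
  proof (intro equalityI subsetI)
    fix f assume f: "f \<in> ?L"
    then obtain xs qs where *: "mset xs = z0" "mset qs = ?q f" "list_all2 (\<lambda>x q. q \<in> Q x) xs qs"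
      by (auto simp: rel_mset_def)
    then obtain xs' where xs': "list_all2 (\<lambda>x q. q \<in> Q x) xs' (map f [0..<n])" "mset xs' = z0"
      using list_all2_reorder_left_invariance[OF list.rel_flip[THEN iffD2, OF *(3)], of "map f [0..<n]"]
      by (metis list.rel_flip)
    then have "f \<in> PiE {..<n} (\<lambda>i. Q (xs' ! i))"
      using f by (auto simp: list_all2_conv_all_nth PiE_iff)
    then show "f \<in> ?R" using xs' by blast
  next
    fix f assume "f \<in> ?R"
    then obtain xs where xs: "mset xs = z0" "f \<in> PiE {..<n} (\<lambda>i. Q (xs ! i))" by blast
    then have la: "list_all2 (\<lambda>x q. q \<in> Q x) xs (map f [0..<n])"
      using len[OF xs(1)] by (auto simp: list_all2_conv_all_nth PiE_iff)
    then have "f \<in> topspace ?prod" using sub[OF la xs(1)] xs(2) by (auto simp: PiE_iff)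
    then show "f \<in> ?L" using la xs(1) unfolding rel_mset_def by blast
  qed
  also have "openin ?prod \<dots>"
  proof (rule openin_Union, safe)
    fix xs assume xs: "z0 = mset xs"
    have "openin (stop M) (Q (xs ! i))" if "i < n" for i
      using Q[of "xs ! i"] that len[of xs] xs by simp
    then show "openin ?prod (PiE {..<n} (\<lambda>i. Q (xs ! i)))"
      by (simp add: openin_PiE_gen)
  qed
  finally show ?thesis using 1 by (simp add: sym_topology_def openin_quotient_topology)
qed

lemma continuous_map_into_sym_topology:
  assumes "length gs = n" "\<And>g. g \<in> set gs \<Longrightarrow> continuous_map A (stop M) g"
  shows "continuous_map A (sym_topology M n) (\<lambda>u. mset (map (\<lambda>g. g u) gs))"
proof -
  have "continuous_map A (product_topology (\<lambda>_. stop M) {..<n}) (\<lambda>u. restrict (\<lambda>i. (gs ! i) u) {..<n})"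
    using assms by (auto simp: continuous_map_componentwise)
  moreover have "continuous_map (product_topology (\<lambda>_. stop M) {..<n}) (sym_topology M n) (\<lambda>f. mset (map f [0..<n]))"
    unfolding sym_topology_def by (rule quotient_imp_continuous_map[OF quotient_map_quotient_topology])
  ultimately have "continuous_map A (sym_topology M n) ((\<lambda>f. mset (map f [0..<n])) \<circ> (\<lambda>u. restrict (\<lambda>i. (gs ! i) u) {..<n}))"
    by (rule continuous_map_compose)
  moreover have "(\<lambda>f. mset (map f [0..<n])) \<circ> (\<lambda>u. restrict (\<lambda>i. (gs ! i) u) {..<n}) = (\<lambda>u. mset (map (\<lambda>g. g u) gs))"
  proof
    fix u
    have "map (restrict (\<lambda>i. (gs ! i) u) {..<n}) [0..<n] = map (\<lambda>g. g u) gs"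
      using assms(1) by (intro nth_equalityI) auto
    then show "((\<lambda>f. mset (map f [0..<n])) \<circ> (\<lambda>u. restrict (\<lambda>i. (gs ! i) u) {..<n})) u = mset (map (\<lambda>g. g u) gs)"
      by (simp only: o_def)
  qed
  ultimately show ?thesis by simp
qed

text \<open>
  Symmetric coordinates are coefficients of a product of linear factors, so holomorphy is tested on all
  coefficients.
\<close>

definition holomorphic_coeffs :: "complex set \<Rightarrow> (complex \<Rightarrow> complex poly) \<Rightarrow> bool" where
  "holomorphic_coeffs S f \<longleftrightarrow> (\<forall>i. (\<lambda>u. coeff (f u) i) holomorphic_on S)"

lemma holomorphic_coeffs_mult:
  "holomorphic_coeffs S f \<Longrightarrow> holomorphic_coeffs S g \<Longrightarrow> holomorphic_coeffs S (\<lambda>u. f u * g u)"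
  unfolding holomorphic_coeffs_def coeff_mult by (intro allI holomorphic_intros) auto

lemma holomorphic_coeffs_linear:
  "g holomorphic_on S \<Longrightarrow> holomorphic_coeffs S (\<lambda>u. [:- g u, 1:])"
  unfolding holomorphic_coeffs_def
proof
  fix i assume "g holomorphic_on S"
  then show "(\<lambda>u. coeff [:- g u, 1:] i) holomorphic_on S"
    by (cases i) (auto simp: coeff_pCons intro!: holomorphic_intros)
qed

lemma holomorphic_coeffs_prod_mset:
  "(\<And>x. x \<in># z \<Longrightarrow> holomorphic_coeffs S (f x)) \<Longrightarrow> holomorphic_coeffs S (\<lambda>u. \<Prod>x\<in>#z. f x u)"
proof (induction z)
  case empty
  then show ?case by (auto simp: holomorphic_coeffs_def)
next
  case (add x z)
  then show ?case using holomorphic_coeffs_mult by simp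
qed

lemma sym_coordinate_add_mset: "sym_coordinate \<phi> (add_mset q z) = [:- \<phi> q, 1:] * sym_coordinate \<phi> z"
  by (simp add: sym_coordinate_def)

lemma degree_sym_coordinate: "degree (sym_coordinate \<phi> z) = size z" "lead_coeff (sym_coordinate \<phi> z) = 1"
proof (induction z)
  case empty
  { case 1 show ?case by (simp add: sym_coordinate_def) }
  { case 2 show ?case by (simp add: sym_coordinate_def) }
next
  case (add q z)
  have nz: "sym_coordinate \<phi> z \<noteq> 0" using add.IH(2) by auto
  { case 1 show ?case unfolding sym_coordinate_add_mset using nz add.IH(1) by (subst degree_mult_eq) auto }
  { case 2 show ?case unfolding sym_coordinate_add_mset lead_coeff_mult using add.IH(2) by simp }
qed

lemma poly_sym_coordinate: "poly (sym_coordinate \<phi> z) v = (\<Prod>q\<in>#z. v - \<phi> q)"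
  by (induction z) (simp_all add: sym_coordinate_def algebra_simps)

lemma poly_eq_sum_coeff:
  fixes p :: "'a::comm_semiring_1 poly"
  assumes "degree p \<le> N" shows "poly p v = (\<Sum>i\<le>N. coeff p i * v ^ i)"
proof -
  have eq: "(\<Sum>i\<le>N. coeff p i * v ^ i) = (\<Sum>i\<le>degree p. coeff p i * v ^ i)"
    using assms by (intro sum.mono_neutral_right) (auto simp: coeff_eq_0)
  show ?thesis by (rule trans[OF poly_altdef eq[symmetric]])
qed

text \<open>
  If all coefficients were stationary at \<open>u0\<close>, then so would be the value of the polynomial at the fixed
  point \<open>g u0\<close>. But this value is \<open>g u0 - g u\<close> times a factor that does not vanish at \<open>u0\<close>.
\<close>

lemma coefficient_moves_with_simple_root:
  assumes S: "open S" "u0 \<in> S" and g: "g holomorphic_on S" "deriv g u0 \<noteq> 0"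
    and h: "holomorphic_coeffs S h" and simple: "poly (h u0) (g u0) \<noteq> 0"
    and deg: "\<And>u. u \<in> S \<Longrightarrow> degree (h u) < n"
    and monic: "\<And>u. u \<in> S \<Longrightarrow> degree ([:- g u, 1:] * h u) = n \<and> lead_coeff ([:- g u, 1:] * h u) = 1"
  shows "\<exists>i<n. deriv (\<lambda>u. coeff ([:- g u, 1:] * h u) i) u0 \<noteq> 0"
proof (rule ccontr)
  assume "\<not> ?thesis"
  then have zero: "\<And>i. i < n \<Longrightarrow> deriv (\<lambda>u. coeff ([:- g u, 1:] * h u) i) u0 = 0" by blast
  define v where "v = g u0"
  define c where "c i u = coeff ([:- g u, 1:] * h u) i" for i u
  have hc: "holomorphic_coeffs S (\<lambda>u. [:- g u, 1:] * h u)"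
    by (intro holomorphic_coeffs_mult holomorphic_coeffs_linear g h)
  have c: "(c i has_field_derivative 0) (at u0)" if "i \<le> n" for i
  proof (cases "i = n")
    case True
    show ?thesis
    proof (rule has_field_derivative_transform_within_open[OF DERIV_const S])
      show "1 = c i u" if "u \<in> S" for u using monic[OF that] True unfolding c_def by metis
    qed
  next
    case False
    have "c i holomorphic_on S" using hc unfolding holomorphic_coeffs_def c_def by blast
    then have "(c i has_field_derivative deriv (c i) u0) (at u0)" using S holomorphic_derivI by blast
    then show ?thesis using zero[of i] False that by (simp add: c_def[abs_def])
  qed
  define H where "H u = (\<Sum>i\<le>n. c i u * v ^ i)" for u
  have "(H has_field_derivative (\<Sum>i\<le>n. 0 * v ^ i)) (at u0)"
    unfolding H_def by (intro DERIV_sum DERIV_cmult_right c) auto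
  then have H0: "deriv H u0 = 0" by (simp add: DERIV_imp_deriv)
  have holh: "(\<lambda>u. poly (h u) v) holomorphic_on S"
  proof (rule holomorphic_transform)
    show "(\<lambda>u. \<Sum>i\<le>n. coeff (h u) i * v ^ i) holomorphic_on S"
      using h unfolding holomorphic_coeffs_def by (intro holomorphic_intros) auto
    show "(\<Sum>i\<le>n. coeff (h u) i * v ^ i) = poly (h u) v" if "u \<in> S" for u
      by (rule poly_eq_sum_coeff[symmetric]) (use deg[OF that] in simp)
  qed
  have "(g has_field_derivative deriv g u0) (at u0)" using g S holomorphic_derivI by blast
  moreover have "((\<lambda>u. poly (h u) v) has_field_derivative deriv (\<lambda>u. poly (h u) v) u0) (at u0)"
    using holh S holomorphic_derivI by blast
  ultimately have "((\<lambda>u. (v - g u) * poly (h u) v) has_field_derivative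
      ((0 - deriv g u0) * poly (h u0) v + deriv (\<lambda>u. poly (h u) v) u0 * (v - g u0))) (at u0)"
    by (intro DERIV_mult DERIV_diff DERIV_const)
  then have "(H has_field_derivative (- deriv g u0 * poly (h u0) v)) (at u0)"
  proof (rule has_field_derivative_transform_within_open[OF _ S, THEN DERIV_cong])
    show "(v - g u) * poly (h u) v = H u" if "u \<in> S" for u
    proof -
      have "H u = poly ([:- g u, 1:] * h u) v"
        unfolding H_def c_def using monic[OF that] by (intro poly_eq_sum_coeff[symmetric]) simp
      then show ?thesis by (simp add: algebra_simps)
    qed
  qed (simp add: v_def)
  then have "deriv H u0 = - deriv g u0 * poly (h u0) v" by (rule DERIV_imp_deriv)
  then show False using H0 g simple by (simp add: v_def)
qed

context fibre_discs
begin

abbreviation "CT \<equiv> Ctilde_topology T X Y \<kappa> \<rho> n"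

lemma finite_F: "finite F"
proof -
  have "F \<subseteq> (\<Union>p\<in>P. fibre T \<kappa> p)" using kappa_in by (auto simp: fibre_def)
  then show ?thesis using finite_P kappa.finite_fibre P_D by (meson finite_UN_I finite_subset)
qed

lemma open_s_image: "x \<in> F \<Longrightarrow> open W \<Longrightarrow> W \<subseteq> Dom (E x) \<Longrightarrow> openin (stop T) (s x ` W)"
  using s_disc[of x] Dom_F unfolding embedded_disc_def by (meson subset_iff)

lemma open_disc: "x \<in> F \<Longrightarrow> openin (stop T) (disc x)"
  unfolding disc_def by (rule open_s_image[OF _ open_Dom]) auto

lemma open_tube: "openin (stop T) tube"
  unfolding tube_def using open_disc by blast

lemma disc_D: "x \<in> F \<Longrightarrow> q \<in> disc x \<Longrightarrow> q \<in> tube \<and> centre q = x"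
  using s_in_tube centre_s by (auto simp: disc_def)

lemma rel_mset_iff_centre:
  assumes "set_mset z \<subseteq> F" "\<And>x. x \<in> F \<Longrightarrow> Q x \<subseteq> disc x"
  shows "rel_mset (\<lambda>x q. q \<in> Q x) z z1 \<longleftrightarrow> (\<forall>q\<in>#z1. q \<in> Q (centre q)) \<and> image_mset centre z1 = z"
proof
  assume "rel_mset (\<lambda>x q. q \<in> Q x) z z1"
  then obtain xs qs where *: "mset xs = z" "mset qs = z1" "list_all2 (\<lambda>x q. q \<in> Q x) xs qs"
    by (auto simp: rel_mset_def)
  have nth: "xs ! i = centre (qs ! i) \<and> qs ! i \<in> Q (xs ! i)" if "i < length xs" for i
  proof -
    have "xs ! i \<in> set_mset z" using *(1) nth_mem[OF that] by (metis set_mset_mset)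
    then have "xs ! i \<in> F" using assms(1) by (rule subsetD[rotated])
    moreover have Qi: "qs ! i \<in> Q (xs ! i)" using *(3) that by (simp add: list_all2_conv_all_nth)
    ultimately have "qs ! i \<in> disc (xs ! i)" using assms(2) by (meson subsetD)
    then have "centre (qs ! i) = xs ! i" using disc_D[OF \<open>xs ! i \<in> F\<close>] by (meson conjunct2)
    then show ?thesis using Qi by (intro conjI) (rule sym)
  qed
  have "length qs = length xs" using *(3) by (simp add: list_all2_lengthD)
  note len = this
  have "map centre qs = xs"
  proof (rule nth_equalityI)
    fix i assume "i < length (map centre qs)"
    then have i: "i < length qs" "i < length xs" using len by simp_all
    show "map centre qs ! i = xs ! i" using nth[OF i(2)] unfolding nth_map[OF i(1)] by (elim conjE) (rule sym)
  qed (use len in simp)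
  moreover have "\<forall>q\<in>set qs. q \<in> Q (centre q)"
  proof
    fix q assume "q \<in> set qs"
    then obtain i where i: "i < length xs" "q = qs ! i" by (metis in_set_conv_nth len)
    then show "q \<in> Q (centre q)" using nth[OF i(1)] by metis
  qed
  ultimately show "(\<forall>q\<in>#z1. q \<in> Q (centre q)) \<and> image_mset centre z1 = z"
    using * by (metis mset_map set_mset_mset)
next
  assume a: "(\<forall>q\<in>#z1. q \<in> Q (centre q)) \<and> image_mset centre z1 = z"
  obtain qs where qs: "z1 = mset qs" by (metis ex_mset)
  then have "list_all2 (\<lambda>x q. q \<in> Q x) (map centre qs) qs" using a by (auto simp: list_all2_conv_all_nth)
  then show "rel_mset (\<lambda>x q. q \<in> Q x) z z1" unfolding rel_mset_def using a qs by (metis mset_map)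
qed

lemma over_y_subset: "over_y z \<Longrightarrow> set_mset z \<subseteq> F"
  using over_y_F by blast

text \<open>
  Taking whole discs for \<open>Q\<close> shows that \<open>Nb z\<close> is open; restricting the parameter in one disc shows
  that this parameter is a continuous function of the divisor.
\<close>

lemma openin_near:
  assumes z: "over_y z" and Q: "\<And>x. x \<in> F \<Longrightarrow> Q x \<subseteq> disc x" "\<And>x. x \<in> F \<Longrightarrow> openin (stop T) (Q x)"
  shows "openin CT {z1 \<in> Ct. (\<forall>q\<in>#z1. q \<in> Q (centre q)) \<and> image_mset centre z1 = z}"
proof -
  have "openin (sym_topology T n) {z1. rel_mset (\<lambda>x q. q \<in> Q x) z z1}"
    using CtD(2)[OF over_y_Ct[OF z]] Q(2) over_y_F[OF z] by (intro openin_sym_topology_rel_mset) auto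
  then have "openin CT ({z1. rel_mset (\<lambda>x q. q \<in> Q x) z z1} \<inter> Ct)"
    unfolding Ctilde_topology_def by (auto simp: openin_subtopology)
  moreover have "{z1. rel_mset (\<lambda>x q. q \<in> Q x) z z1} \<inter> Ct =
      {z1 \<in> Ct. (\<forall>q\<in>#z1. q \<in> Q (centre q)) \<and> image_mset centre z1 = z}"
    using rel_mset_iff_centre[OF over_y_subset[OF z] Q(1)] by auto
  ultimately show ?thesis by simp
qed

lemma Nb_alt: "over_y z \<Longrightarrow> Nb z = {z1 \<in> Ct. (\<forall>q\<in>#z1. q \<in> disc (centre q)) \<and> image_mset centre z1 = z}"
proof -
  assume z: "over_y z"
  have "set_mset z1 \<subseteq> tube \<longleftrightarrow> (\<forall>q\<in>#z1. q \<in> disc (centre q))" if c: "image_mset centre z1 = z" for z1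
  proof
    assume "set_mset z1 \<subseteq> tube"
    then show "\<forall>q\<in>#z1. q \<in> disc (centre q)" using tube_D(4) by blast
  next
    assume disc: "\<forall>q\<in>#z1. q \<in> disc (centre q)"
    show "set_mset z1 \<subseteq> tube"
    proof
      fix q assume q: "q \<in># z1"
      then have "centre q \<in># z" using c by (metis image_eqI set_image_mset)
      then have "centre q \<in> F" by (rule over_y_F[OF z])
      then show "q \<in> tube" using disc_D disc q by blast
    qed
  qed
  then show ?thesis unfolding Nb_def by blast
qed

lemma openin_Nb: "over_y z \<Longrightarrow> openin CT (Nb z)"
  using openin_near[of z disc] open_disc by (simp add: Nb_alt)

text \<open>
  The charts of the fibre product require one injective coordinate near all members of a divisor. The
  parameters of the discs have absolute value less than 1; shifting them by distinct multiples
  of 3 makes them disjoint.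
\<close>

lemma big_coordinate:
  obtains \<phi> c where "local_coordinate T tube \<phi>" "\<And>q. q \<in> tube \<Longrightarrow> \<phi> q = c (centre q) + coord q"
proof -
  obtain m :: "'t \<Rightarrow> nat" where m: "inj_on m F" using finite_F finite_imp_inj_to_nat_seg by metis
  define c where "c x = (of_nat (3 * m x) :: complex)" for x
  define \<phi> where "\<phi> q = c (centre q) + coord q" for q
  have "local_coordinate T tube \<phi>"
    unfolding local_coordinate_def
  proof (intro conjI ballI, goal_cases)
    case 1
    show ?case by (rule open_tube)
  next
    case 2
    show ?case
    proof (rule inj_onI)
      fix q q' assume q: "q \<in> tube" "q' \<in> tube" "\<phi> q = \<phi> q'"
      have "norm (coord q) < 1" "norm (coord q') < 1"
        using Dom_F[OF tube_D(1,2)[OF q(1)]] Dom_F[OF tube_D(1,2)[OF q(2)]] R by simp_all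
      moreover have "c (centre q) - c (centre q') = coord q' - coord q"
        using q(3) by (simp add: \<phi>_def algebra_simps)
      ultimately have "norm (c (centre q) - c (centre q')) < 2"
        using norm_triangle_ineq4[of "coord q'" "coord q"] by simp
      also have "c (centre q) - c (centre q') = of_int (3 * (int (m (centre q)) - int (m (centre q'))))"
        by (simp add: c_def)
      finally have "real_of_int \<bar>3 * (int (m (centre q)) - int (m (centre q')))\<bar> < 2"
        by (simp only: norm_of_int of_int_abs)
      then have "\<bar>3 * (int (m (centre q)) - int (m (centre q')))\<bar> < 2"
        by (simp only: of_int_less_numeral_iff)
      then have "m (centre q) = m (centre q')" by presburger
      then have "centre q = centre q'" using m tube_D(1) q by (auto dest: inj_onD)
      moreover then have "coord q = coord q'" using q(3) by (simp add: \<phi>_def)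
      ultimately show "q = q'" using tube_D(3) q by metis
    qed
  next
    case (3 a)
    obtain A \<alpha> where a: "a = (A, \<alpha>)" by force
    have A: "(A, \<alpha>) \<in> charts T" using 3 a by simp
    have "(\<lambda>u. \<phi> (inv_into A \<alpha> u)) holomorphic_on \<alpha> ` (tube \<inter> A)"
    proof (rule holomorphic_on_if_locally)
      fix u assume "u \<in> \<alpha> ` (tube \<inter> A)"
      then obtain q where q: "q \<in> tube" "q \<in> A" "u = \<alpha> q" by auto
      define x where "x = centre q"
      have x: "x \<in> F" "q \<in> disc x" using tube_D q by (auto simp: x_def)
      define N where "N = \<alpha> ` (disc x \<inter> A)"
      have inv: "inv_into A \<alpha> (\<alpha> b) = b" if "b \<in> A" for b using chartD(3)[OF surfaces(1) A] that by simp
      have sub: "disc x \<subseteq> s x ` ball 0 R" using Dom_F[OF x(1)] by (auto simp: disc_def)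
      have N: "open N" "u \<in> N" "N \<subseteq> \<alpha> ` (tube \<inter> A)"
        using open_chart_image[OF surfaces(1) A open_disc[OF x(1)]] q x disc_D by (auto simp: N_def)
      have "(\<lambda>u. inv_into (ball 0 R) (s x) (inv_into A \<alpha> u)) holomorphic_on \<alpha> ` (s x ` ball 0 R \<inter> A)"
        using s_disc[OF x(1)] A by (auto simp: embedded_disc_def local_coordinate_def)
      then have "(\<lambda>u. inv_into (ball 0 R) (s x) (inv_into A \<alpha> u)) holomorphic_on N"
        by (rule holomorphic_on_subset) (use sub in \<open>auto simp: N_def\<close>)
      then have "(\<lambda>u. c x + inv_into (ball 0 R) (s x) (inv_into A \<alpha> u)) holomorphic_on N"
        by (intro holomorphic_intros)
      then have "(\<lambda>u. \<phi> (inv_into A \<alpha> u)) holomorphic_on N"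
      proof (rule holomorphic_transform)
        fix v assume "v \<in> N"
        then obtain b where b: "b \<in> disc x" "b \<in> A" "v = \<alpha> b" by (auto simp: N_def)
        then obtain t where t: "t \<in> Dom (E x)" "b = s x t" by (auto simp: disc_def)
        have "inj_on (s x) (ball 0 R)" using s_disc[OF x(1)] by (simp add: embedded_disc_def)
        then have "inv_into (ball 0 R) (s x) b = t" using Dom_F[OF x(1) t(1)] t(2) by simp
        then show "c x + inv_into (ball 0 R) (s x) (inv_into A \<alpha> v) = \<phi> (inv_into A \<alpha> v)"
          using inv[OF b(2)] b t centre_s[OF x(1) t(1)] coord_s[OF x(1) t(1)] by (simp add: \<phi>_def)
      qed
      then show "\<exists>N. open N \<and> u \<in> N \<and> N \<subseteq> \<alpha> ` (tube \<inter> A) \<and> (\<lambda>u. \<phi> (inv_into A \<alpha> u)) holomorphic_on N"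
        using N by blast
    qed
    then show ?case by (simp add: a)
  qed
  then show thesis using that[of \<phi> c] \<phi>_def by blast
qed

end

section \<open>Charts of the fibre product\<close>

lemma holomorphic_coeffs_cong:
  assumes "holomorphic_coeffs S f" "\<And>u. u \<in> S \<Longrightarrow> f u = g u"
  shows "holomorphic_coeffs S g"
  unfolding holomorphic_coeffs_def
proof
  fix i
  have "(\<lambda>u. coeff (f u) i) holomorphic_on S" using assms(1) by (simp add: holomorphic_coeffs_def)
  then show "(\<lambda>u. coeff (g u) i) holomorphic_on S"
    by (rule holomorphic_transform) (simp add: assms(2))
qed

lemma mult_conjugate_linear_factors:
  "[:- (a + b), 1:] * [:- (a - b), 1:] = [:a\<^sup>2 - b\<^sup>2, - 2 * a, 1 :: 'a :: comm_ring_1:]"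
  by (simp add: power2_eq_square algebra_simps)

context fibre_discs
begin

text \<open>
  The coordinate on a neighbourhood of \<open>z\<close>: the parameter of the only member near \<open>x\<close>, for \<open>x\<close> a simple
  member of \<open>z\<close>.
\<close>

definition read :: "'t \<Rightarrow> 't multiset \<Rightarrow> complex" where
  "read x z1 = coord (THE q. q \<in># z1 \<and> centre q = x)"

lemma read_eq:
  assumes "q \<in># z1" "centre q = x" "count (image_mset centre z1) x = 1"
  shows "read x z1 = coord q"
proof -
  have "(THE q. q \<in># z1 \<and> centre q = x) = q"
  proof (rule the_equality)
    show "q \<in># z1 \<and> centre q = x" using assms by simp
    fix q' assume q': "q' \<in># z1 \<and> centre q' = x"
    show "q' = q"
    proof (rule ccontr)
      assume ne: "q' \<noteq> q"
      obtain w where w: "z1 = add_mset q w" using assms(1) by (metis multi_member_split)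
      then have "q' \<in># w" using q' ne by simp
      then obtain v where "w = add_mset q' v" by (metis multi_member_split)
      then have "count (image_mset centre z1) x \<ge> 2" using w q' assms(2) by simp
      then show False using assms(3) by simp
    qed
  qed
  then show ?thesis by (simp add: read_def)
qed

text \<open>
  Every family parametrising \<open>Nb z\<close> by the position of one simple member \<open>x\<close> gives a chart. Regularity
  holds because that member is a simple root of the polynomial of symmetric coordinates
  and moves with nonzero speed.
\<close>

lemma chart_from_family:
  assumes z: "over_y z" and x: "x \<in># z" "count z x = 1"
    and Z_image: "Z ` Dom (E x) = Nb z"
    and Zx: "\<And>u. u \<in> Dom (E x) \<Longrightarrow> Z u = add_mset (s x u) (Z' u)"
    and cont: "continuous_map (top_of_set (Dom (E x))) (sym_topology T n) Z"
    and \<phi>: "local_coordinate T tube \<phi>" "\<And>q. q \<in> tube \<Longrightarrow> \<phi> q = c (centre q) + coord q"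
    and coeffs: "holomorphic_coeffs (Dom (E x)) (\<lambda>u. sym_coordinate \<phi> (Z' u))"
  shows "(Nb z, read x) \<in> charts (Ctilde_surface T X Y \<kappa> \<rho> n)"
proof -
  define S where "S = Dom (E x)"
  have oS: "open S" by (simp add: S_def open_Dom)
  have xF: "x \<in> F" using over_y_F[OF z x(1)] .
  have Nb: "z1 \<in> Ct" "set_mset z1 \<subseteq> tube" "image_mset centre z1 = z" if "z1 \<in> Nb z" for z1
    using that by (auto simp: Nb_def)
  have ZNb: "Z u \<in> Nb z" if "u \<in> S" for u using Z_image that by (auto simp: S_def)
  have cs: "centre (s x u) = x" "coord (s x u) = u" if "u \<in> S" for u
    using centre_s[OF xF] coord_s[OF xF] that by (auto simp: S_def)
  have readZ: "read x (Z u) = u" if u: "u \<in> S" for u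
  proof -
    have "s x u \<in># Z u" using Zx u by (simp add: S_def)
    then have "read x (Z u) = coord (s x u)"
      using cs[OF u] Nb(3)[OF ZNb[OF u]] x(2) by (intro read_eq) auto
    then show ?thesis using cs[OF u] by simp
  qed
  have Z_read: "read x z1 \<in> S \<and> Z (read x z1) = z1" if "z1 \<in> Nb z" for z1
  proof -
    have "z1 \<in> Z ` S" using that unfolding S_def Z_image .
    then obtain u where "u \<in> S" "z1 = Z u" by blast
    then show ?thesis by (simp only: readZ)
  qed
  have image: "read x ` Nb z = S"
  proof
    show "read x ` Nb z \<subseteq> S" using Z_read by blast
    show "S \<subseteq> read x ` Nb z"
    proof
      fix u assume "u \<in> S"
      then show "u \<in> read x ` Nb z" using readZ ZNb by (intro image_eqI[of _ _ "Z u"]) simp_all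
    qed
  qed
  have inj: "inj_on (read x) (Nb z)" using Z_read by (intro inj_onI) metis
  have inv: "inv_into (Nb z) (read x) u = Z u" if "u \<in> S" for u
    using inv_into_f_f[OF inj ZNb[OF that]] readZ[OF that] by simp
  have oNb: "openin CT (Nb z)" by (rule openin_Nb[OF z])
  have Nb_sub: "Nb z \<subseteq> Ct" using Nb(1) by blast
  have top_CT: "topspace CT = Ct"
    using CtD unfolding Ctilde_topology_def by (auto simp: topspace_sym_topology)
  have top_sub: "topspace (subtopology CT (Nb z)) = Nb z" using Nb_sub top_CT by auto
  have "continuous_map (top_of_set S) (subtopology CT (Nb z)) Z"
    unfolding Ctilde_topology_def subtopology_subtopology
    using cont ZNb Nb_sub by (auto simp: continuous_map_in_subtopology S_def)
  moreover have "continuous_map (subtopology CT (Nb z)) (top_of_set S) (read x)"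
    unfolding continuous_map_def top_sub
  proof (intro conjI allI impI)
    show "read x \<in> Nb z \<rightarrow> topspace (top_of_set S)" using image by auto
    fix W assume "openin (top_of_set S) W"
    then have W: "open W" "W \<subseteq> S" using oS by (auto simp: openin_open_eq)
    (* The preimage of W consists of the divisors whose member near x lies in s x ` W. *)
    define Q where "Q x' = (if x' = x then s x ` W else disc x')" for x'
    have "openin CT {z1 \<in> Ct. (\<forall>q\<in>#z1. q \<in> Q (centre q)) \<and> image_mset centre z1 = z}"
    proof (rule openin_near[OF z])
      show "Q x' \<subseteq> disc x'" if "x' \<in> F" for x' using W by (auto simp: Q_def disc_def S_def)
      show "openin (stop T) (Q x')" if "x' \<in> F" for x'
        using open_s_image[OF xF W(1)] W(2) open_disc[OF that] by (simp add: Q_def S_def)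
    qed
    also have "{z1 \<in> Ct. (\<forall>q\<in>#z1. q \<in> Q (centre q)) \<and> image_mset centre z1 = z} = {z1 \<in> Nb z. read x z1 \<in> W}"
    proof (intro equalityI subsetI)
      fix z1 assume "z1 \<in> {z1 \<in> Ct. (\<forall>q\<in>#z1. q \<in> Q (centre q)) \<and> image_mset centre z1 = z}"
      then have z1: "z1 \<in> Ct" "\<forall>q\<in>#z1. q \<in> Q (centre q)" "image_mset centre z1 = z" by auto
      have Qd: "Q x' \<subseteq> disc x'" for x' using W by (auto simp: Q_def disc_def S_def)
      then have mem: "z1 \<in> Nb z" unfolding Nb_alt[OF z] using z1 by blast
      define u where "u = read x z1"
      have u: "u \<in> S" "Z u = z1" using Z_read[OF mem] by (auto simp: u_def)
      then have "s x u \<in># z1" using Zx by (auto simp: S_def)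
      then have "s x u \<in> Q x" using z1(2) cs[OF u(1)] by metis
      then obtain u' where "u' \<in> W" "s x u = s x u'" by (auto simp: Q_def)
      then have "u' = u" using cs(2)[OF u(1)] cs(2)[of u'] W(2) by (metis subsetD)
      then have "u \<in> W" using \<open>u' \<in> W\<close> by simp
      then show "z1 \<in> {z1 \<in> Nb z. read x z1 \<in> W}" using mem by (simp add: u_def)
    next
      fix z1 assume "z1 \<in> {z1 \<in> Nb z. read x z1 \<in> W}"
      then have mem: "z1 \<in> Nb z" and W1: "read x z1 \<in> W" by auto
      have cnt: "count (image_mset centre z1) x = 1" using Nb(3)[OF mem] x(2) by simp
      have "q \<in> Q (centre q)" if q: "q \<in># z1" for q
      proof (cases "centre q = x")
        case True
        have "q \<in> tube" using Nb(2)[OF mem] q by blast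
        then have "q = s x (coord q)" using tube_D(3) True by metis
        moreover have "coord q = read x z1" using read_eq[OF q True cnt] by simp
        ultimately show ?thesis using W1 True by (metis Q_def imageI)
      next
        case False
        have "q \<in> tube" using Nb(2)[OF mem] q by blast
        then show ?thesis using tube_D(4) False by (simp add: Q_def)
      qed
      then show "z1 \<in> {z1 \<in> Ct. (\<forall>q\<in>#z1. q \<in> Q (centre q)) \<and> image_mset centre z1 = z}"
        using Nb[OF mem] by simp
    qed
    finally show "openin (subtopology CT (Nb z)) {z1 \<in> Nb z. read x z1 \<in> W}"
      by (auto simp: openin_open_subtopology[OF oNb])
  qed
  ultimately have "homeomorphic_maps (subtopology CT (Nb z)) (top_of_set S) (read x) Z"
    unfolding homeomorphic_maps_def top_sub using Z_read readZ by auto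
  then have homeo: "homeomorphic_map (subtopology CT (Nb z)) (top_of_set S) (read x)"
    unfolding homeomorphic_map_maps by blast
  define f where "f u = [:- (c x + u), 1:] * sym_coordinate \<phi> (Z' u)" for u
  have symZ: "sym_coordinate \<phi> (Z u) = f u" if u: "u \<in> S" for u
  proof -
    have "s x u \<in> tube" using s_in_tube xF u by (simp add: S_def)
    then have "\<phi> (s x u) = c x + u" using \<phi>(2) cs[OF u] by simp
    then show ?thesis using Zx u by (simp add: sym_coordinate_add_mset f_def S_def del: mult_pCons_left)
  qed
  have lin: "(\<lambda>u. c x + u) holomorphic_on S" by (intro holomorphic_intros)
  have f: "holomorphic_coeffs S f"
    unfolding f_def using coeffs by (intro holomorphic_coeffs_mult holomorphic_coeffs_linear lin) (simp add: S_def)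
  have analytic: "(\<lambda>u. coeff (sym_coordinate \<phi> (inv_into (Nb z) (read x) u)) i) analytic_on {u0}" if "u0 \<in> S" for u0 i
  proof -
    have "(\<lambda>u. coeff (f u) i) holomorphic_on S" using f by (simp add: holomorphic_coeffs_def)
    then have "(\<lambda>u. coeff (sym_coordinate \<phi> (inv_into (Nb z) (read x) u)) i) holomorphic_on S"
      by (rule holomorphic_transform) (simp add: inv symZ)
    then show ?thesis using oS that analytic_at by blast
  qed
  have moves: "\<exists>i<n. deriv (\<lambda>u. coeff (sym_coordinate \<phi> (inv_into (Nb z) (read x) u)) i) u0 \<noteq> 0" if u0: "u0 \<in> S" for u0
  proof -
    have size: "size (Z u) = n" if "u \<in> S" for u using CtD(2)[OF Nb(1)[OF ZNb[OF that]]] .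
    have "\<exists>i<n. deriv (\<lambda>u. coeff ([:- (c x + u), 1:] * sym_coordinate \<phi> (Z' u)) i) u0 \<noteq> 0"
    proof (rule coefficient_moves_with_simple_root[OF oS u0 lin])
      show "deriv (\<lambda>u. c x + u) u0 \<noteq> 0" by simp
      show "holomorphic_coeffs S (\<lambda>u. sym_coordinate \<phi> (Z' u))" using coeffs by (simp add: S_def)
      show "degree (sym_coordinate \<phi> (Z' u)) < n" if "u \<in> S" for u
        using size[OF that] Zx that by (simp add: degree_sym_coordinate S_def)
      show "degree ([:- (c x + u), 1:] * sym_coordinate \<phi> (Z' u)) = n \<and>
          lead_coeff ([:- (c x + u), 1:] * sym_coordinate \<phi> (Z' u)) = 1" if "u \<in> S" for u
        using symZ[OF that] degree_sym_coordinate[of \<phi> "Z u"] size[OF that] unfolding f_def by metis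
      have "c x + u0 - \<phi> q \<noteq> 0" if q: "q \<in># Z' u0" for q
      proof -
        have Z0: "Z u0 = add_mset (s x u0) (Z' u0)" using Zx u0 by (simp add: S_def)
        have t: "q \<in> tube" "s x u0 \<in> tube" using Nb(2)[OF ZNb[OF u0]] q Z0 by auto
        have "count (image_mset centre (Z u0)) x = 1" using Nb(3)[OF ZNb[OF u0]] x(2) by simp
        then have "count (image_mset centre (Z' u0)) x = 0" using Z0 cs[OF u0] by simp
        then have "x \<notin># image_mset centre (Z' u0)" by (rule iffD2[OF not_in_iff])
        then have "centre q \<noteq> x" using q by (metis image_eqI set_image_mset)
        then have "q \<noteq> s x u0" using cs[OF u0] by metis
        then have "\<phi> q \<noteq> \<phi> (s x u0)" using \<phi>(1) t by (auto simp: local_coordinate_def dest: inj_onD)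
        then show ?thesis using \<phi>(2)[OF t(2)] cs[OF u0] by simp
      qed
      then show "poly (sym_coordinate \<phi> (Z' u0)) (c x + u0) \<noteq> 0"
        by (auto simp: poly_sym_coordinate prod_mset_zero_iff)
    qed
    then obtain i where i: "i < n" "deriv (\<lambda>u. coeff (f u) i) u0 \<noteq> 0" unfolding f_def by blast
    have "\<forall>\<^sub>F u in nhds u0. u \<in> S" using oS u0 by (rule eventually_nhds_in_open)
    then have "\<forall>\<^sub>F u in nhds u0. coeff (sym_coordinate \<phi> (inv_into (Nb z) (read x) u)) i = coeff (f u) i"
      by eventually_elim (simp add: inv symZ)
    then have "deriv (\<lambda>u. coeff (sym_coordinate \<phi> (inv_into (Nb z) (read x) u)) i) u0 = deriv (\<lambda>u. coeff (f u) i) u0"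
      by (intro deriv_cong_ev) auto
    then show ?thesis using i by auto
  qed
  have "\<exists>V \<phi>. local_coordinate T V \<phi> \<and> set_mset z1 \<subseteq> V \<and>
      (\<forall>i<n. (\<lambda>u. coeff (sym_coordinate \<phi> (inv_into (Nb z) (read x) u)) i) analytic_on {read x z1}) \<and>
      (\<exists>i<n. deriv (\<lambda>u. coeff (sym_coordinate \<phi> (inv_into (Nb z) (read x) u)) i) (read x z1) \<noteq> 0)"
    if z1: "z1 \<in> Nb z" for z1
  proof -
    have S: "read x z1 \<in> S" using Z_read[OF z1] by blast
    show ?thesis
      by (intro exI[of _ tube] exI[of _ \<phi>] conjI \<phi>(1) Nb(2)[OF z1] allI impI analytic[OF S] moves[OF S])
  qed
  then show ?thesis
    using oNb oS homeo unfolding Ctilde_surface_def image by (simp add: image)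
qed

lemma continuous_s: "x \<in> F \<Longrightarrow> continuous_map (top_of_set (Dom (E x))) (stop T) (s x)"
  using s_disc[of x] Dom_F[of x] unfolding embedded_disc_def
  by (auto intro: continuous_map_from_subtopology_mono)

lemma continuous_s_compose:
  assumes "x \<in> F" "continuous_on S f" "f ` S \<subseteq> Dom (E x)"
  shows "continuous_map (top_of_set S) (stop T) (\<lambda>u. s x (f u))"
proof -
  have "continuous_map (top_of_set S) (top_of_set (Dom (E x))) f"
    using assms by (auto simp: image_subset_iff)
  from continuous_map_compose[OF this continuous_s[OF assms(1)]] show ?thesis by (simp add: o_def)
qed

lemma sym_coordinate_simple_family:
  assumes \<phi>: "\<And>q. q \<in> tube \<Longrightarrow> \<phi> q = c (centre q) + coord q"
    and w: "\<forall>x\<in>#w. x \<in> F \<and> E x = 1" and u: "u \<in> Dom 1"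
  shows "sym_coordinate \<phi> (simple_family w u) = (\<Prod>x\<in>#w. [:- (c x + u), 1:])"
proof -
  have "image_mset (\<lambda>x. [:- \<phi> (s x u), 1:]) w = image_mset (\<lambda>x. [:- (c x + u), 1:]) w"
  proof (rule image_mset_cong)
    fix x assume "x \<in># w"
    then have x: "x \<in> F" "u \<in> Dom (E x)" using w u by auto
    show "[:- \<phi> (s x u), 1:] = [:- (c x + u), 1:]"
      using \<phi>[OF s_in_tube[OF x]] centre_s[OF x] coord_s[OF x] by simp
  qed
  then show ?thesis
    by (simp add: sym_coordinate_def simple_family_def multiset.map_comp o_def)
qed

lemma chart_unramified:
  assumes z: "over_y z" and simple: "\<And>x. x \<in># z \<Longrightarrow> E x = 1" and x: "x \<in># z"
  shows "(Nb z, read x) \<in> charts (Ctilde_surface T X Y \<kappa> \<rho> n)"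
proof -
  obtain \<phi> c where \<phi>: "local_coordinate T tube \<phi>" "\<And>q. q \<in> tube \<Longrightarrow> \<phi> q = c (centre q) + coord q"
    by (rule big_coordinate) (rule that)
  have E1: "E x = 1" using simple x by blast
  show ?thesis
  proof (rule chart_from_family[OF z x _ _ _ _ \<phi>, where Z="simple_family z" and Z'="simple_family (z - {#x#})"], unfold E1)
    show "count z x = 1" using simple_point_unique(1)[OF z x E1] .
    show "simple_family z ` Dom 1 = Nb z"
    proof
      show "simple_family z ` Dom 1 \<subseteq> Nb z"
        by (rule image_subsetI) (rule simple_family_Nb[OF z simple])
      show "Nb z \<subseteq> simple_family z ` Dom 1"
        by (rule subsetI) (erule Nb_simple[OF z simple, rotated], simp_all)
    qed
    show "simple_family z u = add_mset (s x u) (simple_family (z - {#x#}) u)" for u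
      unfolding simple_family_def using x by (metis image_mset_add_mset insert_DiffM)
    obtain xs where xs: "z = mset xs" by (metis ex_mset)
    have "continuous_map (top_of_set (Dom 1)) (sym_topology T n) (\<lambda>u. mset (map (\<lambda>g. g u) (map s xs)))"
    proof (rule continuous_map_into_sym_topology)
      show "length (map s xs) = n" using CtD(2)[OF over_y_Ct[OF z]] xs by simp
      show "continuous_map (top_of_set (Dom 1)) (stop T) g" if "g \<in> set (map s xs)" for g
        using that continuous_s over_y_F[OF z] simple xs by auto metis
    qed
    then show "continuous_map (top_of_set (Dom 1)) (sym_topology T n) (simple_family z)"
      by (simp add: simple_family_def[abs_def] xs o_def)
    show "holomorphic_coeffs (Dom 1) (\<lambda>u. sym_coordinate \<phi> (simple_family (z - {#x#}) u))"
    proof (rule holomorphic_coeffs_cong)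
      show "holomorphic_coeffs (Dom 1) (\<lambda>u. \<Prod>x'\<in>#z - {#x#}. [:- (c x' + u), 1:])"
        by (intro holomorphic_coeffs_prod_mset holomorphic_coeffs_linear holomorphic_intros)
      show "(\<Prod>x'\<in>#z - {#x#}. [:- (c x' + u), 1:]) = sym_coordinate \<phi> (simple_family (z - {#x#}) u)" if u: "u \<in> Dom 1" for u
        using over_y_F[OF z] simple by (intro sym_coordinate_simple_family[OF \<phi>(2) _ u, symmetric]) (auto dest: in_diffD)
    qed
  qed
qed

lemma ramified_family_image:
  assumes z: "over_y z" "z = {#x1, x2#} + v" and \<kappa>: "\<kappa> x2 = \<kappa> x1" "E x1 = 2" and simple: "\<And>x. x \<in># v \<Longrightarrow> E x = 1"
  shows "ramified_family x1 x2 v ` Dom 2 = Nb z"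
proof
  show "ramified_family x1 x2 v ` Dom 2 \<subseteq> Nb z"
    by (rule image_subsetI) (rule ramified_family_Nb[OF z \<kappa> simple])
  show "Nb z \<subseteq> ramified_family x1 x2 v ` Dom 2"
  proof
    fix z1 assume "z1 \<in> Nb z"
    then obtain b where "b \<in> Dom 2" "z1 = ramified_family x1 x2 v b"
      by (rule Nb_ramified[OF z \<kappa> simple, rotated]) (rule that)
    then show "z1 \<in> ramified_family x1 x2 v ` Dom 2" by blast
  qed
qed

lemma continuous_ramified_family:
  assumes z: "over_y z" "z = {#x1, x2#} + v" and \<kappa>: "\<kappa> x2 = \<kappa> x1" "E x1 = 2" and simple: "\<And>x. x \<in># v \<Longrightarrow> E x = 1"
  shows "continuous_map (top_of_set (Dom 2)) (sym_topology T n) (ramified_family x1 x2 v)"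
proof -
  have x: "x1 \<in> F" "x2 \<in> F" "E x2 = 2" using over_y_F[OF z(1)] z(2) \<kappa> by auto
  obtain xs where xs: "v = mset xs" by (metis ex_mset)
  define gs where "gs = [s x1, \<lambda>b. s x2 (- b)] @ map (\<lambda>x b. s x (b\<^sup>2)) xs"
  have "continuous_map (top_of_set (Dom 2)) (sym_topology T n) (\<lambda>u. mset (map (\<lambda>g. g u) gs))"
  proof (rule continuous_map_into_sym_topology)
    show "length gs = n" using CtD(2)[OF over_y_Ct[OF z(1)]] z(2) xs by (simp add: gs_def)
    fix g assume "g \<in> set gs"
    then consider "g = s x1" | "g = (\<lambda>b. s x2 (- b))" | x' where "x' \<in># v" "g = (\<lambda>b. s x' (b\<^sup>2))"
      by (auto simp: gs_def xs)
    then show "continuous_map (top_of_set (Dom 2)) (stop T) g"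
    proof cases
      case 1
      then show ?thesis using continuous_s[OF x(1)] \<kappa> by simp
    next
      case 2
      show ?thesis unfolding 2
        by (rule continuous_s_compose[OF x(2)]) (use Dom_square(2) x(3) in \<open>auto intro!: continuous_intros\<close>)
    next
      case (3 x')
      have "x' \<in> F" "E x' = 1" using 3 over_y_F[OF z(1)] z(2) simple by auto
      then show ?thesis unfolding 3(2)
        by (intro continuous_s_compose) (use Dom_square(1) in \<open>auto intro!: continuous_intros\<close>)
    qed
  qed
  moreover have "(\<lambda>u. mset (map (\<lambda>g. g u) gs)) = ramified_family x1 x2 v"
    by (simp add: fun_eq_iff gs_def ramified_family_def simple_family_def xs o_def)
  ultimately show ?thesis by simp
qed

text \<open>
  Near \<open>x + x' + \<dots>\<close> the parameter is that of the member near \<open>x\<close>; the member near \<open>x'\<close> has the opposite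
  parameter.
\<close>

lemma chart_ramified:
  assumes z: "over_y z" and x: "x \<in># z" "E x = 2" "other x \<in># z"
  shows "(Nb z, read x) \<in> charts (Ctilde_surface T X Y \<kappa> \<rho> n)"
proof -
  obtain \<phi> c where \<phi>: "local_coordinate T tube \<phi>" "\<And>q. q \<in> tube \<Longrightarrow> \<phi> q = c (centre q) + coord q"
    by (rule big_coordinate) (rule that)
  obtain x2 v where v: "z = {#x, x2#} + v" "\<kappa> x2 = \<kappa> x" and simple: "\<And>x'. x' \<in># v \<Longrightarrow> E x' = 1"
    by (rule over_y_ramified[OF z x(1,2)]) (rule that)
  have xF: "x \<in> F" using over_y_F[OF z x(1)] .
  note other = fibre_kappa(2)[OF F_D(1)[OF xF]]
  have "other x \<notin># v" using simple[of "other x"] F_D(4)[OF xF] x(2) by auto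
  then have x2: "x2 = other x" using x(3) v(1) other by auto
  have xv: "x \<notin># v" using simple[of x] x(2) by auto
  have x2F: "x2 \<in> F" "E x2 = 2" using x2 F_D[OF xF] x(2) by auto
  have vF: "\<forall>x\<in>#v. x \<in> F \<and> E x = 1" using simple over_y_F[OF z] v(1) by auto
  show ?thesis
  proof (rule chart_from_family[OF z x(1) _ _ _ _ \<phi>, where Z="ramified_family x x2 v"
        and Z'="\<lambda>b. add_mset (s x2 (- b)) (simple_family v (b\<^sup>2))"], unfold x(2))
    show "count z x = 1" using v(1) x2 other xv by (simp add: not_in_iff)
    show "ramified_family x x2 v ` Dom 2 = Nb z" by (rule ramified_family_image[OF z v x(2) simple])
    show "ramified_family x x2 v u = add_mset (s x u) (add_mset (s x2 (- u)) (simple_family v (u\<^sup>2)))" for u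
      by (simp add: ramified_family_def)
    show "continuous_map (top_of_set (Dom 2)) (sym_topology T n) (ramified_family x x2 v)"
      by (rule continuous_ramified_family[OF z v x(2) simple])
    show "holomorphic_coeffs (Dom 2) (\<lambda>u. sym_coordinate \<phi> (add_mset (s x2 (- u)) (simple_family v (u\<^sup>2))))"
    proof (rule holomorphic_coeffs_cong)
      show "holomorphic_coeffs (Dom 2) (\<lambda>u. [:- (c x2 - u), 1:] * (\<Prod>x'\<in>#v. [:- (c x' + u\<^sup>2), 1:]))"
        by (intro holomorphic_coeffs_mult holomorphic_coeffs_prod_mset holomorphic_coeffs_linear holomorphic_intros)
      show "[:- (c x2 - u), 1:] * (\<Prod>x'\<in>#v. [:- (c x' + u\<^sup>2), 1:]) =
          sym_coordinate \<phi> (add_mset (s x2 (- u)) (simple_family v (u\<^sup>2)))" if u: "u \<in> Dom 2" for u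
      proof -
        have mu: "- u \<in> Dom (E x2)" using Dom_square(2)[OF u] x2F(2) by simp
        have "\<phi> (s x2 (- u)) = c x2 - u"
          using \<phi>(2)[OF s_in_tube[OF x2F(1) mu]] centre_s[OF x2F(1) mu] coord_s[OF x2F(1) mu] by simp
        then show ?thesis
          using sym_coordinate_simple_family[OF \<phi>(2) vF Dom_square(1)[OF u]]
          by (simp only: sym_coordinate_add_mset)
      qed
    qed
  qed
qed

text \<open>
  Square roots do not depend continuously on \<open>w\<close>, but the pair \<open>\<plusminus>\<surd>w\<close> does: a function of \<open>w\<close> is continuous if
  it becomes continuous as a function of \<open>b\<close> after \<open>w = b\<^sup>2\<close>.
\<close>

lemma quotient_map_square: "quotient_map (top_of_set (Dom 2)) (top_of_set (Dom 1)) (\<lambda>b. b\<^sup>2)"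
proof (rule continuous_open_imp_quotient_map)
  show "continuous_map (top_of_set (Dom 2)) (top_of_set (Dom 1)) (\<lambda>b. b\<^sup>2)"
    using Dom_square(1) by (auto intro!: continuous_intros)
  show "open_map (top_of_set (Dom 2)) (top_of_set (Dom 1)) (\<lambda>b. b\<^sup>2)"
    unfolding open_map_def
  proof (intro allI impI)
    fix U assume "openin (top_of_set (Dom 2)) U"
    then have U: "open U" "U \<subseteq> Dom 2" using open_Dom by (auto simp: openin_open_eq)
    have "\<not> (\<lambda>b :: complex. b\<^sup>2) constant_on UNIV"
    proof
      assume "(\<lambda>b :: complex. b\<^sup>2) constant_on UNIV"
      then have "(0 :: complex)\<^sup>2 = 1\<^sup>2" unfolding constant_on_def by (metis UNIV_I)
      then show False by simp
    qed
    then have "open ((\<lambda>b. b\<^sup>2) ` U)"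
      using U by (intro open_mapping_thm[of _ UNIV]) (auto intro!: holomorphic_intros)
    moreover have "(\<lambda>b. b\<^sup>2) ` U \<subseteq> Dom 1" using U Dom_square(1) by auto
    ultimately show "openin (top_of_set (Dom 1)) ((\<lambda>b. b\<^sup>2) ` U)" by (rule open_subset[rotated])
  qed
  have "w \<in> (\<lambda>b. b\<^sup>2) ` Dom 2" if "w \<in> Dom 1" for w
    using Dom_square(3)[OF that] by (intro image_eqI[of _ _ "csqrt w"]) simp_all
  then show "(\<lambda>b. b\<^sup>2) ` topspace (top_of_set (Dom 2)) = topspace (top_of_set (Dom 1))"
    using Dom_square(1) by auto
qed

lemma ramified_family_minus: "ramified_family x x v (- b) = ramified_family x x v b"
  by (simp add: ramified_family_def add_mset_commute)

lemma ramified_family_csqrt: "ramified_family x x v (csqrt (b\<^sup>2)) = ramified_family x x v b"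
proof -
  have "csqrt (b\<^sup>2) = b \<or> csqrt (b\<^sup>2) = - b" using power2_eq_iff[of "csqrt (b\<^sup>2)" b] by simp
  then show ?thesis using ramified_family_minus by metis
qed

text \<open>
  Near \<open>2 x1 + \<dots>\<close> the linear factors of the two members near \<open>x1\<close> multiply to a polynomial whose
  coefficients are polynomials in \<open>w\<close>. The parameter \<open>w\<close> is that of a member away from \<open>x1\<close>.
\<close>

lemma chart_double_point:
  assumes z: "over_y z" "z = {#x1, x1#} + v" and E2: "E x1 = 2" and simple: "\<And>x. x \<in># v \<Longrightarrow> E x = 1"
    and x: "x \<in># v"
  shows "(Nb z, read x) \<in> charts (Ctilde_surface T X Y \<kappa> \<rho> n)"
proof -
  obtain \<phi> c where \<phi>: "local_coordinate T tube \<phi>" "\<And>q. q \<in> tube \<Longrightarrow> \<phi> q = c (centre q) + coord q"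
    by (rule big_coordinate) (rule that)
  have x1F: "x1 \<in> F" using over_y_F[OF z(1)] z(2) by simp
  have vF: "\<forall>x\<in>#v - {#x#}. x \<in> F \<and> E x = 1" using simple over_y_F[OF z(1)] z(2) by (auto dest: in_diffD)
  have E1: "E x = 1" using simple x by blast
  have xz: "x \<in># z" using x z(2) by simp
  define Z where "Z w = ramified_family x1 x1 v (csqrt w)" for w
  define Z' where "Z' w = {#s x1 (csqrt w), s x1 (- csqrt w)#} + simple_family (v - {#x#}) w" for w
  show ?thesis
  proof (rule chart_from_family[OF z(1) xz _ _ _ _ \<phi>, where Z=Z and Z'=Z'], unfold E1)
    show "count z x = 1" using simple_point_unique(1)[OF z(1) xz E1] .
    have "Z ` Dom 1 = ramified_family x1 x1 v ` Dom 2"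
    proof
      show "Z ` Dom 1 \<subseteq> ramified_family x1 x1 v ` Dom 2" using Dom_square(3) by (auto simp: Z_def)
      show "ramified_family x1 x1 v ` Dom 2 \<subseteq> Z ` Dom 1"
      proof (rule image_subsetI)
        fix b assume "b \<in> Dom 2"
        then show "ramified_family x1 x1 v b \<in> Z ` Dom 1"
          using Dom_square(1)[of b] by (intro image_eqI[of _ _ "b\<^sup>2"]) (simp_all add: Z_def ramified_family_csqrt)
      qed
    qed
    also have "\<dots> = Nb z" by (rule ramified_family_image[OF z refl E2 simple])
    finally show "Z ` Dom 1 = Nb z" .
    show "Z w = add_mset (s x w) (Z' w)" for w
    proof -
      have "simple_family v w = add_mset (s x w) (simple_family (v - {#x#}) w)"
        unfolding simple_family_def using x by (metis image_mset_add_mset insert_DiffM)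
      then show ?thesis by (simp add: Z_def Z'_def ramified_family_def)
    qed
    have "continuous_map (top_of_set (Dom 2)) (sym_topology T n) (Z \<circ> (\<lambda>b. b\<^sup>2))"
      using continuous_ramified_family[OF z refl E2 simple] by (simp add: Z_def[abs_def] o_def ramified_family_csqrt)
    then show "continuous_map (top_of_set (Dom 1)) (sym_topology T n) Z"
      by (rule continuous_compose_quotient_map[OF quotient_map_square])
    show "holomorphic_coeffs (Dom 1) (\<lambda>w. sym_coordinate \<phi> (Z' w))"
    proof (rule holomorphic_coeffs_cong)
      have "holomorphic_coeffs (Dom 1) (\<lambda>w. [:(c x1)\<^sup>2 - w, - 2 * c x1, 1:])"
        unfolding holomorphic_coeffs_def
      proof
        fix i
        show "(\<lambda>w. coeff [:(c x1)\<^sup>2 - w, - 2 * c x1, 1:] i) holomorphic_on Dom 1"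
          by (cases i) (auto simp: coeff_pCons intro!: holomorphic_intros split: nat.splits)
      qed
      then show "holomorphic_coeffs (Dom 1) (\<lambda>w. [:(c x1)\<^sup>2 - w, - 2 * c x1, 1:] * (\<Prod>x'\<in>#v - {#x#}. [:- (c x' + w), 1:]))"
        by (intro holomorphic_coeffs_mult holomorphic_coeffs_prod_mset holomorphic_coeffs_linear holomorphic_intros)
      show "[:(c x1)\<^sup>2 - w, - 2 * c x1, 1:] * (\<Prod>x'\<in>#v - {#x#}. [:- (c x' + w), 1:]) = sym_coordinate \<phi> (Z' w)"
        if w: "w \<in> Dom 1" for w
      proof -
        have b: "csqrt w \<in> Dom (E x1)" "- csqrt w \<in> Dom (E x1)"
          using Dom_square(3)[OF w] Dom_square(2) E2 by auto
        have "\<phi> (s x1 (csqrt w)) = c x1 + csqrt w" "\<phi> (s x1 (- csqrt w)) = c x1 - csqrt w"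
          using \<phi>(2)[OF s_in_tube[OF x1F b(1)]] centre_s[OF x1F b(1)] coord_s[OF x1F b(1)]
            \<phi>(2)[OF s_in_tube[OF x1F b(2)]] centre_s[OF x1F b(2)] coord_s[OF x1F b(2)] by simp_all
        then have "sym_coordinate \<phi> (Z' w) = [:- (c x1 + csqrt w), 1:] * ([:- (c x1 - csqrt w), 1:] *
            sym_coordinate \<phi> (simple_family (v - {#x#}) w))"
          unfolding Z'_def by (simp only: sym_coordinate_add_mset union_mset_add_mset_left add_0)
        also have "\<dots> = [:(c x1)\<^sup>2 - w, - 2 * c x1, 1:] * sym_coordinate \<phi> (simple_family (v - {#x#}) w)"
          using mult_conjugate_linear_factors[of "c x1" "csqrt w"] by (simp only: mult.assoc[symmetric] power2_csqrt)
        finally show ?thesis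
          using sym_coordinate_simple_family[OF \<phi>(2) vF w] by simp
      qed
    qed
  qed
qed

lemma chart_simple_point:
  assumes z: "over_y z" and x: "x \<in># z" "E x = 1" and no_pair: "\<And>x1. x1 \<in># z \<Longrightarrow> E x1 = 2 \<Longrightarrow> other x1 \<notin># z"
  shows "(Nb z, read x) \<in> charts (Ctilde_surface T X Y \<kappa> \<rho> n)"
proof (cases "\<forall>x\<in>#z. E x = 1")
  case True
  then show ?thesis using chart_unramified[OF z _ x(1)] by blast
next
  case False
  then obtain x1 where x1: "x1 \<in># z" "E x1 \<noteq> 1" by blast
  then have x1F: "x1 \<in> F" and E2: "E x1 = 2" using over_y_F[OF z] E_cases by blast+
  obtain x2 v where v: "z = {#x1, x2#} + v" "\<kappa> x2 = \<kappa> x1" and simple: "\<And>x'. x' \<in># v \<Longrightarrow> E x' = 1"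
    by (rule over_y_ramified[OF z x1(1) E2]) (rule that)
  have "x2 \<in># z" using v by simp
  then have "x2 \<in> fibre T \<kappa> (\<kappa> x1)" using v(2) F_D(1)[OF over_y_F[OF z]] by (auto simp: fibre_def)
  then have "x2 = x1 \<or> x2 = other x1" using fibre_kappa(1)[OF F_D(1)[OF x1F]] by blast
  then have "x2 = x1" using no_pair[OF x1(1) E2] \<open>x2 \<in># z\<close> by blast
  moreover have "x \<in># v" using x v(1) E2 \<open>x2 = x1\<close> by auto
  ultimately show ?thesis using chart_double_point[OF z _ E2 simple] v(1) by blast
qed

end

section \<open>Intersection multiplicities\<close>

lemma holomorphic_on2_power_diff: "holomorphic_on2 (\<lambda>(u, v). u ^ i - v ^ j) W"
  unfolding holomorphic_on2_def
proof
  fix p :: "complex \<times> complex" assume "p \<in> W"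
  have "((\<lambda>p. fst p ^ i - snd p ^ j) has_derivative
      (\<lambda>h. of_nat i * (fst h * fst p ^ (i - 1)) - of_nat j * (snd h * snd p ^ (j - 1)))) (at p)"
    by (auto intro!: derivative_eq_intros)
  then have "((\<lambda>(u, v). u ^ i - v ^ j) has_derivative
      (\<lambda>(u, v). (of_nat i * fst p ^ (i - 1)) * u + (- of_nat j * snd p ^ (j - 1)) * v)) (at p)"
    by (simp add: case_prod_beta' mult_ac)
  then show "\<exists>a b. ((\<lambda>(u, v). u ^ i - v ^ j) has_derivative (\<lambda>(u, v). a * u + b * v)) (at p)" by blast
qed

lemma zorder_minus_power: "zorder (\<lambda>u :: complex. - (u ^ j)) 0 = int j"
  by (rule zorder_eqI[of UNIV _ "\<lambda>_. - 1"]) auto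

text \<open>
  In all cases that occur, the local equation of \<open>D\<close> can be taken to be \<open>u\<^sup>i = v\<^sup>m\<close>; its restriction to
  \<open>u = 0\<close> has order \<open>m\<close>.
\<close>

lemma fibre_multiplicity_eqI:
  assumes s: "(U, s) \<in> charts M" "z \<in> U" "s z = 0" and t: "(V, t) \<in> charts M" "w \<in> V" "t w = 0"
    and i: "i > 0" and equation: "\<And>a b. a \<in> U \<Longrightarrow> b \<in> V \<Longrightarrow> (a, b) \<in> D \<Longrightarrow> s a ^ i = t b ^ m"
    and lower: "\<And>U s V t W g. (U, s) \<in> charts M \<Longrightarrow> (V, t) \<in> charts M \<Longrightarrow> z \<in> U \<Longrightarrow> w \<in> V \<Longrightarrow> open W \<Longrightarrow>
      (s z, t w) \<in> W \<Longrightarrow> holomorphic_on2 g W \<Longrightarrow>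
      (\<And>a b. a \<in> U \<Longrightarrow> b \<in> V \<Longrightarrow> (a, b) \<in> D \<Longrightarrow> (s a, t b) \<in> W \<Longrightarrow> g (s a, t b) = 0) \<Longrightarrow>
      \<exists>\<^sub>F u in at (t w). g (s z, u) \<noteq> 0 \<Longrightarrow> int m \<le> zorder (\<lambda>u. g (s z, u)) (t w)"
  shows "fibre_multiplicity M D z w = m"
  unfolding fibre_multiplicity_def
proof (rule Least_equality)
  define g :: "complex \<times> complex \<Rightarrow> complex" where "g = (\<lambda>(u, v). u ^ i - v ^ m)"
  have g0: "g (s z, u) = - (u ^ m)" for u using i by (simp add: g_def s(3))
  have "\<forall>\<^sub>F u in at (0 :: complex). u \<noteq> 0" by (auto simp: eventually_at_filter)
  then have "\<forall>\<^sub>F u in at (0 :: complex). - (u ^ m) \<noteq> 0" by eventually_elim simp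
  then have "\<exists>\<^sub>F u in at (t w). g (s z, u) \<noteq> 0"
    unfolding g0 t(3) by (intro eventually_frequently) auto
  moreover have "m = nat (zorder (\<lambda>u. g (s z, u)) (t w))" unfolding g0 t(3) by (simp only: zorder_minus_power nat_int)
  moreover have "holomorphic_on2 g UNIV" unfolding g_def by (rule holomorphic_on2_power_diff)
  moreover have "\<forall>a\<in>U. \<forall>b\<in>V. (a, b) \<in> D \<and> (s a, t b) \<in> UNIV \<longrightarrow> g (s a, t b) = 0"
    using equation by (simp add: g_def)
  ultimately show "\<exists>(U, s)\<in>charts M. \<exists>(V, t)\<in>charts M. \<exists>W g. z \<in> U \<and> w \<in> V \<and> open W \<and> (s z, t w) \<in> W \<and>
      holomorphic_on2 g W \<and> (\<forall>a\<in>U. \<forall>b\<in>V. (a, b) \<in> D \<and> (s a, t b) \<in> W \<longrightarrow> g (s a, t b) = 0) \<and>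
      (\<exists>\<^sub>F u in at (t w). g (s z, u) \<noteq> 0) \<and> m = nat (zorder (\<lambda>u. g (s z, u)) (t w))"
    using s(1,2) t(1,2)
    by (intro bexI[of _ "(U, s)"] bexI[of _ "(V, t)"] case_prodI exI[of _ UNIV] exI[of _ g] conjI) auto
next
  fix l
  assume "\<exists>(U, s)\<in>charts M. \<exists>(V, t)\<in>charts M. \<exists>W g. z \<in> U \<and> w \<in> V \<and> open W \<and> (s z, t w) \<in> W \<and>
      holomorphic_on2 g W \<and> (\<forall>a\<in>U. \<forall>b\<in>V. (a, b) \<in> D \<and> (s a, t b) \<in> W \<longrightarrow> g (s a, t b) = 0) \<and>
      (\<exists>\<^sub>F u in at (t w). g (s z, u) \<noteq> 0) \<and> l = nat (zorder (\<lambda>u. g (s z, u)) (t w))"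
  then obtain U s V t W g where *: "(U, s) \<in> charts M" "(V, t) \<in> charts M" "z \<in> U" "w \<in> V" "open W"
      "(s z, t w) \<in> W" "holomorphic_on2 g W"
      "\<forall>a\<in>U. \<forall>b\<in>V. (a, b) \<in> D \<and> (s a, t b) \<in> W \<longrightarrow> g (s a, t b) = 0"
      "\<exists>\<^sub>F u in at (t w). g (s z, u) \<noteq> 0" "l = nat (zorder (\<lambda>u. g (s z, u)) (t w))"
    by (elim bexE case_prodE exE conjE) simp
  have "int m \<le> zorder (\<lambda>u. g (s z, u)) (t w)"
    by (rule lower[OF *(1-7) _ *(9)]) (use *(8) in blast)
  then show "m \<le> l" by (simp add: *(10))
qed

lemma analytic_slice:
  assumes "open W" "(a, b) \<in> W" "holomorphic_on2 g W"
  shows "(\<lambda>u. g (a, u)) analytic_on {b}"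
proof -
  define B where "B = {u. (a, u) \<in> W}"
  have "open B" unfolding B_def using open_vimage[OF assms(1), of "\<lambda>u. (a, u)"]
    by (simp add: vimage_def continuous_on_Pair)
  moreover have "(\<lambda>u. g (a, u)) holomorphic_on B" by (rule holomorphic_on2_slice[OF assms(3)]) (simp add: B_def)
  moreover have "b \<in> B" using assms(2) by (simp add: B_def)
  ultimately show ?thesis using analytic_at by blast
qed

lemma multiplicity_lower_1:
  assumes "(z, w) \<in> D" "z \<in> U" "w \<in> V" "open W" "(s z, t w) \<in> W" "holomorphic_on2 g W"
    and "\<And>a b. a \<in> U \<Longrightarrow> b \<in> V \<Longrightarrow> (a, b) \<in> D \<Longrightarrow> (s a, t b) \<in> W \<Longrightarrow> g (s a, t b) = 0"
    and "\<exists>\<^sub>F u in at (t w). g (s z, u) \<noteq> 0"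
  shows "int 1 \<le> zorder (\<lambda>u. g (s z, u)) (t w)"
proof -
  have "g (s z, t w) = 0" using assms by blast
  then have "zorder (\<lambda>u. g (s z, u)) (t w) > 0"
    using zorder_pos_iff'[OF analytic_slice[OF assms(4-6)] assms(8)] by simp
  then show ?thesis by simp
qed

context fibre_discs
begin

abbreviation "C \<equiv> C_surface T X Y \<kappa> \<rho> n"
abbreviation "DC \<equiv> D_curve T X Y \<kappa> \<rho>"

lemma F_tube: "x \<in> F \<Longrightarrow> x \<in> tube" "x \<in> F \<Longrightarrow> centre x = x" "x \<in> F \<Longrightarrow> coord x = 0"
proof -
  assume x: "x \<in> F"
  have 0: "0 \<in> Dom (E x)" using zero_in_Dom E_cases x by blast
  show "x \<in> tube" "centre x = x" "coord x = 0"
    using s_in_tube[OF x 0] centre_s[OF x 0] coord_s[OF x 0] s_0[OF x] by simp_all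
qed

lemma centre_primed: "set_mset z1 \<subseteq> tube \<Longrightarrow> image_mset centre (primed z1) = primed (image_mset centre z1)"
  unfolding conj_divisor_def multiset.map_comp
  by (rule image_mset_cong) (use tube_other(2) in auto)

lemma centre_flip:
  assumes "set_mset z1 \<subseteq> tube" "q \<in># z1"
  shows "image_mset centre (flip q z1) = flip (centre q) (image_mset centre z1)"
proof -
  obtain w where w: "z1 = add_mset q w" using assms(2) by (metis multi_member_split)
  then show ?thesis using assms centre_primed[of w] by simp
qed

lemma Nb_self: "over_y z \<Longrightarrow> z \<in> Nb z"
proof -
  assume z: "over_y z"
  have "image_mset centre z = image_mset id z"
    by (rule image_mset_cong) (use F_tube over_y_F[OF z] in auto)
  then show ?thesis using over_y_Ct[OF z] F_tube(1) over_y_F[OF z] by (auto simp: Nb_def)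
qed

lemma Nb_D:
  assumes "z1 \<in> Nb z"
  shows "z1 \<in> Ct" "set_mset z1 \<subseteq> tube" "image_mset centre z1 = z"
  using assms by (auto simp: Nb_def)

text \<open>
  If two divisors near \<open>z\<close> were conjugate, then \<open>z\<close> would be conjugate to itself, contrary to parity.
\<close>

lemma inj_on_orbit_Nb:
  assumes z: "over_y z" shows "inj_on orbit (Nb z)"
proof (rule inj_onI)
  fix z1 z2 assume *: "z1 \<in> Nb z" "z2 \<in> Nb z" "orbit z1 = orbit z2"
  note z1 = Nb_D[OF *(1)] and z2 = Nb_D[OF *(2)]
  have "z2 = z1 \<or> z2 = primed z1" using *(3) orbit_eq_iff[OF z1(1)] by simp
  moreover have "z2 \<noteq> primed z1"
  proof
    assume "z2 = primed z1"
    then have "primed z = z" using z1 z2 centre_primed[OF z1(2)] by simp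
    then show False using parity_primed_Ct[OF over_y_Ct[OF z]] by simp
  qed
  ultimately show "z1 = z2" by simp
qed

lemma chart_of_C:
  assumes z: "over_y z" and chart: "(Nb z, read x) \<in> charts (Ctilde_surface T X Y \<kappa> \<rho> n)"
  shows "(orbit ` Nb z, \<lambda>c. read x (inv_into (Nb z) orbit c)) \<in> charts C"
  using chart inj_on_orbit_Nb[OF z] unfolding C_surface_def by auto

lemma inv_orbit: "over_y z \<Longrightarrow> z1 \<in> Nb z \<Longrightarrow> inv_into (Nb z) orbit (orbit z1) = z1"
  using inj_on_orbit_Nb by simp

lemma read_point:
  assumes "z1 \<in> Nb z" "x \<in># z" "count z x = 1"
  obtains q where "q \<in># z1" "centre q = x" "read x z1 = coord q"
proof -
  have "x \<in># image_mset centre z1" using Nb_D(3)[OF assms(1)] assms(2) by simp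
  then obtain q where q: "q \<in># z1" "centre q = x" by auto
  then have "read x z1 = coord q" using Nb_D(3)[OF assms(1)] assms(3) by (intro read_eq) auto
  then show thesis using that q by blast
qed

lemma read_centre:
  assumes z: "over_y z" and x: "x \<in># z" "count z x = 1"
  shows "read x z = 0"
proof -
  obtain q where "q \<in># z" "read x z = coord q" by (rule read_point[OF Nb_self[OF z] x]) (rule that)
  then show ?thesis using F_tube(3) over_y_F[OF z] by simp
qed

lemma read_power:
  assumes "z1 \<in> Nb z" "x \<in># z" "count z x = 1" "q \<in># z1"
  shows "read x z1 ^ E x = coord q ^ E (centre q)"
proof -
  obtain q0 where q0: "q0 \<in># z1" "centre q0 = x" "read x z1 = coord q0" by (rule read_point[OF assms(1-3)]) (rule that)
  obtain w where w: "\<And>q. q \<in># z1 \<Longrightarrow> coord q ^ E (centre q) = w"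
    by (rule displacement[OF Nb_D(1,2)[OF assms(1)]]) (rule that)
  show ?thesis using w[OF q0(1)] w[OF assms(4)] q0 by simp
qed

text \<open>
  Near the point given by the flip of \<open>z\<close> in \<open>x\<close>, the curve \<open>D\<close> has no branch other than that of the flips
  in members close to \<open>x\<close>. The centres of a flip are a flip of the centres; parity excludes the
  conjugate of a flip, and injectivity of flips determines the member.
\<close>

lemma D_near:
  assumes z: "over_y z" and x: "x \<in># z" and z1: "z1 \<in> Nb z" and f1: "f1 \<in> Nb (flip x z)"
    and D: "(orbit z1, orbit f1) \<in> DC"
  obtains q where "q \<in># z1" "centre q = x" "f1 = flip q z1"
proof -
  note z1' = Nb_D[OF z1] and f1' = Nb_D[OF f1]
  obtain q where q: "q \<in># z1" "orbit f1 = orbit (flip q z1)" using D D_curve_iff[OF z1'(1)] by blast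
  have cq: "centre q \<in># z" using q z1'(3) by (metis image_eqI set_image_mset)
  have c: "image_mset centre (flip q z1) = flip (centre q) z" using centre_flip[OF z1'(2) q(1)] z1'(3) by simp
  have Ct: "z \<in> Ct" by (rule over_y_Ct[OF z])
  have sub: "set_mset (flip q z1) \<subseteq> tube"
    using z1'(2) q(1) tube_other(1) by (auto simp: flip_def conj_divisor_def dest!: in_diffD)
  have "flip q z1 = f1 \<or> flip q z1 = primed f1" using q(2) orbit_eq_iff[OF f1'(1)] by simp
  moreover have "flip q z1 \<noteq> primed f1"
  proof
    assume "flip q z1 = primed f1"
    then have "flip (centre q) z = primed (flip x z)" using c centre_primed[OF f1'(2)] f1'(3) by simp
    then show False
      using parity_primed_Ct[OF flip_Ct[OF Ct x]] parity_flip_Ct[OF Ct x] parity_flip_Ct[OF Ct cq] by simp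
  qed
  ultimately have f: "f1 = flip q z1" by simp
  then have "flip (centre q) z = flip x z" using c f1'(3) by simp
  then have "centre q = x" using flip_inj[OF CtD(1)[OF Ct] cq x] by simp
  then show thesis using that q f by blast
qed

lemma simple_point_exists:
  assumes z: "over_y z" obtains x where "x \<in># z" "E x = 1"
proof -
  have size: "size z = n" using CtD(2)[OF over_y_Ct[OF z]] .
  then have "z \<noteq> {#}" using degree by auto
  then obtain x1 where x1: "x1 \<in># z" by auto
  show thesis
  proof (cases "E x1 = 1")
    case True then show thesis using that x1 by blast
  next
    case False
    then have "E x1 = 2" using E_cases over_y_F[OF z x1] by blast
    then obtain x2 v where v: "z = {#x1, x2#} + v" "\<And>x. x \<in># v \<Longrightarrow> E x = 1"
      by (rule over_y_ramified[OF z x1]) (rule that)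
    have "v \<noteq> {#}" using size v(1) degree by auto
    then obtain x where "x \<in># v" by auto
    then show thesis using that v by auto
  qed
qed

lemma pair_count:
  assumes z: "over_y z" and x: "x \<in># z" "E x = 2" "other x \<in># z"
  obtains v where "z = {#x, other x#} + v" "\<And>x'. x' \<in># v \<Longrightarrow> E x' = 1"
proof -
  obtain x2 v where v: "z = {#x, x2#} + v" "\<And>x'. x' \<in># v \<Longrightarrow> E x' = 1"
    by (rule over_y_ramified[OF z x(1,2)]) (rule that)
  have xF: "x \<in> F" using over_y_F[OF z x(1)] .
  have "other x \<notin># v" using v(2)[of "other x"] F_D(4)[OF xF] x(2) by auto
  then have "x2 = other x" using x(3) v(1) fibre_kappa(2)[OF F_D(1)[OF xF]] by auto
  then show thesis using that v by blast
qed

lemma count_pair: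
  assumes z: "over_y z" and x: "x \<in># z" "E x = 2" "other x \<in># z"
  shows "count z x = 1"
proof -
  obtain v where v: "z = {#x, other x#} + v" "\<And>x'. x' \<in># v \<Longrightarrow> E x' = 1"
    by (rule pair_count[OF assms]) (rule that)
  have "x \<notin># v" using v(2)[of x] x(2) by auto
  then have "count v x = 0" by (rule iffD1[OF not_in_iff])
  then show ?thesis using v(1) fibre_kappa(2)[OF F_D(1)[OF over_y_F[OF z x(1)]]] by simp
qed

text \<open>
  If \<open>z\<close> has no pair of conjugate members above a ramification point, then the chart can be the coordinate of
  \<open>Y\<close>; this is what \<open>E x = 1\<close> says.
\<close>

lemma some_chart:
  assumes z: "over_y z"
  obtains x where "x \<in># z" "count z x = 1" "(Nb z, read x) \<in> charts (Ctilde_surface T X Y \<kappa> \<rho> n)"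
    "E x > 0" "(\<forall>x1\<in>#z. E x1 = 2 \<longrightarrow> other x1 \<notin># z) \<longrightarrow> E x = 1"
proof (cases "\<exists>x1\<in>#z. E x1 = 2 \<and> other x1 \<in># z")
  case True
  then obtain x1 where x1: "x1 \<in># z" "E x1 = 2" "other x1 \<in># z" by blast
  show thesis
    by (rule that[OF x1(1) count_pair[OF z x1] chart_ramified[OF z x1]]) (use x1 in auto)
next
  case False
  obtain x where x: "x \<in># z" "E x = 1" by (rule simple_point_exists[OF z]) (rule that)
  show thesis
    using that[OF x(1) simple_point_unique(1)[OF z x] chart_simple_point[OF z x]] False x(2) by auto
qed

text \<open>
  In the charts around \<open>z\<close> and its flip, given by simple members \<open>a\<close> and \<open>b\<close>, the local equation of \<open>D\<close> has
  to be checked only on a divisor near \<open>z\<close> and its flips in members near \<open>x\<close>.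
\<close>

lemma C_multiplicity_eqI:
  assumes z: "over_y z" and x: "x \<in># z"
    and a: "a \<in># z" "count z a = 1" "(Nb z, read a) \<in> charts (Ctilde_surface T X Y \<kappa> \<rho> n)"
    and b: "b \<in># flip x z" "count (flip x z) b = 1" "(Nb (flip x z), read b) \<in> charts (Ctilde_surface T X Y \<kappa> \<rho> n)"
    and i: "i > 0"
    and equation: "\<And>z1 q. z1 \<in> Nb z \<Longrightarrow> flip q z1 \<in> Nb (flip x z) \<Longrightarrow> q \<in># z1 \<Longrightarrow> centre q = x \<Longrightarrow>
      read a z1 ^ i = read b (flip q z1) ^ m"
    and lower: "\<And>U s V t W g. (U, s) \<in> charts C \<Longrightarrow> (V, t) \<in> charts C \<Longrightarrow> orbit z \<in> U \<Longrightarrow> orbit (flip x z) \<in> V \<Longrightarrow> open W \<Longrightarrow>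
      (s (orbit z), t (orbit (flip x z))) \<in> W \<Longrightarrow> holomorphic_on2 g W \<Longrightarrow>
      (\<And>a b. a \<in> U \<Longrightarrow> b \<in> V \<Longrightarrow> (a, b) \<in> DC \<Longrightarrow> (s a, t b) \<in> W \<Longrightarrow> g (s a, t b) = 0) \<Longrightarrow>
      \<exists>\<^sub>F u in at (t (orbit (flip x z))). g (s (orbit z), u) \<noteq> 0 \<Longrightarrow>
      int m \<le> zorder (\<lambda>u. g (s (orbit z), u)) (t (orbit (flip x z)))"
  shows "fibre_multiplicity C DC (orbit z) (orbit (flip x z)) = m"
proof -
  have f: "over_y (flip x z)" by (rule over_y_flip[OF z x])
  show ?thesis
  proof (rule fibre_multiplicity_eqI[OF chart_of_C[OF z a(3)] _ _ chart_of_C[OF f b(3)] _ _ i _ lower])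
    show "orbit z \<in> orbit ` Nb z" "orbit (flip x z) \<in> orbit ` Nb (flip x z)"
      using Nb_self[OF z] Nb_self[OF f] by auto
    show "read a (inv_into (Nb z) orbit (orbit z)) = 0"
      using inv_orbit[OF z Nb_self[OF z]] read_centre[OF z a(1,2)] by simp
    show "read b (inv_into (Nb (flip x z)) orbit (orbit (flip x z))) = 0"
      using inv_orbit[OF f Nb_self[OF f]] read_centre[OF f b(1,2)] by simp
    fix c d assume "c \<in> orbit ` Nb z" "d \<in> orbit ` Nb (flip x z)" and D: "(c, d) \<in> DC"
    then obtain z1 f1 where z1: "z1 \<in> Nb z" "c = orbit z1" and f1: "f1 \<in> Nb (flip x z)" "d = orbit f1" by blast
    obtain q where q: "q \<in># z1" "centre q = x" "f1 = flip q z1"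
      by (rule D_near[OF z x z1(1) f1(1)]) (use D z1 f1 that in simp_all)
    show "read a (inv_into (Nb z) orbit c) ^ i = read b (inv_into (Nb (flip x z)) orbit d) ^ m"
      using equation[OF z1(1) _ q(1,2)] f1 q(3) inv_orbit[OF z z1(1)] inv_orbit[OF f f1(1)] z1(2) by simp
  qed
qed

text \<open>
  If the flipped divisor is parametrised by \<open>Y\<close>, then the local equation says that both divisors lie over
  the same point of \<open>Y\<close>. Otherwise both divisors contain the pair of points above the ramification point.
  The flip then conjugates the member near \<open>x1\<close>, and its conjugate has the same parameter.
\<close>

lemma multiplicity_simple:
  assumes z: "over_y z" and x: "x \<in># z" "count z x = 1"
  shows "fibre_multiplicity C DC (orbit z) (orbit (flip x z)) = 1"
proof -
  have f: "over_y (flip x z)" by (rule over_y_flip[OF z x(1)])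
  have Dmem: "(orbit z, orbit (flip x z)) \<in> DC" using D_curve_iff[OF over_y_Ct[OF z]] x(1) by blast
  have q_flip: "q \<in># flip q z1" for q z1 by (simp add: flip_def)
  show ?thesis
  proof (cases "\<forall>x1\<in>#flip x z. E x1 = 2 \<longrightarrow> other x1 \<notin># flip x z")
    case True
    obtain a where a: "a \<in># z" "count z a = 1" "(Nb z, read a) \<in> charts (Ctilde_surface T X Y \<kappa> \<rho> n)" "E a > 0"
      by (rule some_chart[OF z]) (rule that)
    obtain b where b: "b \<in># flip x z" "count (flip x z) b = 1"
        "(Nb (flip x z), read b) \<in> charts (Ctilde_surface T X Y \<kappa> \<rho> n)"
        "(\<forall>x1\<in>#flip x z. E x1 = 2 \<longrightarrow> other x1 \<notin># flip x z) \<longrightarrow> E b = 1"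
      by (rule some_chart[OF f]) (rule that)
    have Eb: "E b = 1" using b(4) True by blast
    show ?thesis
    proof (rule C_multiplicity_eqI[OF z x(1) a(1-3) b(1-3) a(4)])
      show "read a z1 ^ E a = read b (flip q z1) ^ 1"
        if "z1 \<in> Nb z" "flip q z1 \<in> Nb (flip x z)" "q \<in># z1" for z1 q
        using read_power[OF that(1) a(1,2) that(3)] read_power[OF that(2) b(1,2) q_flip] Eb by simp
    qed (rule multiplicity_lower_1[OF Dmem], assumption+)
  next
    case False
    then obtain x1 where x1: "x1 \<in># flip x z" "E x1 = 2" "other x1 \<in># flip x z" by blast
    obtain w where w: "z = add_mset x w" using x(1) by (metis multi_member_split)
    have wF: "v \<in> F" if "v \<in># w" for v using over_y_F[OF z] w that by simp
    have x1F: "x1 \<in> F" by (rule over_y_F[OF f x1(1)])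
    have other_mem: "v \<in># primed w \<longleftrightarrow> other v \<in># w" if "v \<in> F" for v
    proof
      assume "v \<in># primed w"
      then obtain u where "u \<in># w" "v = other u" by (auto simp: conj_divisor_def)
      then show "other v \<in># w" using other_other F_D(1)[OF wF] by simp
    next
      assume "other v \<in># w"
      then show "v \<in># primed w" using other_other[OF F_D(1)[OF that]] by (force simp: conj_divisor_def)
    qed
    (* Otherwise x is a simple member above the ramification point, and flip x z contains x twice, but not other x. *)
    have E1: "E x = 1"
    proof (rule ccontr)
      assume "E x \<noteq> 1"
      then have E2: "E x = 2" using E_cases over_y_F[OF z x(1)] by blast
      obtain x2 v where v: "z = {#x, x2#} + v" "\<kappa> x2 = \<kappa> x" and simple: "\<And>x'. x' \<in># v \<Longrightarrow> E x' = 1"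
        by (rule over_y_ramified[OF z x(1) E2]) (rule that)
      have xF: "x \<in> F" using over_y_F[OF z x(1)] .
      have x2F: "x2 \<in> F" using over_y_F[OF z] v(1) by simp
      have "x2 \<in> fibre T \<kappa> (\<kappa> x)" using v(2) F_D(1)[OF x2F] by (simp add: fibre_def)
      moreover have "x2 \<noteq> x" using x(2) v(1) by auto
      ultimately have "x2 = other x" using fibre_kappa(1)[OF F_D(1)[OF xF]] by blast
      then have fl: "flip x z = {#x, x#} + primed v" using v(1) other_other[OF F_D(1)[OF xF]] by simp
      have simple': "E u = 1" if "u \<in># primed v" for u
      proof -
        obtain u' where "u' \<in># v" "u = other u'" using \<open>u \<in># primed v\<close> by (auto simp: conj_divisor_def)
        then show ?thesis using simple[of u'] F_D(4)[of u'] over_y_F[OF z] v(1) by simp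
      qed
      have "x1 = x" using x1(1,2) fl simple'[of x1] by auto
      moreover have "other x1 = x" using x1(2,3) fl simple'[of "other x1"] F_D(4)[OF x1F] by auto
      ultimately show False using fibre_kappa(2)[OF F_D(1)[OF x1F]] by simp
    qed
    have "x1 \<noteq> x" "other x1 \<noteq> x" using E1 x1(2) F_D(4)[OF x1F] by auto
    then have "x1 \<in># primed w" "other x1 \<in># primed w" using x1 w by auto
    then have xw: "other x1 \<in># w" "x1 \<in># w"
      using other_mem[OF x1F] other_mem[OF F_D(3)[OF x1F]] other_other[OF F_D(1)[OF x1F]] by auto
    then have xz: "x1 \<in># z" "other x1 \<in># z" using w by auto
    have E2': "E (other x1) = 2" using F_D(4)[OF x1F] x1(2) by simp
    have pair': "other (other x1) \<in># flip x z" using x1(1) other_other[OF F_D(1)[OF x1F]] by simp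
    have cz: "count z x1 = 1" by (rule count_pair[OF z xz(1) x1(2) xz(2)])
    have cf: "count (flip x z) (other x1) = 1" by (rule count_pair[OF f x1(3) E2' pair'])
    show ?thesis
    proof (rule C_multiplicity_eqI[OF z x(1) xz(1) cz chart_ramified[OF z xz(1) x1(2) xz(2)]
          x1(3) cf chart_ramified[OF f x1(3) E2' pair'] zero_less_one])
      fix z1 q assume z1: "z1 \<in> Nb z" and f1: "flip q z1 \<in> Nb (flip x z)" and q: "q \<in># z1" "centre q = x"
      obtain q1 where q1: "q1 \<in># z1" "centre q1 = x1" "read x1 z1 = coord q1"
        by (rule read_point[OF z1 xz(1) cz]) (rule that)
      have q1t: "q1 \<in> tube" using Nb_D(2)[OF z1] q1(1) by blast
      obtain v where v: "z1 = add_mset q v" using q(1) by (metis multi_member_split)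
      have "q1 \<noteq> q" using q1 q \<open>x1 \<noteq> x\<close> by auto
      then have "q1 \<in># v" using q1(1) v by simp
      then have mem: "other q1 \<in># flip q z1" using v by (simp add: conj_divisor_def)
      have "read (other x1) (flip q z1) = coord (other q1)"
        using mem tube_other(2)[OF q1t] q1(2) cf Nb_D(3)[OF f1] by (intro read_eq) auto
      then show "read x1 z1 ^ 1 = read (other x1) (flip q z1) ^ 1"
        using tube_other(3)[OF q1t] q1(3) by simp
    qed (rule multiplicity_lower_1[OF Dmem], assumption+)
  qed
qed

lemma primed_ramified_family:
  assumes x: "x1 \<in> F" "x2 \<in> F" "E x1 = 2" "E x2 = 2" and v: "\<forall>x\<in>#v. x \<in> F \<and> E x = 1" and b: "b \<in> Dom 2"
  shows "primed (ramified_family x1 x2 v b) = ramified_family (other x1) (other x2) (primed v) b"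
    and "primed (simple_family v (b\<^sup>2)) = simple_family (primed v) (b\<^sup>2)"
proof -
  have "image_mset (\<lambda>x. other (s x (b\<^sup>2))) v = image_mset (\<lambda>x. s (other x) (b\<^sup>2)) v"
    by (rule image_mset_cong) (use v Dom_square(1)[OF b] other_s in auto)
  then show *: "primed (simple_family v (b\<^sup>2)) = simple_family (primed v) (b\<^sup>2)"
    by (simp add: simple_family_def conj_divisor_def multiset.map_comp o_def)
  show "primed (ramified_family x1 x2 v b) = ramified_family (other x1) (other x2) (primed v) b"
    using other_s[OF x(1)] other_s[OF x(2)] x b Dom_square(2)[OF b] * by (simp add: ramified_family_def)
qed

lemma ramified_family_0:
  assumes "x1 \<in> F" "x2 \<in> F" "\<forall>x\<in>#v. x \<in> F"
  shows "ramified_family x1 x2 v 0 = {#x1, x2#} + v"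
proof -
  have "image_mset (\<lambda>x. s x 0) v = image_mset id v"
    by (rule image_mset_cong) (use assms s_0 in auto)
  then show ?thesis using assms s_0 by (simp add: ramified_family_def simple_family_def)
qed

text \<open>
  A chart of \<open>C\<close> comes from a chart of the fibre product around either representative of the orbit. Both
  the family and its conjugate are families of the same kind, so the representative may be chosen to
  suit the chart.
\<close>

lemma path_in_C_chart:
  assumes chart: "(U, t) \<in> charts C" "orbit \<zeta> \<in> U"
    and z: "over_y \<zeta>" "\<zeta> = {#x1, x2#} + v" and \<kappa>: "\<kappa> x2 = \<kappa> x1" "E x1 = 2" and simple: "\<And>x. x \<in># v \<Longrightarrow> E x = 1"
    and \<eta>: "\<eta> > 0"
  obtains \<delta> where "\<delta> > 0" "\<And>b. norm b < \<delta> \<Longrightarrow> b \<in> Dom 2 \<and> orbit (ramified_family x1 x2 v b) \<in> U \<and>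
    dist (t (orbit (ramified_family x1 x2 v b))) (t (orbit \<zeta>)) < \<eta>"
proof -
  have x: "x1 \<in> F" "x2 \<in> F" "E x2 = 2" using over_y_F[OF z(1)] z(2) \<kappa> by auto
  have vF: "\<forall>x\<in>#v. x \<in> F \<and> E x = 1" using simple over_y_F[OF z(1)] z(2) by auto
  have zCt: "\<zeta> \<in> Ct" by (rule over_y_Ct[OF z(1)])
  obtain U' t' where U': "(U', t') \<in> charts (Ctilde_surface T X Y \<kappa> \<rho> n)" "inj_on orbit U'"
    "U = orbit ` U'" "t = (\<lambda>c. t' (inv_into U' orbit c))"
    using chart(1) unfolding C_surface_def by auto
  have oU': "openin CT U'" and hom: "homeomorphic_map (subtopology CT U') (top_of_set (t' ` U')) t'"
    using U'(1) by (auto simp: Ctilde_surface_def)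
  have inv: "inv_into U' orbit (orbit \<psi>) = \<psi>" if "\<psi> \<in> U'" for \<psi> using U'(2) that by simp
  have U'Ct: "U' \<subseteq> Ct"
    using oU' openin_subset CtD unfolding Ctilde_topology_def by fastforce
  have top_sub: "topspace (subtopology CT U') = U'" using openin_subset[OF oU'] by auto
  obtain \<psi>0 where \<psi>0: "\<psi>0 \<in> U'" "orbit \<psi>0 = orbit \<zeta>" using chart(2) U'(3) by auto
  obtain \<Psi> where \<Psi>: "continuous_map (top_of_set (Dom 2)) CT \<Psi>" "\<Psi> 0 = \<psi>0"
    "\<And>b. b \<in> Dom 2 \<Longrightarrow> orbit (\<Psi> b) = orbit (ramified_family x1 x2 v b)"
  proof -
    have cont: "continuous_map (top_of_set (Dom 2)) CT (ramified_family a b u)"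
      if "over_y w" "w = {#a, b#} + u" "\<kappa> b = \<kappa> a" "E a = 2" "\<And>x. x \<in># u \<Longrightarrow> E x = 1" for w a b u
      unfolding Ctilde_topology_def continuous_map_in_subtopology
      using continuous_ramified_family[OF that] ramified_family_Nb[OF that] Nb_D(1) by auto
    have "\<psi>0 = \<zeta> \<or> \<psi>0 = primed \<zeta>" using \<psi>0(2) orbit_eq_iff[OF zCt] by metis
    then show thesis
    proof
      assume "\<psi>0 = \<zeta>"
      then show thesis
        using that[of "ramified_family x1 x2 v"] cont[OF z \<kappa> simple] ramified_family_0[OF x(1,2)] vF z(2) by simp
    next
      assume \<psi>: "\<psi>0 = primed \<zeta>"
      have p: "over_y (primed \<zeta>)" "primed \<zeta> = {#other x1, other x2#} + primed v"
        using over_y_primed[OF z(1)] z(2) by simp_all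
      have pv: "E u = 1" "u \<in> F" if "u \<in># primed v" for u
      proof -
        obtain u' where u': "u' \<in># v" "u = other u'" using \<open>u \<in># primed v\<close> by (auto simp: conj_divisor_def)
        then show "E u = 1" "u \<in> F" using vF F_D(3,4)[of u'] by auto
      qed
      have \<kappa>': "\<kappa> (other x2) = \<kappa> (other x1)" "E (other x1) = 2"
        using \<kappa> kappa_other F_D(1)[OF x(1)] F_D(1)[OF x(2)] by simp_all
      show thesis
      proof (rule that)
        show "continuous_map (top_of_set (Dom 2)) CT (ramified_family (other x1) (other x2) (primed v))"
          by (rule cont[OF p \<kappa>' pv(1)])
        show "ramified_family (other x1) (other x2) (primed v) 0 = \<psi>0"
          using ramified_family_0[OF F_D(3)[OF x(1)] F_D(3)[OF x(2)], of "primed v"] pv(2) p(2) \<psi> by simp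
        show "orbit (ramified_family (other x1) (other x2) (primed v) b) = orbit (ramified_family x1 x2 v b)"
          if b: "b \<in> Dom 2" for b
          using primed_ramified_family(1)[OF x(1,2) \<kappa>(2) x(3) vF b]
            orbit_primed[OF Nb_D(1)[OF ramified_family_Nb[OF z \<kappa> simple b]]] by simp
      qed
    qed
  qed
  define N where "N = {\<psi> \<in> U'. t' \<psi> \<in> ball (t' \<psi>0) \<eta>}"
  have "openin (subtopology CT U') {\<psi> \<in> topspace (subtopology CT U'). t' \<psi> \<in> t' ` U' \<inter> ball (t' \<psi>0) \<eta>}"
    using homeomorphic_imp_continuous_map[OF hom] by (rule openin_continuous_map_preimage) (auto simp: openin_open)
  moreover have "{\<psi> \<in> topspace (subtopology CT U'). t' \<psi> \<in> t' ` U' \<inter> ball (t' \<psi>0) \<eta>} = N"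
    unfolding top_sub by (auto simp: N_def)
  ultimately have "openin CT N" using oU' openin_trans_full by metis
  then have "openin (top_of_set (Dom 2)) {b \<in> topspace (top_of_set (Dom 2)). \<Psi> b \<in> N}"
    by (rule openin_continuous_map_preimage[OF \<Psi>(1)])
  then have "open {b \<in> Dom 2. \<Psi> b \<in> N}" using open_Dom by (auto intro: openin_open_trans)
  moreover have "0 \<in> {b \<in> Dom 2. \<Psi> b \<in> N}" using zero_in_Dom \<Psi>(2) \<psi>0(1) \<eta> by (simp add: N_def)
  ultimately obtain \<delta> where \<delta>: "\<delta> > 0" "ball 0 \<delta> \<subseteq> {b \<in> Dom 2. \<Psi> b \<in> N}" by (meson openE)
  show thesis
  proof (rule that[OF \<delta>(1)])
    fix b :: complex assume "norm b < \<delta>"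
    then have b: "b \<in> Dom 2" "\<Psi> b \<in> N" using \<delta>(2) by auto
    have "t (orbit (\<Psi> b)) = t' (\<Psi> b)" "t (orbit \<psi>0) = t' \<psi>0" "\<Psi> b \<in> U'"
      using b(2) inv \<psi>0(1) by (simp_all add: U'(4) N_def)
    then show "b \<in> Dom 2 \<and> orbit (ramified_family x1 x2 v b) \<in> U \<and>
        dist (t (orbit (ramified_family x1 x2 v b))) (t (orbit \<zeta>)) < \<eta>"
      using b \<Psi>(3)[OF b(1)] \<psi>0(2) by (auto simp: U'(3) N_def dist_commute)
  qed
qed

lemma C_chart_inj:
  assumes "(U, t) \<in> charts C" shows "inj_on t U"
proof -
  obtain U' t' where U': "(U', t') \<in> charts (Ctilde_surface T X Y \<kappa> \<rho> n)" "inj_on orbit U'"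
    "U = orbit ` U'" "t = (\<lambda>c. t' (inv_into U' orbit c))"
    using assms unfolding C_surface_def by auto
  have oU': "openin CT U'" and hom: "homeomorphic_map (subtopology CT U') (top_of_set (t' ` U')) t'"
    using U'(1) by (auto simp: Ctilde_surface_def)
  have "topspace (subtopology CT U') = U'" using openin_subset[OF oU'] by auto
  then have "inj_on t' U'" using hom by (simp add: homeomorphic_eq_everything_map)
  then show ?thesis using U'(2) unfolding U'(3,4) by (auto simp: inj_on_def)
qed

text \<open>
  The families satisfy \<open>flip (s x b) (Z b) = Z' b\<close>, where \<open>Z\<close> is even in \<open>b\<close> and \<open>Z'\<close> is not. So \<open>Z b\<close>
  corresponds to both \<open>Z' b\<close> and \<open>Z' (- b)\<close>.
\<close>

lemma multiplicity_double:
  assumes z: "over_y z" and zz: "z = {#x, x#} + v" and E2: "E x = 2" and simple: "\<And>x'. x' \<in># v \<Longrightarrow> E x' = 1"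
  shows "fibre_multiplicity C DC (orbit z) (orbit (flip x z)) = 2"
proof -
  have xz: "x \<in># z" using zz by simp
  have xF: "x \<in> F" by (rule over_y_F[OF z xz])
  have ox: "other x \<in> F" "E (other x) = 2" using F_D[OF xF] E2 by auto
  have vF: "\<forall>x\<in>#v. x \<in> F \<and> E x = 1" using simple over_y_F[OF z] zz by auto
  have f: "over_y (flip x z)" by (rule over_y_flip[OF z xz])
  have ff: "flip x z = {#x, other x#} + primed v" using zz by (simp add: add_mset_commute)
  have xf: "x \<in># flip x z" "other x \<in># flip x z" using ff by simp_all
  have fsimple: "E u = 1" if "u \<in># primed v" for u
  proof -
    obtain u' where u': "u' \<in># v" "u = other u'" using \<open>u \<in># primed v\<close> by (auto simp: conj_divisor_def)
    then show ?thesis using vF F_D(4)[of u'] by simp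
  qed
  have cf: "count (flip x z) x = 1" by (rule count_pair[OF f xf(1) E2 xf(2)])
  have "size z = n" using CtD(2)[OF over_y_Ct[OF z]] .
  then have "v \<noteq> {#}" using zz degree by auto
  then obtain a where a: "a \<in># v" by auto
  have Ea: "E a = 1" and az: "a \<in># z" using simple a zz by auto
  have ca: "count z a = 1" by (rule simple_point_unique(1)[OF z az Ea])
  have \<kappa>x: "\<kappa> (other x) = \<kappa> x" using kappa_other[OF F_D(1)[OF xF]] .
  have Z: "ramified_family x x v b \<in> Nb z" if "b \<in> Dom 2" for b
    by (rule ramified_family_Nb[OF z zz refl E2 simple that])
  have Z': "ramified_family x (other x) (primed v) b \<in> Nb (flip x z)" if "b \<in> Dom 2" for b
    by (rule ramified_family_Nb[OF f ff \<kappa>x E2 fsimple that])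
  have flip_Z: "flip (s x b) (ramified_family x x v b) = ramified_family x (other x) (primed v) b" if b: "b \<in> Dom 2" for b
  proof -
    have "other (s x (- b)) = s (other x) (- b)" using other_s[OF xF] Dom_square(2)[OF b] E2 by simp
    then show ?thesis
      using primed_ramified_family(2)[OF xF xF E2 E2 vF b] by (simp add: ramified_family_def add_mset_commute)
  qed
  have Dmem: "(orbit (ramified_family x x v b), orbit (ramified_family x (other x) (primed v) b)) \<in> DC" if b: "b \<in> Dom 2" for b
  proof -
    have "s x b \<in># ramified_family x x v b" by (simp add: ramified_family_def)
    then show ?thesis using D_curve_iff[OF Nb_D(1)[OF Z[OF b]]] flip_Z[OF b] by metis
  qed
  have no_pair: "other x1 \<notin># z" if "x1 \<in># z" "E x1 = 2" for x1
  proof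
    assume "other x1 \<in># z"
    moreover have "x1 = x" using that zz simple[of x1] by auto
    ultimately have "other x \<in># v" using zz fibre_kappa(2)[OF F_D(1)[OF xF]] by auto
    then show False using simple[of "other x"] ox(2) by simp
  qed
  show ?thesis
  proof (rule C_multiplicity_eqI[OF z xz az ca chart_simple_point[OF z az Ea no_pair] xf(1) cf chart_ramified[OF f xf(1) E2 xf(2)] zero_less_one])
    show "read a z1 ^ 1 = read x (flip q z1) ^ 2"
      if "z1 \<in> Nb z" "flip q z1 \<in> Nb (flip x z)" "q \<in># z1" for z1 q
    proof -
      have "q \<in># flip q z1" by (simp add: flip_def)
      then show ?thesis
        using read_power[OF that(1) az ca that(3)] read_power[OF that(2) xf(1) cf] Ea E2 by simp
    qed
  next
    fix U s' V t W g
    assume U: "(U, s') \<in> charts C" and V: "(V, t) \<in> charts C" and zU: "orbit z \<in> U" and fV: "orbit (flip x z) \<in> V"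
      and W: "open W" "(s' (orbit z), t (orbit (flip x z))) \<in> W" and g: "holomorphic_on2 g W"
      and vanish: "\<And>a b. a \<in> U \<Longrightarrow> b \<in> V \<Longrightarrow> (a, b) \<in> DC \<Longrightarrow> (s' a, t b) \<in> W \<Longrightarrow> g (s' a, t b) = 0"
      and freq: "\<exists>\<^sub>F u in at (t (orbit (flip x z))). g (s' (orbit z), u) \<noteq> 0"
    define p where "p = s' (orbit z)"
    define q where "q = t (orbit (flip x z))"
    obtain A B where AB: "open A" "open B" "p \<in> A" "q \<in> B" "A \<times> B \<subseteq> W"
      using W unfolding p_def q_def by (rule open_prod_elim[elim_format]) auto
    obtain \<eta>1 where \<eta>1: "\<eta>1 > 0" "ball p \<eta>1 \<subseteq> A" using AB by (meson openE)
    obtain \<eta>2 where \<eta>2: "\<eta>2 > 0" "ball q \<eta>2 \<subseteq> B" using AB by (meson openE)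
    have "deriv (\<lambda>u. g (p, u)) q = 0"
    proof (rule deriv_eq_0_if_two_zeros_collide[OF W(1) _ g])
      show "(p, q) \<in> W" using W by (simp add: p_def q_def)
      fix \<eta> :: real assume \<eta>: "\<eta> > 0"
      define \<epsilon> where "\<epsilon> = min \<eta> (min \<eta>1 \<eta>2)"
      have \<epsilon>: "\<epsilon> > 0" "\<epsilon> \<le> \<eta>" "\<epsilon> \<le> \<eta>1" "\<epsilon> \<le> \<eta>2" using \<eta> \<eta>1 \<eta>2 by (auto simp: \<epsilon>_def)
      obtain \<delta>1 where \<delta>1: "\<delta>1 > 0" "\<And>b. norm b < \<delta>1 \<Longrightarrow> b \<in> Dom 2 \<and> orbit (ramified_family x x v b) \<in> U \<and>
          dist (s' (orbit (ramified_family x x v b))) p < \<epsilon>"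
        by (rule path_in_C_chart[OF U zU z zz refl E2 simple \<epsilon>(1), folded p_def]) (assumption, rule that)
      obtain \<delta>2 where \<delta>2: "\<delta>2 > 0" "\<And>b. norm b < \<delta>2 \<Longrightarrow> b \<in> Dom 2 \<and> orbit (ramified_family x (other x) (primed v) b) \<in> V \<and>
          dist (t (orbit (ramified_family x (other x) (primed v) b))) q < \<epsilon>"
        by (rule path_in_C_chart[OF V fV f ff \<kappa>x E2 fsimple \<epsilon>(1), folded q_def]) (assumption, rule that)
      define b where "b = complex_of_real (min \<delta>1 \<delta>2 / 2)"
      have b: "norm b < \<delta>1" "norm b < \<delta>2" "b \<noteq> 0" using \<delta>1 \<delta>2 by (auto simp: b_def norm_divide)
      then have mb: "norm (- b) < \<delta>1" "norm (- b) < \<delta>2" by simp_all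
      define c where "c = orbit (ramified_family x x v b)"
      define d where "d = orbit (ramified_family x (other x) (primed v) b)"
      define d' where "d' = orbit (ramified_family x (other x) (primed v) (- b))"
      have c: "c \<in> U" "dist (s' c) p < \<epsilon>" using \<delta>1(2)[OF b(1)] by (simp_all add: c_def)
      have d: "d \<in> V" "dist (t d) q < \<epsilon>" "b \<in> Dom 2" using \<delta>2(2)[OF b(2)] by (simp_all add: d_def)
      have d': "d' \<in> V" "dist (t d') q < \<epsilon>" "- b \<in> Dom 2" using \<delta>2(2)[OF mb(2)] by (simp_all add: d'_def)
      have cd: "(c, d) \<in> DC" "(c, d') \<in> DC"
        using Dmem[OF d(3)] Dmem[OF d'(3)] by (simp_all add: c_def d_def d'_def ramified_family_minus)
      have in_W: "(s' c, t e) \<in> W" if "dist (t e) q < \<epsilon>" for e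
      proof -
        have "s' c \<in> A" using \<eta>1(2) c(2) \<epsilon> by (auto simp: dist_commute)
        moreover have "t e \<in> B" using \<eta>2(2) that \<epsilon> by (auto simp: dist_commute)
        ultimately show ?thesis using AB(5) by blast
      qed
      have "d \<noteq> d'"
      proof
        assume "d = d'"
        then have eq: "ramified_family x (other x) (primed v) b = ramified_family x (other x) (primed v) (- b)"
          using inj_onD[OF inj_on_orbit_Nb[OF f]] Z'[OF d(3)] Z'[OF d'(3)] by (simp add: d_def d'_def)
        have bE: "b \<in> Dom (E x)" "- b \<in> Dom (E x)" using d d' E2 by simp_all
        have "read x (ramified_family x (other x) (primed v) b) = coord (s x b)"
          using Nb_D(3)[OF Z'[OF d(3)]] cf centre_s[OF xF bE(1)] by (intro read_eq) (auto simp: ramified_family_def)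
        moreover have "read x (ramified_family x (other x) (primed v) (- b)) = coord (s x (- b))"
          using Nb_D(3)[OF Z'[OF d'(3)]] cf centre_s[OF xF bE(2)] by (intro read_eq) (auto simp: ramified_family_def)
        ultimately have "b = - b" using eq coord_s[OF xF bE(1)] coord_s[OF xF bE(2)] by simp
        then show False using b(3) by simp
      qed
      then have "t d \<noteq> t d'" using C_chart_inj[OF V] d(1) d'(1) by (auto dest: inj_onD)
      moreover have "g (s' c, t d) = 0" "g (s' c, t d') = 0"
        using vanish[OF c(1) d(1) cd(1) in_W[OF d(2)]] vanish[OF c(1) d'(1) cd(2) in_W[OF d'(2)]] .
      ultimately show "\<exists>s t t'. dist s p < \<eta> \<and> dist t q < \<eta> \<and> dist t' q < \<eta> \<and> t \<noteq> t' \<and> g (s, t) = 0 \<and> g (s, t') = 0"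
        using c(2) d(2) d'(2) \<epsilon>(2) by (intro exI[of _ "s' c"] exI[of _ "t d"] exI[of _ "t d'"]) auto
    qed
    moreover have "(orbit z, orbit (flip x z)) \<in> DC" using D_curve_iff[OF over_y_Ct[OF z]] xz by blast
    then have "g (p, q) = 0" using vanish[OF zU fV] W(2) by (simp add: p_def q_def)
    ultimately have "zorder (\<lambda>u. g (p, u)) q \<ge> 2"
      using analytic_slice[OF W g] freq by (intro zorder_ge_2I) (simp_all add: p_def q_def)
    then show "int 2 \<le> zorder (\<lambda>u. g (s' (orbit z), u)) (t (orbit (flip x z)))"
      by (simp add: p_def q_def)
  qed
qed

lemma multiplicity_eq_count:
  assumes z: "over_y z" and x: "x \<in># z"
  shows "fibre_multiplicity C DC (orbit z) (orbit (flip x z)) = count z x"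
proof (cases "count z x = 1")
  case True
  then show ?thesis using multiplicity_simple[OF z x] by simp
next
  case False
  then have "E x \<noteq> 1" using simple_point_unique(1)[OF z x] by blast
  then have E2: "E x = 2" using E_cases over_y_F[OF z x] by blast
  obtain x2 v where v: "z = {#x, x2#} + v" and simple: "\<And>x'. x' \<in># v \<Longrightarrow> E x' = 1"
    by (rule over_y_ramified[OF z x E2]) (rule that)
  have "x \<notin># v" using simple[of x] E2 by auto
  then have "count v x = 0" by (rule iffD1[OF not_in_iff])
  then have "x2 = x" "count z x = 2" using False v by (auto split: if_splits)
  then show ?thesis using multiplicity_double[OF z _ E2 simple] v by simp
qed

end

lemma (in covering_pair) multiplicity:
  assumes z: "z \<in> Ct" and x: "x \<in># z"
  shows "fibre_multiplicity (C_surface T X Y \<kappa> \<rho> n) (D_curve T X Y \<kappa> \<rho>) (orbit z) (orbit (flip x z)) = count z x"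
proof -
  obtain y where y_in: "y \<in> pts Y" and image: "image_mset \<kappa> z = pullback_divisor X Y \<rho> y" using CtD(4)[OF z] by blast
  obtain \<Gamma> \<gamma> R r s where "fibre_discs T X Y \<kappa> \<rho> n y \<Gamma> \<gamma> R r s" by (rule fibre_discs_exist[OF y_in])
  then interpret fibre_discs T X Y \<kappa> \<rho> n y \<Gamma> \<gamma> R r s .
  have "over_y z" using CtD(1)[OF z] image by (simp add: over_y_def)
  then show ?thesis by (rule multiplicity_eq_count[OF _ x])
qed

theorem theorem1:
  fixes X :: "'x surface" and Y :: "'y surface" and T :: "'t surface"
    and \<rho> :: "'x \<Rightarrow> 'y" and \<kappa> :: "'t \<Rightarrow> 'x" and n k :: nat
  assumes "compact_riemann_surface X" "connected_surface X"
    and "compact_riemann_surface Y" "connected_surface Y"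
    and "compact_riemann_surface T"
    and "k \<ge> 1" and "n = 2 * k + 1"
    and "covering X Y \<rho> n" and "ramified X Y \<rho>" and "simply_ramified X Y \<rho>"
    and "etale_double_cover T X \<kappa>"
    and "\<not> base_change_of_double_cover T X Y \<kappa> \<rho>"
    and "smooth_Ctilde T X Y \<kappa> \<rho> n"
    and "card (connected_components_of (Ctilde_topology T X Y \<kappa> \<rho> n)) = 2"
  shows "let P = (\<Prod>i\<le>k. [:(- 1) ^ (i + k + 1) * (2 * int i + 1), 1:]) in
    satisfies_equation (C_surface T X Y \<kappa> \<rho> n) (D_curve T X Y \<kappa> \<rho>) P \<and>
    (\<forall>r :: complex. order r (map_poly of_int P) \<le> 1)"
proof -
  interpret covering_pair T X Y \<kappa> \<rho> n
    using assms by unfold_locales (auto simp: compact_riemann_surface_def)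
  have "pts (C_surface T X Y \<kappa> \<rho> n) \<subseteq> orbit ` Ct"
    by (auto simp: C_surface_def topspace_quotient_topology Ctilde_topology_def)
  then have "satisfies_equation (C_surface T X Y \<kappa> \<rho> n) (D_curve T X Y \<kappa> \<rho>)
      (\<Prod>i\<le>k. [:(- 1) ^ (i + k + 1) * (2 * int i + 1), 1:])"
    using multiplicity assms(7) by (intro satisfies_equation_if_multiplicity)
  then show ?thesis unfolding Let_def using flip_polynomial_simple_roots by blast
qed

end
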